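(* Suppose that $\gamma_g=0$, or that $\gamma_g\ne0$ and $\chi_g\ne0$. Then the solutions of the system \[ \rho u_{tt}=\mu u_{xx}+b\phi_x,\quad J\phi_{tt}=\alpha\phi_{xx}-bu_x-\xi\phi-\beta\theta_x,\quad c\theta_t=-\beta\phi_{xt}+\int_0^{+\infty}\kappa(s)\eta_{xx}(x,s)ds,\quad \eta_t=\theta-\eta_s \] on $(0,\pi)\times(0,\infty)$ with boundary conditions $u=\phi_x=\theta=0$ at $x=0,\pi$ are not exponentially stable; that is, the contraction semigroup $S(t)=e^{-\mathcal At}$ on $\mathcal H$ generated by this problem is not exponentially stable (there are no constants $C,\omega>0$ with $\|S(t)U_0\|_{\mathcal H}\le Ce^{-\omega t}\|U_0\|_{\mathcal H}$ for all $U_0\in\mathcal H$, $t\ge0$).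
   Context: $\rho,J,c,\mu,b,\alpha,\xi$ are positive constants with $\mu\xi>b^2$; $\beta\ne0$ real. $\kappa:[0,\infty)\to\mathbb R$ satisfies (h1) $\kappa\in C([0,\infty))\cap L^1(0,\infty)$; (h2) $\kappa(s)>0$, $\kappa'(s)\le0$; (h3) $g(0):=\int_0^\infty\kappa(s)ds$; (h4) $\kappa'(s)\le-\delta\kappa(s)$ for some $\delta>0$. $\eta=\eta^t(x,s)=\int_0^s\theta(x,t-\tau)d\tau$. $\gamma_g=c\mu-\rho g(0)$ and, for $\gamma_g\ne0$, $\chi_g=\frac\rho\mu-\frac J\alpha+\frac{\rho\beta^2}{\alpha\gamma_g}$. The phase space is $\mathcal H=H^1_0(0,\pi)\times L^2(0,\pi)\times H^1_*(0,\pi)\times L^2(0,\pi)\times L^2(0,\pi)\times\mathcal V$, $H^1_*=\{f\in H^1(0,\pi):\int_0^\pi f=0\}$, $\mathcal V=L^2_\kappa((0,\infty);H^1_0(0,\pi))$, for $U=(u,v,\phi,\psi,\theta,\eta)$ with norm $\|U\|_{\mathcal H}^2=\mu\|u_x\|^2+\xi\|\phi\|^2+2b\langle\phi,u_x\rangle+\rho\|v\|^2+\alpha\|\phi_x\|^2+J\|\psi\|^2+c\|\theta\|^2+\int_0^\infty\kappa(s)\|\eta_x(s)\|^2ds$. The operator is $\mathcal AU=\big(-v,\ -\frac{\mu}{\rho}u_{xx}-\frac b\rho\phi_x,\ -\psi,\ -\frac\alpha J\phi_{xx}+\frac\xi J\phi+\frac bJu_x+\frac\beta J\theta_x,\ \frac\beta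 c\psi_x-\frac1c\int_0^\infty\kappa\eta_{xx}ds,\ -\theta+\eta_s\big)^T$ on $D(\mathcal A)=\{U\in\mathcal H: u,\phi\in H^2,\ v,\theta\in H^1_0,\ \psi\in H^1_*,\ \eta\in H^1_\kappa((0,\infty);H^1_0),\ \int_0^\infty\kappa\eta_{xx}ds\in L^2,\ \eta(0)=0\}$, so that the system reads $U_t+\mathcal AU=0$ with $v=u_t$, $\psi=\phi_t$.
   Formalization: The component ψ of the phase space is taken in mean-zero L² instead of L², and the boundary condition φ_x=0 is added to D(A); as written, D(A) (with ψ in H^1_* ) is not dense in H, so -A would generate no semigroup on H. *)

theory Defs
  imports "HOL-Analysis.Analysis"
begin

text \<open>Functions on (0,pi) are represented by real-valued functions on the reals;
only their values on (0,pi) matter, and all notions below are insensitive to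
changes on null sets (the norm is a seminorm on representatives).\<close>

record st =
  su :: "real \<Rightarrow> real"
  sv :: "real \<Rightarrow> real"
  sphi :: "real \<Rightarrow> real"
  spsi :: "real \<Rightarrow> real"
  stheta :: "real \<Rightarrow> real"
  seta :: "real \<Rightarrow> real \<Rightarrow> real"  (* seta U s x = eta(x,s) *)

definition st_lin :: "real \<Rightarrow> st \<Rightarrow> real \<Rightarrow> st \<Rightarrow> st" where
  "st_lin a U b W =
     \<lparr>su = (\<lambda>x. a * su U x + b * su W x),
      sv = (\<lambda>x. a * sv U x + b * sv W x),
      sphi = (\<lambda>x. a * sphi U x + b * sphi W x),
      spsi = (\<lambda>x. a * spsi U x + b * spsi W x),
      stheta = (\<lambda>x. a * stheta U x + b * stheta W x),
      seta = (\<lambda>s x. a * seta U s x + b * seta W s x)\<rparr>"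

definition L2 :: "(real \<Rightarrow> real) \<Rightarrow> bool" where
  "L2 f \<longleftrightarrow> set_borel_measurable lborel {0<..<pi} f \<and>
            set_integrable lborel {0<..<pi} (\<lambda>x. (f x)\<^sup>2)"

definition l2n :: "(real \<Rightarrow> real) \<Rightarrow> real" where
  "l2n f = (LINT x:{0<..<pi}|lborel. (f x)\<^sup>2)"

definition l2ip :: "(real \<Rightarrow> real) \<Rightarrow> (real \<Rightarrow> real) \<Rightarrow> real" where
  "l2ip f g = (LINT x:{0<..<pi}|lborel. f x * g x)"

definition L2star :: "(real \<Rightarrow> real) \<Rightarrow> bool" where
  "L2star f \<longleftrightarrow> L2 f \<and> (LINT x:{0<..<pi}|lborel. f x) = 0"

definition test_fun :: "(real \<Rightarrow> real) \<Rightarrow> bool" where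
  "test_fun \<phi> \<longleftrightarrow> (\<forall>n x. (deriv ^^ n) \<phi> differentiable (at x)) \<and>
     (\<exists>a b. 0 < a \<and> a \<le> b \<and> b < pi \<and> (\<forall>x. x \<notin> {a..b} \<longrightarrow> \<phi> x = 0))"

definition is_wd :: "(real \<Rightarrow> real) \<Rightarrow> (real \<Rightarrow> real) \<Rightarrow> bool" where
  "is_wd u g \<longleftrightarrow> L2 g \<and> (\<forall>\<phi>. test_fun \<phi> \<longrightarrow>
      (LINT x:{0<..<pi}|lborel. u x * deriv \<phi> x) = - (LINT x:{0<..<pi}|lborel. g x * \<phi> x))"

definition wd :: "(real \<Rightarrow> real) \<Rightarrow> (real \<Rightarrow> real)" where
  "wd u = (SOME g. is_wd u g)"

definition H1 :: "(real \<Rightarrow> real) \<Rightarrow> bool" where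
  "H1 u \<longleftrightarrow> L2 u \<and> (\<exists>g. is_wd u g)"

definition H10 :: "(real \<Rightarrow> real) \<Rightarrow> bool" where
  "H10 u \<longleftrightarrow> H1 u \<and> (\<forall>e>0. \<exists>\<phi>. test_fun \<phi> \<and>
      l2n (\<lambda>x. u x - \<phi> x) + l2n (\<lambda>x. wd u x - deriv \<phi> x) < e)"

definition H1star :: "(real \<Rightarrow> real) \<Rightarrow> bool" where
  "H1star u \<longleftrightarrow> H1 u \<and> (LINT x:{0<..<pi}|lborel. u x) = 0"

definition H2 :: "(real \<Rightarrow> real) \<Rightarrow> bool" where
  "H2 u \<longleftrightarrow> H1 u \<and> H1 (wd u)"

definition etanorm :: "(real \<Rightarrow> real) \<Rightarrow> (real \<Rightarrow> real \<Rightarrow> real) \<Rightarrow> real" where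
  "etanorm \<kappa> \<eta> = (LINT s:{0<..}|lebesgue. \<kappa> s * l2n (wd (\<eta> s)))"

definition inV :: "(real \<Rightarrow> real) \<Rightarrow> (real \<Rightarrow> real \<Rightarrow> real) \<Rightarrow> bool" where
  "inV \<kappa> \<eta> \<longleftrightarrow>
     set_borel_measurable lborel ({0<..} \<times> {0<..<pi}) (\<lambda>p::real\<times>real. \<eta> (fst p) (snd p)) \<and>
     (AE s in lborel. 0 < s \<longrightarrow> H10 (\<eta> s)) \<and>
     set_integrable lebesgue {0<..} (\<lambda>s. \<kappa> s * l2n (wd (\<eta> s)))"

definition inH :: "(real \<Rightarrow> real) \<Rightarrow> st \<Rightarrow> bool" where
  "inH \<kappa> U \<longleftrightarrow> H10 (su U) \<and> L2 (sv U) \<and> H1star (sphi U) \<and> L2star (spsi U) \<and>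
                 L2 (stheta U) \<and> inV \<kappa> (seta U)"

definition Hnorm :: "real \<Rightarrow> real \<Rightarrow> real \<Rightarrow> real \<Rightarrow> real \<Rightarrow> real \<Rightarrow> real \<Rightarrow>
                     (real \<Rightarrow> real) \<Rightarrow> st \<Rightarrow> real" where
  "Hnorm rho J c mu b alpha xi \<kappa> U = sqrt (
      mu * l2n (wd (su U)) + xi * l2n (sphi U) + 2 * b * l2ip (sphi U) (wd (su U))
    + rho * l2n (sv U) + alpha * l2n (wd (sphi U)) + J * l2n (spsi U)
    + c * l2n (stheta U) + etanorm \<kappa> (seta U))"

text \<open>zeta is the s-derivative of eta in V, with eta(0) = 0 (i.e. eta(s) = int_0^s zeta).\<close>
definition is_eta_s :: "(real \<Rightarrow> real) \<Rightarrow> (real \<Rightarrow> real \<Rightarrow> real) \<Rightarrow> (real \<Rightarrow> real \<Rightarrow> real) \<Rightarrow> bool" where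
  "is_eta_s \<kappa> \<eta> \<zeta> \<longleftrightarrow> inV \<kappa> \<zeta> \<and>
     (AE p in lborel. p \<in> {0<..} \<times> {0<..<pi} \<longrightarrow>
        \<eta> (fst p) (snd p) = (LINT r:{0..fst p}|lborel. \<zeta> r (snd p)))"

text \<open>h is the L^2 function equal (in the sense of distributions) to int_0^inf kappa(s) eta_xx(s) ds.\<close>
definition is_mem_int :: "(real \<Rightarrow> real) \<Rightarrow> (real \<Rightarrow> real \<Rightarrow> real) \<Rightarrow> (real \<Rightarrow> real) \<Rightarrow> bool" where
  "is_mem_int \<kappa> \<eta> h \<longleftrightarrow> L2 h \<and> (\<forall>w. test_fun w \<longrightarrow>
     (LINT s:{0<..}|lborel. \<kappa> s * (LINT x:{0<..<pi}|lborel. \<eta> s x * (deriv ^^ 2) w x)) = l2ip h w)"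

definition DA :: "(real \<Rightarrow> real) \<Rightarrow> st \<Rightarrow> bool" where
  "DA \<kappa> U \<longleftrightarrow> inH \<kappa> U \<and> H2 (su U) \<and> H2 (sphi U) \<and> H10 (wd (sphi U)) \<and>
     H10 (sv U) \<and> H10 (stheta U) \<and> H1star (spsi U) \<and>
     (\<exists>\<zeta>. is_eta_s \<kappa> (seta U) \<zeta>) \<and> (\<exists>h. is_mem_int \<kappa> (seta U) h)"

definition Aop :: "real \<Rightarrow> real \<Rightarrow> real \<Rightarrow> real \<Rightarrow> real \<Rightarrow> real \<Rightarrow> real \<Rightarrow> real \<Rightarrow>
                   (real \<Rightarrow> real) \<Rightarrow> st \<Rightarrow> st" where
  "Aop rho J c mu b alpha xi beta \<kappa> U =
    (let \<zeta> = (SOME \<zeta>. is_eta_s \<kappa> (seta U) \<zeta>); h = (SOME h. is_mem_int \<kappa> (seta U) h) in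
     \<lparr>su = (\<lambda>x. - sv U x),
      sv = (\<lambda>x. - (mu / rho) * wd (wd (su U)) x - (b / rho) * wd (sphi U) x),
      sphi = (\<lambda>x. - spsi U x),
      spsi = (\<lambda>x. - (alpha / J) * wd (wd (sphi U)) x + (xi / J) * sphi U x
                 + (b / J) * wd (su U) x + (beta / J) * wd (stheta U) x),
      stheta = (\<lambda>x. (beta / c) * wd (spsi U) x - (1 / c) * h x),
      seta = (\<lambda>s x. - stheta U x + \<zeta> s x)\<rparr>)"

text \<open>S is a C_0-semigroup of bounded linear operators on H (modulo null representatives)
  whose generator extends -A on D(A). Since -A generates a C_0-semigroup, this
  characterises S = e^{-At} uniquely.\<close>
definition generated_semigroup :: "real \<Rightarrow> real \<Rightarrow> real \<Rightarrow> real \<Rightarrow> real \<Rightarrow> real \<Rightarrow> real \<Rightarrow> real \<Rightarrow>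
     (real \<Rightarrow> real) \<Rightarrow> (real \<Rightarrow> st \<Rightarrow> st) \<Rightarrow> bool" where
  "generated_semigroup rho J c mu b alpha xi beta \<kappa> S \<longleftrightarrow>
     (let N = Hnorm rho J c mu b alpha xi \<kappa> in
      (\<forall>t\<ge>0. \<forall>U. inH \<kappa> U \<longrightarrow> inH \<kappa> (S t U)) \<and>
      (\<forall>t\<ge>0. \<forall>U W a b'. inH \<kappa> U \<longrightarrow> inH \<kappa> W \<longrightarrow>
          N (st_lin 1 (S t (st_lin a U b' W)) (-1) (st_lin a (S t U) b' (S t W))) = 0) \<and>
      (\<forall>t\<ge>0. \<exists>M. \<forall>U. inH \<kappa> U \<longrightarrow> N (S t U) \<le> M * N U) \<and>
      (\<forall>U. inH \<kappa> U \<longrightarrow> N (st_lin 1 (S 0 U) (-1) U) = 0) \<and>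
      (\<forall>t\<ge>0. \<forall>s\<ge>0. \<forall>U. inH \<kappa> U \<longrightarrow> N (st_lin 1 (S (t + s) U) (-1) (S t (S s U))) = 0) \<and>
      (\<forall>U. inH \<kappa> U \<longrightarrow> ((\<lambda>t. N (st_lin 1 (S t U) (-1) U)) \<longlongrightarrow> 0) (at_right 0)) \<and>
      (\<forall>U. DA \<kappa> U \<longrightarrow>
          ((\<lambda>h. N (st_lin (1 / h) (st_lin 1 (S h U) (-1) U) 1
                        (Aop rho J c mu b alpha xi beta \<kappa> U))) \<longlongrightarrow> 0) (at_right 0)))"

definition g0 :: "(real \<Rightarrow> real) \<Rightarrow> real" where
  "g0 \<kappa> = (LINT s:{0..}|lborel. \<kappa> s)"

definition gamma_g :: "real \<Rightarrow> real \<Rightarrow> real \<Rightarrow> (real \<Rightarrow> real) \<Rightarrow> real" where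
  "gamma_g rho c mu \<kappa> = c * mu - rho * g0 \<kappa>"

definition chi_g :: "real \<Rightarrow> real \<Rightarrow> real \<Rightarrow> real \<Rightarrow> real \<Rightarrow> real \<Rightarrow> (real \<Rightarrow> real) \<Rightarrow> real" where
  "chi_g rho J c mu alpha beta \<kappa> = rho / mu - J / alpha + rho * beta\<^sup>2 / (alpha * gamma_g rho c mu \<kappa>)"

end

theory Submission
  imports Defs
begin

text \<open>
  If the semigroup were exponentially stable, the resolvent would be bounded on the imaginary axis:
  for real states \<open>U\<close>, \<open>W\<close> in the domain and real \<open>l\<close>, the norms of \<open>U\<close> and \<open>W\<close> would be controlled by the norms of
  \<open>A U - l W\<close> and \<open>A W + l U\<close>, the real and imaginary part of \<open>(i l + A) (U + i W)\<close>, up to an additive constant.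
  This is violated along \<open>l = n sqrt (mu / rho)\<close> by states in the \<open>n\<close>-th Fourier mode with \<open>u = sin (n x)\<close>,
  \<open>\<phi> = (\<phi>\<^sub>0 / n) cos (n x)\<close> and \<open>\<theta> = \<theta>\<^sub>0 sin (n x)\<close>: their norm grows like \<open>n\<close>, while the residual is \<open>o(n)\<close> as soon as
  \<open>(alpha - J mu / rho) \<phi>\<^sub>0 + beta \<theta>\<^sub>0 = - b\<close> and \<open>gamma_g \<theta>\<^sub>0 = beta mu \<phi>\<^sub>0\<close>. This linear system is solvable
  exactly when \<open>gamma_g = 0\<close>, or \<open>gamma_g\<close> and \<open>chi_g\<close> are both nonzero.

  States are only representatives of classes: weak derivatives, the \<open>s\<close>-derivative of the memory
  variable and the memory integral are chosen by \<open>SOME\<close> and must be shown to be unique almost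
  everywhere, and the integral defining the memory norm is 0 for non-integrable functions, so the triangle
  inequality needs measurability of \<open>s \<mapsto> l2n (wd (\<eta> s))\<close>.
\<close>

section \<open>Square integrable functions on the interval\<close>

text \<open>The two scalar equations express the balance at leading order. With
  \<open>l^2 = n^2 mu / rho\<close> the terms of order \<open>n^2\<close> in the equation of
  \<open>u\<close> cancel, and those of order \<open>n\<close> in the equations of
  \<open>\<phi>\<close> and \<open>\<theta>\<close> cancel under these equations; the memory enters
  only through its mass \<open>g0 \<kappa>\<close>, since the kernel integrated against a profile
  concentrating at \<open>s = 0\<close> is negligible. All components except \<open>u\<close> and
  \<open>v\<close> stay bounded in norm, so the damped part takes too little energy out of the wave.
  For \<open>gamma_g\<close> nonzero, eliminating \<open>\<theta>\<close> leaves one equation for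
  \<open>\<phi>\<close> with coefficient \<open>alpha mu chi_g / rho\<close> and right-hand side
  \<open>- b\<close>. The semigroup is given by its algebraic laws, up to states of norm 0, and by
  its right derivative at 0 on the domain. The resolvent bound is therefore obtained by following a
  rotating real curve in small steps up to a fixed time at which the assumed decay has overcome
  \<open>C\<close>. The \<open>o(h)\<close> errors of the steps have no rate uniform in the states;
  they are absorbed in the additive constant, which is harmless because the norms of the modes
  grow.\<close>

definition ivl :: "real measure" where
  "ivl = restrict_space lborel {0<..<pi}"

lemma space_ivl [simp]: "space ivl = {0<..<pi}"
  by (simp add: ivl_def space_restrict_space)

lemma finite_measure_ivl: "finite_measure ivl"
  unfolding ivl_def
  by (rule finite_measureI) (simp add: emeasure_restrict_space space_restrict_space)

interpretation ivl: finite_measure ivl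
  by (rule finite_measure_ivl)

lemma measurable_ivl_iff:
  "f \<in> borel_measurable ivl \<longleftrightarrow> set_borel_measurable lborel {0<..<pi} (f :: real \<Rightarrow> real)"
  by (simp add: ivl_def set_borel_measurable_def borel_measurable_restrict_space_iff)

lemma integrable_ivl_iff:
  "integrable ivl f \<longleftrightarrow> set_integrable lborel {0<..<pi} (f :: real \<Rightarrow> real)"
  by (simp add: ivl_def set_integrable_def integrable_restrict_space)

lemma integral_ivl: "(LINT x:{0<..<pi}|lborel. f x) = (\<integral>x. f x \<partial>ivl)" for f :: "real \<Rightarrow> real"
  by (simp add: ivl_def set_lebesgue_integral_def integral_restrict_space)

lemma AE_ivl_iff: "(AE x in ivl. P x) \<longleftrightarrow> (AE x in lborel. 0 < x \<and> x < pi \<longrightarrow> P x)"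
  unfolding ivl_def by (subst AE_restrict_space_iff) auto

lemma AE_ivl_I: "(\<And>x. 0 < x \<Longrightarrow> x < pi \<Longrightarrow> P x) \<Longrightarrow> AE x in ivl. P x"
  by (rule AE_I2) simp

lemma borel_measurable_ivl: "f \<in> borel_measurable borel \<Longrightarrow> f \<in> borel_measurable ivl"
  unfolding ivl_def by (rule measurable_restrict_space1) simp

lemma L2_iff: "L2 f \<longleftrightarrow> f \<in> borel_measurable ivl \<and> integrable ivl (\<lambda>x. (f x)\<^sup>2)"
  by (simp add: L2_def measurable_ivl_iff integrable_ivl_iff)

lemma l2n_eq: "l2n f = (\<integral>x. (f x)\<^sup>2 \<partial>ivl)"
  by (simp add: l2n_def integral_ivl)

lemma l2ip_eq: "l2ip f g = (\<integral>x. f x * g x \<partial>ivl)"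
  by (simp add: l2ip_def integral_ivl)

lemma L2_measurable: "L2 f \<Longrightarrow> f \<in> borel_measurable ivl"
  by (simp add: L2_iff)

lemma L2_mult_integrable: "L2 f \<Longrightarrow> L2 g \<Longrightarrow> integrable ivl (\<lambda>x. f x * g x)"
proof (rule Bochner_Integration.integrable_bound[where f = "\<lambda>x. (f x)\<^sup>2 + (g x)\<^sup>2"])
  have "\<bar>u * v\<bar> \<le> u\<^sup>2 + v\<^sup>2" for u v :: real
  proof -
    have "0 \<le> (\<bar>u\<bar> - \<bar>v\<bar>)\<^sup>2" "0 \<le> u\<^sup>2 + v\<^sup>2" by auto
    then have "2 * \<bar>u * v\<bar> \<le> u\<^sup>2 + v\<^sup>2" by (simp add: power2_eq_square algebra_simps abs_mult)
    with abs_ge_zero[of "u * v"] show ?thesis by linarith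
  qed
  then show "AE x in ivl. norm (f x * g x) \<le> norm ((f x)\<^sup>2 + (g x)\<^sup>2)"
    by (intro AE_I2) (simp add: abs_mult)
qed (auto simp: L2_iff)

lemma L2_lin: 
  assumes "L2 f" "L2 g" shows "L2 (\<lambda>x. a * f x + b * g x)"
proof -
  have "(\<lambda>x. (a * f x + b * g x)\<^sup>2) = (\<lambda>x. a\<^sup>2 * (f x)\<^sup>2 + 2 * a * b * (f x * g x) + b\<^sup>2 * (g x)\<^sup>2)"
    by (auto simp: power2_eq_square algebra_simps)
  then show ?thesis
    using assms L2_mult_integrable[OF assms] by (auto simp: L2_iff)
qed

lemma L2_continuous: "continuous_on UNIV f \<Longrightarrow> L2 f"
proof -
  assume f: "continuous_on UNIV f"
  then have "compact (f ` {0..pi})"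
    by (intro compact_continuous_image) (auto intro: continuous_on_subset)
  then obtain B where B: "\<And>x. 0 \<le> x \<Longrightarrow> x \<le> pi \<Longrightarrow> \<bar>f x\<bar> \<le> B"
    by (force simp: bounded_iff dest!: compact_imp_bounded)
  have m: "f \<in> borel_measurable ivl"
    using f by (intro borel_measurable_ivl borel_measurable_continuous_onI)
  show "L2 f"
    unfolding L2_iff
  proof
    show "integrable ivl (\<lambda>x. (f x)\<^sup>2)"
    proof (rule ivl.integrable_const_bound[where B = "B\<^sup>2"])
      show "AE x in ivl. norm ((f x)\<^sup>2) \<le> B\<^sup>2"
        by (rule AE_ivl_I) (metis B abs_le_square_iff abs_of_nonneg abs_ge_zero order.trans
            less_imp_le norm_power power2_abs real_norm_def)
    qed (use m in auto)
  qed fact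
qed

lemma L2_const: "L2 (\<lambda>x. k)"
  by (rule L2_continuous) simp

lemma L2_integrable: "L2 f \<Longrightarrow> integrable ivl f"
  using L2_mult_integrable[OF _ L2_const, of f 1] by simp

lemma L2_diff: "L2 f \<Longrightarrow> L2 g \<Longrightarrow> L2 (\<lambda>x. f x - g x)"
  using L2_lin[of f g 1 "-1"] by simp

lemma l2n_nonneg: "0 \<le> l2n f"
  by (simp add: l2n_eq)

lemma l2ip_commute: "l2ip f g = l2ip g f"
  by (simp add: l2ip_eq mult.commute)

lemma l2ip_lin:
  "L2 f \<Longrightarrow> L2 g \<Longrightarrow> L2 h \<Longrightarrow> l2ip (\<lambda>x. a * f x + b * g x) h = a * l2ip f h + b * l2ip g h"
  using L2_mult_integrable[of f h] L2_mult_integrable[of g h]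
  by (simp add: l2ip_eq distrib_right mult.assoc)

lemma l2n_lin:
  assumes "L2 f" "L2 g"
  shows "l2n (\<lambda>x. a * f x + b * g x) = a\<^sup>2 * l2n f + 2 * a * b * l2ip f g + b\<^sup>2 * l2n g"
proof -
  have "(\<lambda>x. (a * f x + b * g x)\<^sup>2) = (\<lambda>x. a\<^sup>2 * (f x)\<^sup>2 + 2 * a * b * (f x * g x) + b\<^sup>2 * (g x)\<^sup>2)"
    by (auto simp: power2_eq_square algebra_simps)
  then show ?thesis
    using assms L2_mult_integrable[OF assms] by (simp add: L2_iff l2n_eq l2ip_eq)
qed

lemma l2n_cmult: "l2n (\<lambda>x. a * f x) = a\<^sup>2 * l2n f"
  by (simp add: l2n_eq power_mult_distrib)

text \<open>Discriminant bound, stated for numbers because it serves both \<open>l2ip\<close> and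
  the energy form, which are only semidefinite on representatives. If \<open>A = 0\<close>, the form
  is affine in \<open>s\<close>, which forces \<open>B = 0\<close>; otherwise evaluate at
  \<open>s = B\<close>, \<open>t = - A\<close> and divide by \<open>A\<close>.\<close>

lemma quadratic_form_CS:
  fixes A B C :: real
  assumes "\<And>s t. 0 \<le> s\<^sup>2 * A + 2 * s * t * B + t\<^sup>2 * C" "0 \<le> A" "0 \<le> C"
  shows "B\<^sup>2 \<le> A * C"
proof (cases "A = 0")
  case True
  have "B = 0"
  proof (rule ccontr)
    assume "B \<noteq> 0"
    have "0 \<le> 2 * (- (C + 1) / (2 * B)) * B + C"
      using assms(1)[of "- (C + 1) / (2 * B)" 1] True by simp
    then show False using \<open>B \<noteq> 0\<close> by (simp add: field_simps)
  qed
  then show ?thesis using True by simp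
next
  case False
  then have "A > 0" using assms by simp
  have "0 \<le> B\<^sup>2 * A + 2 * B * (- A) * B + A\<^sup>2 * C"
    using assms(1)[of B "- A"] by simp
  then have "A * B\<^sup>2 \<le> A * (A * C)" by (simp add: power2_eq_square algebra_simps)
  then show ?thesis using \<open>A > 0\<close> by simp
qed

lemma l2ip_CS:
  assumes "L2 f" "L2 g" shows "(l2ip f g)\<^sup>2 \<le> l2n f * l2n g"
proof (rule quadratic_form_CS)
  fix s t
  show "0 \<le> s\<^sup>2 * l2n f + 2 * s * t * l2ip f g + t\<^sup>2 * l2n g"
    using l2n_nonneg[of "\<lambda>x. s * f x + t * g x"] l2n_lin[OF assms] by simp
qed (simp_all add: l2n_nonneg)

lemma l2n_add_le:
  assumes "L2 f" "L2 g" shows "l2n (\<lambda>x. a * f x + b * g x) \<le> 2 * a\<^sup>2 * l2n f + 2 * b\<^sup>2 * l2n g"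
  using l2n_nonneg[of "\<lambda>x. a * f x + (- b) * g x"] l2n_lin[OF assms, of a b] l2n_lin[OF assms, of a "- b"]
  by (simp add: algebra_simps)

lemma l2n_diff_triangle:
  assumes "L2 f" "L2 g" "L2 h"
  shows "l2n (\<lambda>x. f x - h x) \<le> 2 * l2n (\<lambda>x. f x - g x) + 2 * l2n (\<lambda>x. g x - h x)"
  using l2n_add_le[OF L2_diff[OF assms(1,2)] L2_diff[OF assms(2,3)], of 1 1] by simp

lemma l2n_zero_iff: "L2 f \<Longrightarrow> l2n f = 0 \<longleftrightarrow> (AE x in ivl. f x = 0)"
  by (simp add: l2n_eq L2_iff integral_nonneg_eq_0_iff_AE)

lemma l2n_cong_AE: "L2 f \<Longrightarrow> L2 g \<Longrightarrow> AE x in ivl. f x = g x \<Longrightarrow> l2n f = l2n g"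
  unfolding l2n_eq by (intro integral_cong_AE) (auto simp: L2_iff)

lemma l2ip_cong_AE:
  "L2 f \<Longrightarrow> L2 g \<Longrightarrow> L2 h \<Longrightarrow> AE x in ivl. f x = g x \<Longrightarrow> l2ip f h = l2ip g h"
  unfolding l2ip_eq by (intro integral_cong_AE) (auto simp: L2_iff)

section \<open>Smooth functions and test functions\<close>

text \<open>Recursion through \<open>deriv f\<close> instead of the iterates in
  \<open>test_fun\<close>: closure under sums, products and affine substitution can then be proved
  by induction on \<open>n\<close> with the functions left arbitrary.\<close>

primrec diff_upto :: "nat \<Rightarrow> (real \<Rightarrow> real) \<Rightarrow> bool" where
  "diff_upto 0 f \<longleftrightarrow> (\<forall>x. f differentiable (at x))"
| "diff_upto (Suc n) f \<longleftrightarrow> (\<forall>x. f differentiable (at x)) \<and> diff_upto n (deriv f)"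

definition smooth :: "(real \<Rightarrow> real) \<Rightarrow> bool" where
  "smooth f \<longleftrightarrow> (\<forall>n. diff_upto n f)"

lemma diff_upto_iff: "diff_upto n f \<longleftrightarrow> (\<forall>k\<le>n. \<forall>x. (deriv ^^ k) f differentiable (at x))"
proof (induction n arbitrary: f)
  case (Suc n)
  show ?case
  proof (intro iffI allI impI)
    fix k x assume "diff_upto (Suc n) f" "k \<le> Suc n"
    then have *: "\<forall>x. f differentiable at x" "diff_upto n (deriv f)" "k \<le> Suc n" by auto
    show "(deriv ^^ k) f differentiable at x"
    proof (cases k)
      case (Suc j)
      then show ?thesis using * Suc.IH[of "deriv f"]
        by (simp del: funpow.simps add: funpow_Suc_right)
    qed (use * in simp)
  next
    assume *: "\<forall>k\<le>Suc n. \<forall>x. (deriv ^^ k) f differentiable at x"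
    then have "\<forall>k\<le>n. \<forall>x. (deriv ^^ k) (deriv f) differentiable at x"
      by (metis Suc_le_mono comp_apply funpow_Suc_right)
    then show "diff_upto (Suc n) f"
      using Suc.IH *[rule_format, of 0] by simp
  qed
qed simp

lemma smooth_iff: "smooth f \<longleftrightarrow> (\<forall>n x. (deriv ^^ n) f differentiable (at x))"
  unfolding smooth_def diff_upto_iff by auto

lemma diff_upto_DERIV: "diff_upto n f \<Longrightarrow> (f has_real_derivative deriv f x) (at x)"
  by (cases n) (auto simp: DERIV_deriv_iff_real_differentiable)

lemma diff_upto_SucI:
  assumes "\<And>x. (f has_real_derivative f' x) (at x)" "diff_upto n f'"
  shows "diff_upto (Suc n) f"
proof -
  have "deriv f = f'" using assms(1) by (auto intro: DERIV_imp_deriv)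
  then show ?thesis using assms by (auto simp: real_differentiable_def)
qed

lemma diff_upto_Suc_D: "diff_upto (Suc n) f \<Longrightarrow> diff_upto n f"
  by (simp add: diff_upto_iff del: diff_upto.simps)

lemma diff_upto_lin: "diff_upto n f \<Longrightarrow> diff_upto n g \<Longrightarrow> diff_upto n (\<lambda>x. a * f x + b * g x)"
proof (induction n arbitrary: f g)
  case 0
  then show ?case by auto
next
  case (Suc n)
  show ?case
  proof (rule diff_upto_SucI)
    show "((\<lambda>x. a * f x + b * g x) has_real_derivative a * deriv f x + b * deriv g x) (at x)" for x
      using Suc.prems[THEN diff_upto_DERIV] by (auto intro!: derivative_eq_intros)
    show "diff_upto n (\<lambda>x. a * deriv f x + b * deriv g x)"
      using Suc by auto
  qed
qed

lemma diff_upto_mult: "diff_upto n f \<Longrightarrow> diff_upto n g \<Longrightarrow> diff_upto n (\<lambda>x. f x * g x)"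
proof (induction n arbitrary: f g)
  case 0
  then show ?case by auto
next
  case (Suc n)
  show ?case
  proof (rule diff_upto_SucI)
    \<comment> \<open>The factors 1 bring the product rule into the shape required by
      \<open>diff_upto_lin\<close>.\<close>
    show "((\<lambda>x. f x * g x) has_real_derivative 1 * (deriv f x * g x) + 1 * (f x * deriv g x)) (at x)" for x
      using Suc.prems[THEN diff_upto_DERIV] by (auto intro!: derivative_eq_intros)
    show "diff_upto n (\<lambda>x. 1 * (deriv f x * g x) + 1 * (f x * deriv g x))"
      using Suc.IH Suc.prems Suc.prems[THEN diff_upto_Suc_D] by (intro diff_upto_lin) auto
  qed
qed

lemma diff_upto_affine: "diff_upto n f \<Longrightarrow> diff_upto n (\<lambda>x. f (a * x + b))"
proof (induction n arbitrary: f)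
  case 0
  have "((\<lambda>x. f (a * x + b)) has_real_derivative deriv f (a * x + b) * a) (at x)" for x
    by (rule DERIV_chain2[OF diff_upto_DERIV[OF 0]]) (auto intro!: derivative_eq_intros)
  then show ?case
    by (auto simp: real_differentiable_def)
next
  case (Suc n)
  show ?case
  proof (rule diff_upto_SucI)
    show "((\<lambda>x. f (a * x + b)) has_real_derivative a * deriv f (a * x + b) + 0 * deriv f (a * x + b)) (at x)" for x
      by (rule DERIV_cong[OF DERIV_chain2[OF diff_upto_DERIV[OF Suc.prems]]])
        (auto intro!: derivative_eq_intros)
    show "diff_upto n (\<lambda>x. a * deriv f (a * x + b) + 0 * deriv f (a * x + b))"
      using Suc.IH Suc.prems by (intro diff_upto_lin) auto
  qed
qed

lemma smooth_lin: "smooth f \<Longrightarrow> smooth g \<Longrightarrow> smooth (\<lambda>x. a * f x + b * g x)"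
  by (simp add: smooth_def diff_upto_lin)

lemma smooth_mult: "smooth f \<Longrightarrow> smooth g \<Longrightarrow> smooth (\<lambda>x. f x * g x)"
  by (simp add: smooth_def diff_upto_mult)

lemma smooth_affine: "smooth f \<Longrightarrow> smooth (\<lambda>x. f (a * x + b))"
  by (simp add: smooth_def diff_upto_affine)

lemma smooth_deriv: "smooth f \<Longrightarrow> smooth (deriv f)"
  unfolding smooth_def by (metis diff_upto.simps(2))

lemma smooth_DERIV: "smooth f \<Longrightarrow> (f has_real_derivative deriv f x) (at x)"
  using diff_upto_DERIV smooth_def by blast

lemma smooth_continuous: "smooth f \<Longrightarrow> continuous_on UNIV f"
  by (meson DERIV_isCont continuous_at_imp_continuous_on smooth_DERIV)

lemma smooth_sin: "smooth sin"
proof -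
  \<comment> \<open>The span of sine and cosine is closed under differentiation, so the induction is
    run on the whole span.\<close>
  have "diff_upto n (\<lambda>x. a * sin x + b * cos x)" for n a b
  proof (induction n arbitrary: a b)
    case 0
    have "((\<lambda>x. a * sin x + b * cos x) has_real_derivative (- b) * sin x + a * cos x) (at x)" for x
      by (auto intro!: derivative_eq_intros)
    then show ?case unfolding diff_upto.simps real_differentiable_def by blast
  next
    case (Suc n)
    show ?case
      by (rule diff_upto_SucI[OF _ Suc, of _ "- b" a]) (auto intro!: derivative_eq_intros)
  qed
  from this[of _ 1 0] show ?thesis by (simp add: smooth_def)
qed

text \<open>The classical \<open>exp (- 1 / x)\<close> with a power of \<open>1 / x\<close> in
  front. The power makes the family closed under differentiation up to linear combinations, so that
  smoothness of all members follows by a single induction with \<open>k\<close> arbitrary.\<close>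

definition flat :: "nat \<Rightarrow> real \<Rightarrow> real" where
  "flat k x = (if x > 0 then (1 / x) ^ k * exp (- 1 / x) else 0)"

lemma flat_tendsto_0: "(flat k \<longlongrightarrow> 0) (at 0)"
proof (rule filterlim_split_at)
  show "(flat k \<longlongrightarrow> 0) (at_left 0)"
    by (rule tendsto_eventually) (auto simp: flat_def eventually_at_filter)
  have "((\<lambda>x. inverse x ^ k / exp (inverse x)) \<longlongrightarrow> 0) (at_right (0::real))"
    by (rule filterlim_compose[OF tendsto_power_div_exp_0 filterlim_inverse_at_top_right])
  then show "(flat k \<longlongrightarrow> 0) (at_right 0)"
    by (rule Lim_transform_eventually)
      (auto simp: flat_def eventually_at_filter exp_minus field_simps)
qed

lemma flat_DERIV:
  "(flat k has_real_derivative (- real k) * flat (Suc k) x + 1 * flat (Suc (Suc k)) x) (at x)"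
proof -
  consider "x < 0" | "x = 0" | "x > 0" by linarith
  then show ?thesis
  proof cases
    case 1
    have "((\<lambda>_. 0) has_real_derivative 0) (at x)" by simp
    then have "(flat k has_real_derivative 0) (at x)"
      by (rule has_field_derivative_transform_within_open[of _ _ _ "{..<0}"]) (use 1 in \<open>auto simp: flat_def\<close>)
    then show ?thesis using 1 by (simp add: flat_def)
  next
    case 2
    \<comment> \<open>At 0 the difference quotient of \<open>flat k\<close> is
      \<open>flat (Suc k)\<close>, whose limit is already known.\<close>
    have "((\<lambda>h. (flat k (0 + h) - flat k 0) / h) \<longlongrightarrow> 0) (at 0)"
      by (rule Lim_transform_eventually[OF flat_tendsto_0[of "Suc k"]])
        (auto simp: flat_def eventually_at_filter field_simps)
    then show ?thesis using 2 by (simp add: DERIV_def flat_def)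
  next
    case 3
    have d: "((\<lambda>x. 1 / x) has_real_derivative - ((1 / x) ^ 2)) (at x)"
      using 3 by (auto intro!: derivative_eq_intros simp: power2_eq_square)
    have "((\<lambda>x. (1 / x) ^ k * exp (- (1 / x))) has_real_derivative
        real k * (- ((1 / x)\<^sup>2) * (1 / x) ^ (k - 1)) * exp (- (1 / x)) +
        exp (- (1 / x)) * - (- ((1 / x)\<^sup>2)) * (1 / x) ^ k) (at x)"
      using DERIV_mult[OF DERIV_power[OF d, of k] DERIV_fun_exp[OF DERIV_minus[OF d]]] by simp
    also have "real k * (- ((1 / x)\<^sup>2) * (1 / x) ^ (k - 1)) * exp (- (1 / x)) +
        exp (- (1 / x)) * - (- ((1 / x)\<^sup>2)) * (1 / x) ^ k =
        (- real k) * flat (Suc k) x + 1 * flat (Suc (Suc k)) x"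
      using 3 by (cases k) (simp_all add: flat_def power2_eq_square field_simps)
    finally have "((\<lambda>x. (1 / x) ^ k * exp (- 1 / x)) has_real_derivative
        (- real k) * flat (Suc k) x + 1 * flat (Suc (Suc k)) x) (at x)" by simp
    then show ?thesis
      by (rule has_field_derivative_transform_within_open[of _ _ _ "{0<..}"]) (use 3 in \<open>auto simp: flat_def\<close>)
  qed
qed

lemma smooth_flat: "smooth (flat k)"
proof -
  have "diff_upto n (flat k)" for n
  proof (induction n arbitrary: k)
    case 0
    show ?case using flat_DERIV by (auto simp: real_differentiable_def)
  next
    case (Suc n)
    show ?case
      by (rule diff_upto_SucI[OF flat_DERIV]) (intro diff_upto_lin Suc)
  qed
  then show ?thesis by (simp add: smooth_def)
qed

lemma flat_nonneg: "0 \<le> flat k x"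
  by (simp add: flat_def)

text \<open>A single term of the exponential series is at most \<open>exp (1 / x)\<close>. The
  resulting uniform bounds are what makes dominated convergence work in
  \<open>H10_sin\<close>.\<close>

lemma flat_le: "flat k x \<le> fact k"
proof (cases "x > 0")
  case True
  have "(1 / x) ^ k / fact k \<le> exp (1 / x)"
  proof -
    have "(\<Sum>n\<in>{k}. (1 / x) ^ n /\<^sub>R fact n) \<le> (\<Sum>n. (1 / x) ^ n /\<^sub>R fact n)"
      using True by (intro sum_le_suminf summable_exp_generic) auto
    then show ?thesis by (simp add: exp_def divide_inverse mult.commute)
  qed
  then show ?thesis
    using True by (simp add: flat_def exp_minus field_simps)
qed (simp add: flat_def)

lemma flat_0_le_1: "flat 0 x \<le> 1"
  using flat_le[of 0] by simp

lemma flat_0_tendsto_1: "(flat 0 \<longlongrightarrow> 1) at_top"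
proof (rule Lim_transform_eventually)
  show "((\<lambda>x::real. exp (- inverse x)) \<longlongrightarrow> 1) at_top"
    using tendsto_exp[OF tendsto_minus[OF tendsto_inverse_0_at_top[OF filterlim_ident]]] by simp
  show "\<forall>\<^sub>F x in at_top. exp (- inverse x) = flat 0 x"
    using eventually_gt_at_top[of 0] by eventually_elim (simp add: flat_def divide_inverse)
qed

section \<open>Test functions and smooth cutoffs\<close>

lemma test_fun_iff: "test_fun \<phi> \<longleftrightarrow> smooth \<phi> \<and>
     (\<exists>a b. 0 < a \<and> a \<le> b \<and> b < pi \<and> (\<forall>x. x \<notin> {a..b} \<longrightarrow> \<phi> x = 0))"
  by (simp add: test_fun_def smooth_iff)

lemma smooth_const: "smooth (\<lambda>_. k)"
proof -
  have "diff_upto n (\<lambda>_. k)" for n and k :: real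
    by (induction n arbitrary: k) auto
  then show ?thesis by (simp add: smooth_def)
qed

lemma test_fun_smooth: "test_fun \<phi> \<Longrightarrow> smooth \<phi>"
  by (simp add: test_fun_iff)

lemma test_fun_boundary: "test_fun \<phi> \<Longrightarrow> \<phi> 0 = 0" "test_fun \<phi> \<Longrightarrow> \<phi> pi = 0"
  unfolding test_fun_iff by force+

lemma test_fun_L2: "test_fun \<phi> \<Longrightarrow> L2 \<phi>"
  by (intro L2_continuous smooth_continuous test_fun_smooth)

lemma test_fun_L2_deriv: "test_fun \<phi> \<Longrightarrow> L2 (deriv \<phi>)"
  by (intro L2_continuous smooth_continuous smooth_deriv test_fun_smooth)

lemma test_fun_DERIV: "test_fun \<phi> \<Longrightarrow> (\<phi> has_real_derivative deriv \<phi> x) (at x)"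
  by (intro smooth_DERIV test_fun_smooth)

lemma test_fun_deriv_continuous: "test_fun \<phi> \<Longrightarrow> continuous_on UNIV (deriv \<phi>)"
  by (intro smooth_continuous smooth_deriv test_fun_smooth)

lemma test_fun_deriv: "test_fun \<phi> \<Longrightarrow> test_fun (deriv \<phi>)"
proof -
  assume \<phi>: "test_fun \<phi>"
  then obtain a b where ab: "0 < a" "a \<le> b" "b < pi" "\<And>x. x \<notin> {a..b} \<Longrightarrow> \<phi> x = 0"
    unfolding test_fun_iff by blast
  have "deriv \<phi> x = 0" if "x \<notin> {a..b}" for x
  proof (rule DERIV_imp_deriv)
    have "((\<lambda>_. 0) has_real_derivative 0) (at x)" by simp
    then show "(\<phi> has_real_derivative 0) (at x)"
      by (rule has_field_derivative_transform_within_open[of _ _ _ "- {a..b}"])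
        (use that ab in \<open>auto simp: open_Compl\<close>)
  qed
  then show ?thesis
    using ab \<phi> by (auto simp: test_fun_iff smooth_deriv)
qed

lemma test_fun_lin: "test_fun \<phi> \<Longrightarrow> test_fun \<psi> \<Longrightarrow> test_fun (\<lambda>x. a * \<phi> x + b * \<psi> x)"
proof -
  assume A: "test_fun \<phi>" "test_fun \<psi>"
  then obtain l u where 1: "0 < l" "l \<le> u" "u < pi" "\<And>x. x \<notin> {l..u} \<Longrightarrow> \<phi> x = 0"
    unfolding test_fun_iff by blast
  from A obtain l' u' where 2: "0 < l'" "l' \<le> u'" "u' < pi" "\<And>x. x \<notin> {l'..u'} \<Longrightarrow> \<psi> x = 0"
    unfolding test_fun_iff by blast
  have "a * \<phi> x + b * \<psi> x = 0" if "x \<notin> {min l l'..max u u'}" for x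
  proof -
    have "x \<notin> {l..u}" "x \<notin> {l'..u'}" using that by auto
    then show ?thesis using 1(4) 2(4) by simp
  qed
  moreover have "0 < min l l'" "min l l' \<le> max u u'" "max u u' < pi" using 1 2 by auto
  ultimately show ?thesis using A
    unfolding test_fun_iff by (blast intro: smooth_lin)
qed

lemma deriv_lin:
  "test_fun \<phi> \<Longrightarrow> test_fun \<psi> \<Longrightarrow> deriv (\<lambda>x. a * \<phi> x + b * \<psi> x) = (\<lambda>x. a * deriv \<phi> x + b * deriv \<psi> x)"
  by (rule ext, rule DERIV_imp_deriv) (auto intro!: derivative_eq_intros dest: test_fun_DERIV)

lemma test_fun_zero: "test_fun (\<lambda>x. 0)"
proof -
  have "0 < pi / 2" "pi / 2 < pi" by auto
  then show ?thesis
    unfolding test_fun_iff using smooth_const by (auto intro!: exI[of _ "pi / 2"])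
qed

text \<open>A product of two smooth steps that vanishes outside the interval from
  \<open>1 / Suc m\<close> to \<open>b - 1 / Suc m\<close>. It stays below 1 and tends to the
  indicator of \<open>(0,b)\<close> only because both arguments grow with \<open>m\<close>. The
  arguments have the affine form expected by \<open>smooth_affine\<close>.\<close>

definition cut :: "nat \<Rightarrow> real \<Rightarrow> real \<Rightarrow> real" where
  "cut m b x = flat 0 (real (Suc m) * x + (- 1)) * flat 0 ((- real (Suc m)) * x + (real (Suc m) * b - 1))"

lemma smooth_cut: "smooth (cut m b)"
  unfolding cut_def[abs_def] by (intro smooth_mult smooth_affine smooth_flat)

lemma test_fun_mult_cut:
  assumes "smooth f" "b \<le> pi" shows "test_fun (\<lambda>x. f x * cut m b x)"
proof -
  let ?l = "1 / real (Suc m)" let ?u = "b - 1 / real (Suc m)"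
  have *: "cut m b x = 0" if "x \<notin> {?l..?u}" for x
  proof -
    from that have "x \<le> ?l \<or> x \<ge> ?u" by auto
    then have "real (Suc m) * x + (- 1) \<le> 0 \<or> (- real (Suc m)) * x + (real (Suc m) * b - 1) \<le> 0"
      by (simp add: field_simps)
    then show ?thesis by (auto simp: cut_def flat_def)
  qed
  have sm: "smooth (\<lambda>x. f x * cut m b x)" using assms(1) smooth_cut by (rule smooth_mult)
  show ?thesis
  proof (cases "?l \<le> ?u")
    case True
    have "0 < ?l" by simp
    then have "?u < pi" using assms(2) by linarith
    with \<open>0 < ?l\<close> True * sm show ?thesis
      unfolding test_fun_iff by (intro conjI exI[of _ ?l] exI[of _ ?u]) auto
  \<comment> \<open>Here the two steps do not overlap. The definition of test functions asks for a
    nonempty support interval, so this case is treated as the zero function.\<close>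
  next
    case False
    then have "cut m b x = 0" for x by (intro *) auto
    then show ?thesis using test_fun_zero by simp
  qed
qed

lemma cut_bounds: "0 \<le> cut m b x" "cut m b x \<le> 1"
  unfolding cut_def by (intro mult_nonneg_nonneg flat_nonneg mult_le_one flat_0_le_1)+

lemma filterlim_Suc_affine:
  fixes x :: real assumes "0 < x" shows "filterlim (\<lambda>m. real (Suc m) * x + (- 1)) at_top sequentially"
  using filterlim_tendsto_add_at_top[OF tendsto_const[of "-1"]
      filterlim_tendsto_pos_mult_at_top[OF tendsto_const assms
        filterlim_compose[OF filterlim_real_sequentially filterlim_Suc]]]
  by (simp add: add.commute mult.commute)

lemma cut_tendsto: assumes "0 < x" "x \<noteq> b" shows "(\<lambda>m. cut m b x) \<longlonglongrightarrow> indicator {..b} x"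
proof (cases "x < b")
  case True
  have "(\<lambda>m. flat 0 (real (Suc m) * x + (- 1)) * flat 0 (real (Suc m) * (b - x) + (- 1))) \<longlonglongrightarrow> 1 * 1"
    using assms True
    by (intro tendsto_mult filterlim_compose[OF flat_0_tendsto_1] filterlim_Suc_affine) auto
  then show ?thesis using True by (simp add: cut_def algebra_simps)
next
  case False
  have "\<not> 0 < (- real (Suc m)) * x + (real (Suc m) * b - 1)" for m
  proof -
    have "real (Suc m) * b \<le> real (Suc m) * x"
      using False by (intro mult_left_mono) auto
    then show ?thesis unfolding mult_minus_left by linarith
  qed
  then have "cut m b x = 0" for m
    by (simp only: cut_def flat_def) simp
  then show ?thesis using False assms by simp
qed

section \<open>Fundamental lemma of the calculus of variations\<close>

lemma AE_zero_of_atMost: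
  fixes f :: "real \<Rightarrow> real"
  assumes f: "integrable lborel f" and 0: "\<And>a. (\<integral>x. indicator {..a} x * f x \<partial>lborel) = 0"
  shows "AE x in lborel. f x = 0"
proof (rule sigma_finite_measure.density_zero[OF sigma_finite_lborel f])
  have all: "(\<integral>x. f x \<partial>lborel) = 0"
  proof (rule LIMSEQ_unique)
    show "(\<lambda>n. \<integral>x. indicator {..real n} x * f x \<partial>lborel) \<longlonglongrightarrow> (\<integral>x. f x \<partial>lborel)"
    proof (rule integral_dominated_convergence[where w = "\<lambda>x. \<bar>f x\<bar>"])
      show "AE x in lborel. (\<lambda>n. indicator {..real n} x * f x) \<longlonglongrightarrow> f x"
      proof (rule AE_I2)
        fix x
        obtain N where "x \<le> real N" using real_arch_simple by blast
        then show "(\<lambda>n. indicator {..real n} x * f x) \<longlonglongrightarrow> f x"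
          by (intro tendsto_eventually eventually_sequentiallyI[of N]) (auto simp: indicator_def)
      qed
    qed (use f in \<open>auto simp: abs_mult indicator_def\<close>)
  qed (simp add: 0)
  have si: "set_integrable lborel A f" if "A \<in> sets borel" for A
    using integrable_mult_indicator[OF _ f, of A] that by (simp add: set_integrable_def)
  fix A :: "real set" assume "A \<in> sets lborel"
  then have A: "A \<in> sigma_sets UNIV (range atMost)"
    by (simp add: borel_eq_atMost)
  have b: "B \<in> sets borel" if "B \<in> sigma_sets UNIV (range atMost)" for B :: "real set"
    using that by (simp add: borel_eq_atMost)
  \<comment> \<open>Rays are stable under intersection and generate the Borel sets; complements
    require the vanishing of the integral over the whole line, which is \<open>all\<close>.\<close>
  show "set_lebesgue_integral lborel A f = 0"
  proof (rule sigma_sets_induct_disjoint[OF _ _ A])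
    show "Int_stable (range (atMost :: real \<Rightarrow> _))"
      unfolding Int_stable_def by (auto simp: Int_atMost)
  next
    fix A :: "real set" assume "A \<in> range atMost"
    then show "set_lebesgue_integral lborel A f = 0" using 0 by (auto simp: set_lebesgue_integral_def)
  next
    fix A :: "real set" assume A: "A \<in> sigma_sets UNIV (range atMost)" "set_lebesgue_integral lborel A f = 0"
    have "set_lebesgue_integral lborel (A \<union> (UNIV - A)) f
        = set_lebesgue_integral lborel A f + set_lebesgue_integral lborel (UNIV - A) f"
      using b[OF A(1)] by (intro set_integral_Un si) auto
    then show "set_lebesgue_integral lborel (UNIV - A) f = 0"
      using A(2) all by (simp add: set_lebesgue_integral_def)
  next
    fix A :: "nat \<Rightarrow> real set"
    assume A: "disjoint_family A" "range A \<subseteq> sigma_sets UNIV (range atMost)"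
      "\<And>i. set_lebesgue_integral lborel (A i) f = 0"
    have m: "A i \<in> sets borel" for i using A(2) b by auto
    have "set_lebesgue_integral lborel (\<Union>i. A i) f = (\<Sum>i. set_lebesgue_integral lborel (A i) f)"
    proof (rule lebesgue_integral_countable_add)
      show "A i \<in> sets lborel" for i using m by simp
      show "A i \<inter> A j = {}" if "i \<noteq> j" for i j
        using A(1) that by (auto simp: disjoint_family_on_def)
      show "set_integrable lborel (\<Union>i. A i) f" using m by (intro si) auto
    qed
    then show "set_lebesgue_integral lborel (\<Union>i. A i) f = 0" by (simp add: A(3))
  qed (auto simp: set_lebesgue_integral_def)
qed

text \<open>The cutoffs converge to indicators of rays, dominated by the absolute value of
  \<open>g\<close>, so \<open>g\<close> has integral 0 over all rays. The constraint
  \<open>b \<le> pi\<close> keeps the cutoffs supported in the interval; a larger \<open>b\<close>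
  cuts off nothing more than \<open>pi\<close> does.\<close>

lemma AE_zero_of_test_fun:
  assumes g: "integrable ivl g" and 0: "\<And>\<phi>. test_fun \<phi> \<Longrightarrow> (\<integral>x. g x * \<phi> x \<partial>ivl) = 0"
  shows "AE x in ivl. g x = 0"
proof -
  let ?f = "\<lambda>x. indicator {0<..<pi} x * g x"
  have int_eq: "(\<integral>x. indicator {..b} x * ?f x \<partial>lborel) = (\<integral>x. g x * indicator {..b} x \<partial>ivl)" for b
    by (simp add: integral_ivl[symmetric] set_lebesgue_integral_def mult_ac)
  have lim: "(\<integral>x. g x * indicator {..b} x \<partial>ivl) = 0" if "b \<le> pi" for b
  proof (rule LIMSEQ_unique)
    show "(\<lambda>m. \<integral>x. g x * cut m b x \<partial>ivl) \<longlonglongrightarrow> (\<integral>x. g x * indicator {..b} x \<partial>ivl)"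
    proof (rule integral_dominated_convergence[where w = "\<lambda>x. \<bar>g x\<bar>"])
      have "cut m b \<in> borel_measurable ivl" for m
        by (intro borel_measurable_ivl borel_measurable_continuous_onI smooth_continuous smooth_cut)
      then show "(\<lambda>x. g x * cut m b x) \<in> borel_measurable ivl" for m
        using g by simp
      show "(\<lambda>x. g x * indicator {..b} x) \<in> borel_measurable ivl"
        using borel_measurable_integrable[OF g]
        by (rule borel_measurable_times) (rule borel_measurable_ivl, simp)
      show "AE x in ivl. (\<lambda>m. g x * cut m b x) \<longlonglongrightarrow> g x * indicator {..b} x"
        unfolding AE_ivl_iff using AE_lborel_singleton[of b]
        by eventually_elim (auto intro!: tendsto_mult cut_tendsto)
      show "AE x in ivl. norm (g x * cut m b x) \<le> \<bar>g x\<bar>" for m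
        using cut_bounds by (intro AE_I2) (simp add: abs_mult mult_left_le)
    qed (use g in simp)
    show "(\<lambda>m. \<integral>x. g x * cut m b x \<partial>ivl) \<longlonglongrightarrow> 0"
      using 0[OF test_fun_mult_cut[OF smooth_const[of 1] that]] by simp
  qed
  have "AE x in lborel. ?f x = 0"
  proof (rule AE_zero_of_atMost)
    show "integrable lborel ?f" using g by (simp add: integrable_ivl_iff set_integrable_def)
    fix b
    have "(\<integral>x. g x * indicator {..b} x \<partial>ivl) = (\<integral>x. g x * indicator {..min b pi} x \<partial>ivl)"
      by (rule Bochner_Integration.integral_cong) (auto simp: indicator_def)
    then show "(\<integral>x. indicator {..b} x * ?f x \<partial>lborel) = 0"
      unfolding int_eq using lim[of "min b pi"] by simp
  qed
  then show ?thesis unfolding AE_ivl_iff by eventually_elim (auto simp: indicator_def)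
qed

section \<open>Weak derivatives\<close>

lemma integral_ivl_Icc: "(\<integral>x. f x * indicator {0..pi} x \<partial>lborel) = (\<integral>x. f x \<partial>ivl)" for f :: "real \<Rightarrow> real"
  using set_integral_discrete_difference[of "{0, pi}" "{0..pi}" "{0<..<pi}" lborel f]
  unfolding integral_ivl by (fastforce simp: set_lebesgue_integral_def mult.commute)

lemma l2ip_by_parts:
  fixes F G :: "real \<Rightarrow> real"
  assumes "\<And>x. (F has_real_derivative f x) (at x)" "\<And>x. (G has_real_derivative g x) (at x)"
    and "continuous_on UNIV f" "continuous_on UNIV g" "F 0 * G 0 = 0" "F pi * G pi = 0"
  shows "l2ip F g = - l2ip f G"
  using integral_by_parts[of 0 pi f g F G] assms
  unfolding l2ip_eq integral_ivl_Icc by (simp add: continuous_on_eq_continuous_at)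

lemma is_wd_iff:
  "is_wd u g \<longleftrightarrow> L2 g \<and> (\<forall>\<phi>. test_fun \<phi> \<longrightarrow> l2ip u (deriv \<phi>) = - l2ip g \<phi>)"
  by (simp add: is_wd_def l2ip_eq integral_ivl)

lemma is_wd_C1:
  assumes "\<And>x. (f has_real_derivative f' x) (at x)" "continuous_on UNIV f'"
  shows "is_wd f f'"
  unfolding is_wd_iff
proof (intro conjI allI impI L2_continuous assms)
  fix \<phi> assume "test_fun \<phi>"
  then show "l2ip f (deriv \<phi>) = - l2ip f' \<phi>"
    using assms test_fun_boundary
    by (intro l2ip_by_parts test_fun_DERIV test_fun_deriv_continuous) auto
qed

lemma L2_DERIV: "(\<And>x. (f has_real_derivative f' x) (at x)) \<Longrightarrow> L2 f"
  by (meson DERIV_isCont L2_continuous continuous_at_imp_continuous_on)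

lemma is_wd_L2: "is_wd u g \<Longrightarrow> L2 g"
  by (simp add: is_wd_iff)

lemma AE_eq_of_test_fun:
  assumes "L2 g" "L2 h" "\<And>\<phi>. test_fun \<phi> \<Longrightarrow> l2ip g \<phi> = l2ip h \<phi>"
  shows "AE x in ivl. g x = h x"
proof -
  have "AE x in ivl. g x - h x = 0"
  proof (rule AE_zero_of_test_fun)
    show "integrable ivl (\<lambda>x. g x - h x)" using assms by (intro L2_integrable L2_diff)
    fix \<phi> assume "test_fun \<phi>"
    then show "(\<integral>x. (g x - h x) * \<phi> x \<partial>ivl) = 0"
      using l2ip_lin[OF assms(1,2) test_fun_L2[of \<phi>], of 1 "-1"] assms(3)[of \<phi>] by (simp add: l2ip_eq)
  qed
  then show ?thesis by simp
qed

lemma is_wd_unique: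
  assumes "is_wd u g" "is_wd u h" shows "AE x in ivl. g x = h x"
  using assms by (intro AE_eq_of_test_fun) (simp_all add: is_wd_iff)

lemma is_wd_wd: "is_wd u g \<Longrightarrow> is_wd u (wd u)"
  unfolding wd_def by (rule someI[of "is_wd u"])

text \<open>Since \<open>wd\<close> is a choice, identities for it hold only almost everywhere; they
  reach norms and inner products through \<open>l2n_cong_AE\<close> and
  \<open>l2ip_cong_AE\<close>.\<close>

lemma wd_AE: "is_wd u g \<Longrightarrow> AE x in ivl. wd u x = g x"
  by (rule is_wd_unique[OF is_wd_wd])

lemma H1_is_wd: "H1 u \<Longrightarrow> is_wd u (wd u)"
  unfolding H1_def by (blast intro: is_wd_wd)

lemma H1_L2: "H1 u \<Longrightarrow> L2 u"
  by (simp add: H1_def)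

lemma H1_L2_wd: "H1 u \<Longrightarrow> L2 (wd u)"
  by (rule is_wd_L2[OF H1_is_wd])

lemma H10_H1: "H10 u \<Longrightarrow> H1 u"
  by (simp add: H10_def)

lemma is_wd_lin:
  assumes "is_wd u g" "is_wd v h" "L2 u" "L2 v"
  shows "is_wd (\<lambda>x. a * u x + b * v x) (\<lambda>x. a * g x + b * h x)"
  using assms test_fun_L2 test_fun_L2_deriv unfolding is_wd_iff
  by (auto simp: l2ip_lin L2_lin algebra_simps)

lemma H1_lin: "H1 u \<Longrightarrow> H1 v \<Longrightarrow> H1 (\<lambda>x. a * u x + b * v x)"
  unfolding H1_def by (blast intro: is_wd_lin L2_lin)

lemma wd_lin: "H1 u \<Longrightarrow> H1 v \<Longrightarrow> AE x in ivl. wd (\<lambda>x. a * u x + b * v x) x = a * wd u x + b * wd v x"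
  by (intro wd_AE is_wd_lin H1_is_wd H1_L2)

lemma is_wd_cong_AE:
  assumes "is_wd u g" "L2 u" "L2 v" "AE x in ivl. u x = v x" shows "is_wd v g"
  using assms l2ip_cong_AE[OF assms(2,3)] test_fun_L2_deriv unfolding is_wd_iff by auto

lemma l2n_wd_lin:
  assumes "H1 u" "H1 v"
  shows "l2n (wd (\<lambda>x. a * u x + b * v x)) = a\<^sup>2 * l2n (wd u) + 2 * a * b * l2ip (wd u) (wd v) + b\<^sup>2 * l2n (wd v)"
proof -
  note L = assms[THEN H1_L2_wd]
  have "l2n (wd (\<lambda>x. a * u x + b * v x)) = l2n (\<lambda>x. a * wd u x + b * wd v x)"
    by (intro l2n_cong_AE wd_lin assms H1_L2_wd[OF H1_lin] L2_lin L)
  then show ?thesis by (simp add: l2n_lin[OF L])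
qed

text \<open>Allows the approximation to be measured with an explicit weak derivative in place of the
  chosen one.\<close>

lemma H10I:
  assumes "L2 u" "is_wd u g"
    and "\<And>e. e > 0 \<Longrightarrow> \<exists>\<phi>. test_fun \<phi> \<and> l2n (\<lambda>x. u x - \<phi> x) + l2n (\<lambda>x. g x - deriv \<phi> x) < e"
  shows "H10 u"
proof -
  have "l2n (\<lambda>x. wd u x - deriv \<phi> x) = l2n (\<lambda>x. g x - deriv \<phi> x)" if "test_fun \<phi>" for \<phi>
    using wd_AE[OF assms(2)] is_wd_L2[OF assms(2)] is_wd_L2[OF is_wd_wd[OF assms(2)]]
      test_fun_L2_deriv[OF that]
    by (intro l2n_cong_AE L2_diff) auto
  then show ?thesis
    unfolding H10_def H1_def using assms by metis
qed

lemma H10_approx: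
  assumes "H10 u" "e > 0"
  obtains \<phi> where "test_fun \<phi>" "l2n (\<lambda>x. u x - \<phi> x) < e" "l2n (\<lambda>x. wd u x - deriv \<phi> x) < e"
proof -
  obtain \<phi> where "test_fun \<phi>" "l2n (\<lambda>x. u x - \<phi> x) + l2n (\<lambda>x. wd u x - deriv \<phi> x) < e"
    using assms unfolding H10_def by blast
  with l2n_nonneg[of "\<lambda>x. u x - \<phi> x"] l2n_nonneg[of "\<lambda>x. wd u x - deriv \<phi> x"]
  show ?thesis by (intro that) auto
qed

lemma H10_cong_AE:
  assumes "H10 u" "L2 v" "AE x in ivl. u x = v x" shows "H10 v"
proof (rule H10I[OF assms(2) is_wd_cong_AE])
  show "is_wd u (wd u)" "L2 u" by (intro H1_is_wd H1_L2 H10_H1 assms)+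
  fix e :: real assume "e > 0"
  then obtain \<phi> where \<phi>: "test_fun \<phi>" "l2n (\<lambda>x. u x - \<phi> x) + l2n (\<lambda>x. wd u x - deriv \<phi> x) < e"
    using assms unfolding H10_def by blast
  have "l2n (\<lambda>x. u x - \<phi> x) = l2n (\<lambda>x. v x - \<phi> x)"
    using assms test_fun_L2[OF \<phi>(1)] \<open>L2 u\<close> by (intro l2n_cong_AE L2_diff) auto
  with \<phi> show "\<exists>\<phi>. test_fun \<phi> \<and> l2n (\<lambda>x. v x - \<phi> x) + l2n (\<lambda>x. wd u x - deriv \<phi> x) < e" by auto
qed (use assms in auto)

lemma H10_lin:
  assumes "H10 u" "H10 v" shows "H10 (\<lambda>x. a * u x + b * v x)"
proof (rule H10I)
  note H = assms[THEN H10_H1]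
  note L = H[THEN H1_L2] H[THEN H1_L2_wd]
  show "L2 (\<lambda>x. a * u x + b * v x)" by (intro L2_lin L)
  show "is_wd (\<lambda>x. a * u x + b * v x) (\<lambda>x. a * wd u x + b * wd v x)"
    by (intro is_wd_lin H1_is_wd H L)
  fix e :: real assume "e > 0"
  \<comment> \<open>The function and its derivative each contribute an error of at most
    \<open>(2 a^2 + 2 b^2) d\<close>. The summand 1 makes the total strictly smaller than
    \<open>e\<close> and keeps \<open>K\<close> positive when \<open>a\<close> and \<open>b\<close>
    are 0.\<close>
  define K where "K = 4 * a\<^sup>2 + 4 * b\<^sup>2 + 1"
  have K: "K > 0" unfolding K_def by (intro add_nonneg_pos) auto
  define d where "d = e / K"
  have d: "d > 0" using \<open>e > 0\<close> K by (simp add: d_def)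
  obtain \<phi> where \<phi>: "test_fun \<phi>" "l2n (\<lambda>x. u x - \<phi> x) < d" "l2n (\<lambda>x. wd u x - deriv \<phi> x) < d"
    using H10_approx[OF assms(1) d] .
  obtain \<psi> where \<psi>: "test_fun \<psi>" "l2n (\<lambda>x. v x - \<psi> x) < d" "l2n (\<lambda>x. wd v x - deriv \<psi> x) < d"
    using H10_approx[OF assms(2) d] .
  have b: "l2n (\<lambda>x. (a * f x + b * g x) - (a * f' x + b * g' x)) \<le> (2 * a\<^sup>2 + 2 * b\<^sup>2) * d"
    if "L2 f" "L2 g" "L2 f'" "L2 g'" "l2n (\<lambda>x. f x - f' x) < d" "l2n (\<lambda>x. g x - g' x) < d" for f g f' g'
  proof -
    have "l2n (\<lambda>x. (a * f x + b * g x) - (a * f' x + b * g' x))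
        = l2n (\<lambda>x. a * (f x - f' x) + b * (g x - g' x))" by (simp add: algebra_simps)
    also have "\<dots> \<le> 2 * a\<^sup>2 * l2n (\<lambda>x. f x - f' x) + 2 * b\<^sup>2 * l2n (\<lambda>x. g x - g' x)"
      using that by (intro l2n_add_le L2_diff)
    also have "\<dots> \<le> 2 * a\<^sup>2 * d + 2 * b\<^sup>2 * d"
      using that by (intro add_mono mult_left_mono) auto
    finally show ?thesis by (simp add: algebra_simps)
  qed
  have "l2n (\<lambda>x. (a * u x + b * v x) - (a * \<phi> x + b * \<psi> x)) \<le> (2 * a\<^sup>2 + 2 * b\<^sup>2) * d"
    "l2n (\<lambda>x. (a * wd u x + b * wd v x) - (a * deriv \<phi> x + b * deriv \<psi> x)) \<le> (2 * a\<^sup>2 + 2 * b\<^sup>2) * d"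
    using L \<phi> \<psi> test_fun_L2[of \<phi>] test_fun_L2[of \<psi>] test_fun_L2_deriv[of \<phi>] test_fun_L2_deriv[of \<psi>]
    by (auto intro!: b)
  moreover have "K * d = e" using K by (simp add: d_def)
  ultimately show "\<exists>\<phi>. test_fun \<phi> \<and> l2n (\<lambda>x. (a * u x + b * v x) - \<phi> x) +
      l2n (\<lambda>x. (a * wd u x + b * wd v x) - deriv \<phi> x) < e"
    using \<phi> \<psi> d by (intro exI[of _ "\<lambda>x. a * \<phi> x + b * \<psi> x"])
      (auto simp: test_fun_lin deriv_lin K_def algebra_simps)
qed

lemma l2ip_diff_left:
  "L2 f \<Longrightarrow> L2 g \<Longrightarrow> L2 h \<Longrightarrow> l2ip (\<lambda>x. f x - g x) h = l2ip f h - l2ip g h"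
  using l2ip_lin[of f g h 1 "-1"] by simp

section \<open>The space of weakly differentiable functions with zero boundary values\<close>

text \<open>The identity holds for test functions and both sides depend continuously on
  \<open>f\<close> and \<open>wd f\<close>, so it passes to the closure: a nonzero defect
  \<open>D\<close> contradicts an approximation within \<open>D^2 / (4 K)\<close>. In contrast to
  the definition of \<open>is_wd\<close>, \<open>P\<close> may be nonzero at the endpoints, as
  cosine polynomials are.\<close>

lemma H10_by_parts:
  assumes f: "H10 f" and P: "\<And>x. (P has_real_derivative P' x) (at x)" "continuous_on UNIV P'"
  shows "l2ip (wd f) P = - l2ip f P'"
proof (rule ccontr)
  define D where "D = l2ip (wd f) P + l2ip f P'"
  assume "l2ip (wd f) P \<noteq> - l2ip f P'"
  then have D: "D\<^sup>2 > 0" unfolding D_def by simp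
  note L = H1_L2[OF H10_H1[OF f]] H1_L2_wd[OF H10_H1[OF f]] L2_DERIV[OF P(1)] L2_continuous[OF P(2)]
  define K where "K = l2n P + l2n P' + 1"
  have K: "K > 0" using l2n_nonneg[of P] l2n_nonneg[of P'] by (simp add: K_def)
  obtain \<phi> where \<phi>: "test_fun \<phi>" "l2n (\<lambda>x. f x - \<phi> x) < D\<^sup>2 / (4 * K)"
      "l2n (\<lambda>x. wd f x - deriv \<phi> x) < D\<^sup>2 / (4 * K)"
    using H10_approx[OF f, of "D\<^sup>2 / (4 * K)"] D K by auto
  note M = test_fun_L2[OF \<phi>(1)] test_fun_L2_deriv[OF \<phi>(1)]
  have "l2ip P (deriv \<phi>) = - l2ip P' \<phi>"
    using test_fun_boundary[OF \<phi>(1)]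
    by (intro l2ip_by_parts P test_fun_DERIV test_fun_deriv_continuous \<phi>) auto
  then have "D = l2ip (\<lambda>x. wd f x - deriv \<phi> x) P + l2ip (\<lambda>x. f x - \<phi> x) P'"
    unfolding D_def using l2ip_diff_left L M by (simp add: l2ip_commute)
  moreover have "(s + t)\<^sup>2 \<le> 2 * s\<^sup>2 + 2 * t\<^sup>2" for s t :: real
    using zero_le_power2[of "s - t"] by (simp add: power2_eq_square algebra_simps)
  ultimately have "D\<^sup>2 \<le> 2 * (l2ip (\<lambda>x. wd f x - deriv \<phi> x) P)\<^sup>2 + 2 * (l2ip (\<lambda>x. f x - \<phi> x) P')\<^sup>2"
    by metis
  also have "\<dots> \<le> 2 * (l2n (\<lambda>x. wd f x - deriv \<phi> x) * l2n P) + 2 * (l2n (\<lambda>x. f x - \<phi> x) * l2n P')"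
    using L M by (intro add_mono mult_left_mono l2ip_CS L2_diff) auto
  also have "\<dots> \<le> 2 * (D\<^sup>2 / (4 * K) * l2n P) + 2 * (D\<^sup>2 / (4 * K) * l2n P')"
    using \<phi> by (intro add_mono mult_left_mono mult_right_mono l2n_nonneg) auto
  also have "\<dots> = D\<^sup>2 / (2 * K) * (l2n P + l2n P')"
    using K by (simp add: field_simps)
  also have "\<dots> \<le> D\<^sup>2 / (2 * K) * K"
    using K by (intro mult_left_mono) (auto simp: K_def)
  also have "\<dots> < D\<^sup>2" using D K by simp
  finally show False by simp
qed

text \<open>Integrate the square of \<open>\<phi>\<close> by parts against the derivative of
  \<open>x\<close>. Young's inequality with \<open>x \<le> pi\<close> leaves half of the norm on the
  right, where it is absorbed.\<close>

lemma test_fun_Poincare: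
  assumes \<phi>: "test_fun \<phi>" shows "l2n \<phi> \<le> 4 * pi\<^sup>2 * l2n (deriv \<phi>)"
proof -
  note M = test_fun_L2[OF \<phi>] test_fun_L2_deriv[OF \<phi>]
  note c = smooth_continuous[OF test_fun_smooth[OF \<phi>]] test_fun_deriv_continuous[OF \<phi>]
  let ?h = "\<lambda>x. 2 * \<phi> x * deriv \<phi> x"
  have "l2ip (\<lambda>x. (\<phi> x)\<^sup>2) (\<lambda>x. 1) = - l2ip ?h (\<lambda>x. x)"
    using test_fun_boundary[OF \<phi>] test_fun_DERIV[OF \<phi>] c
    by (intro l2ip_by_parts) (auto intro!: derivative_eq_intros continuous_intros)
  then have "l2n \<phi> = (\<integral>x. - (?h x * x) \<partial>ivl)"
    by (simp add: l2n_eq l2ip_eq)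
  also have "\<dots> \<le> (\<integral>x. (1/2) * (\<phi> x)\<^sup>2 + 2 * pi\<^sup>2 * (deriv \<phi> x)\<^sup>2 \<partial>ivl)"
  proof (rule integral_mono)
    show "integrable ivl (\<lambda>x. - (?h x * x))"
      using c by (intro L2_integrable L2_continuous continuous_intros)
    show "integrable ivl (\<lambda>x. (1/2) * (\<phi> x)\<^sup>2 + 2 * pi\<^sup>2 * (deriv \<phi> x)\<^sup>2)"
      using M by (simp add: L2_iff)
    fix x assume "x \<in> space ivl"
    then have x: "0 < x" "x < pi" by auto
    have "0 \<le> (\<phi> x + 2 * x * deriv \<phi> x)\<^sup>2" by simp
    then have "- (?h x * x) \<le> (1/2) * (\<phi> x)\<^sup>2 + 2 * (x\<^sup>2 * (deriv \<phi> x)\<^sup>2)"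
      by (simp add: power2_eq_square algebra_simps)
    also have "x\<^sup>2 * (deriv \<phi> x)\<^sup>2 \<le> pi\<^sup>2 * (deriv \<phi> x)\<^sup>2"
      using x by (intro mult_right_mono power_mono) auto
    finally show "- (?h x * x) \<le> (1/2) * (\<phi> x)\<^sup>2 + 2 * pi\<^sup>2 * (deriv \<phi> x)\<^sup>2" by simp
  qed
  also have "\<dots> = (1/2) * l2n \<phi> + 2 * pi\<^sup>2 * l2n (deriv \<phi>)"
    using M by (simp add: l2n_eq L2_iff)
  finally show ?thesis by simp
qed

text \<open>The constant is \<open>4 * 4 pi^2\<close>: passing from \<open>f\<close> to a test
  function and from its derivative back to \<open>wd f\<close> costs a factor 2 each time.\<close>

lemma H10_Poincare:
  assumes f: "H10 f" shows "l2n f \<le> 16 * pi\<^sup>2 * l2n (wd f)"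
proof (rule field_le_epsilon)
  fix e :: real assume e: "e > 0"
  define K where "K = 2 + 16 * pi\<^sup>2"
  have K: "K > 0" unfolding K_def by (intro add_pos_nonneg) auto
  define t where "t = e / K"
  have t: "t > 0" "K * t = e" using e K by (simp_all add: t_def)
  obtain \<phi> where \<phi>: "test_fun \<phi>" "l2n (\<lambda>x. f x - \<phi> x) < t"
      "l2n (\<lambda>x. wd f x - deriv \<phi> x) < t"
    using H10_approx[OF f t(1)] .
  note L = H1_L2[OF H10_H1[OF f]] H1_L2_wd[OF H10_H1[OF f]]
  note M = test_fun_L2[OF \<phi>(1)] test_fun_L2_deriv[OF \<phi>(1)]
  have "l2n f \<le> 2 * l2n (\<lambda>x. f x - \<phi> x) + 2 * l2n \<phi>"
    using l2n_add_le[OF L2_diff[OF L(1) M(1)] M(1), of 1 1] by simp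
  moreover have "l2n (deriv \<phi>) \<le> 2 * l2n (wd f) + 2 * l2n (\<lambda>x. wd f x - deriv \<phi> x)"
    using l2n_add_le[OF L(2) L2_diff[OF L(2) M(2)], of 1 "-1"] by simp
  then have "4 * pi\<^sup>2 * l2n (deriv \<phi>) \<le> 4 * pi\<^sup>2 * (2 * l2n (wd f) + 2 * t)"
    using \<phi> by (intro mult_left_mono) auto
  moreover have "2 * t + 16 * pi\<^sup>2 * t = e"
    using t(2) by (simp add: K_def algebra_simps)
  ultimately show "l2n f \<le> 16 * pi\<^sup>2 * l2n (wd f) + e"
    using test_fun_Poincare[OF \<phi>(1)] \<phi>(2) by (simp add: algebra_simps)
qed

section \<open>Approximating sines by test functions\<close>

lemma flat_Suc_tendsto_0: "(flat (Suc k) \<longlongrightarrow> 0) at_top"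
proof (rule Lim_transform_eventually)
  have "((\<lambda>x::real. inverse x ^ Suc k * exp (- inverse x)) \<longlongrightarrow> 0 ^ Suc k * exp (- 0)) at_top"
    by (intro tendsto_intros tendsto_inverse_0_at_top filterlim_ident)
  then show "((\<lambda>x::real. inverse x ^ Suc k * exp (- inverse x)) \<longlongrightarrow> 0) at_top" by simp
  show "\<forall>\<^sub>F x in at_top. inverse x ^ Suc k * exp (- inverse x) = flat (Suc k) x"
    using eventually_gt_at_top[of 0] by eventually_elim (simp add: flat_def divide_inverse)
qed

lemma flat_DERIV_affine:
  "((\<lambda>x. flat 0 (a * x + b)) has_real_derivative a * flat 2 (a * x + b)) (at x)"
proof -
  have "(flat 0 has_real_derivative flat 2 (a * x + b)) (at (a * x + b))"
    using flat_DERIV[of 0 "a * x + b"] by (simp add: numeral_2_eq_2)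
  moreover have "((\<lambda>x. a * x + b) has_real_derivative a) (at x)"
    by (auto intro!: derivative_eq_intros)
  ultimately have "((\<lambda>x. flat 0 (a * x + b)) has_real_derivative flat 2 (a * x + b) * a) (at x)"
    by (rule DERIV_chain2)
  then show ?thesis by (simp add: mult.commute)
qed

lemma flat_mult: "y * flat (Suc k) y = flat k y"
  by (simp add: flat_def)

text \<open>The sine is multiplied by \<open>cut m pi\<close>. The derivative of the cutoff carries
  a factor \<open>Suc m\<close>, but it acts near the endpoints, where the sine is at most
  \<open>n\<close> times the distance to the endpoint. By \<open>flat_mult\<close> the product
  becomes a sum of functions \<open>flat 1\<close> and \<open>flat 2\<close>, which are bounded and
  tend to 0 pointwise.\<close>

lemma H10_sin: "H10 (\<lambda>x. sin (real n * x))"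
proof (rule H10I)
  let ?n = "real n"
  show "L2 (\<lambda>x. sin (?n * x))" by (intro L2_continuous continuous_intros)
  show "is_wd (\<lambda>x. sin (?n * x)) (\<lambda>x. ?n * cos (?n * x))"
    by (intro is_wd_C1) (auto intro!: derivative_eq_intros continuous_intros)
  define A where "A m x = real (Suc m) * x + (- 1)" for m and x :: real
  define B where "B m x = (- real (Suc m)) * x + (real (Suc m) * pi - 1)" for m and x :: real
  \<comment> \<open>The reflection of \<open>x\<close> to \<open>pi - x\<close> exchanges the two
    ends and preserves the absolute value of the sine, so only the left end needs an
    estimate.\<close>
  have BA: "B m x = A m (pi - x)" for m x by (simp add: A_def B_def algebra_simps)
  define \<phi> where "\<phi> m x = sin (?n * x) * cut m pi x" for m x
  define h where "h m x = sin (?n * x) * (real (Suc m) * flat 2 (A m x) * flat 0 (B m x)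
      - flat 0 (A m x) * (real (Suc m) * flat 2 (B m x)))" for m x
  have test: "test_fun (\<phi> m)" for m
    unfolding \<phi>_def[abs_def] using smooth_affine[OF smooth_sin, of ?n 0] by (intro test_fun_mult_cut) auto
  have d: "deriv (\<phi> m) x = ?n * cos (?n * x) * cut m pi x + h m x" for m x
  proof (rule DERIV_imp_deriv)
    have c: "(cut m pi has_real_derivative real (Suc m) * flat 2 (A m x) * flat 0 (B m x)
        + (- real (Suc m)) * flat 2 (B m x) * flat 0 (A m x)) (at x)"
      unfolding cut_def[abs_def] A_def B_def by (rule DERIV_mult[OF flat_DERIV_affine flat_DERIV_affine])
    have "((\<lambda>x. sin (?n * x)) has_real_derivative ?n * cos (?n * x)) (at x)"
      by (auto intro!: derivative_eq_intros)
    from DERIV_mult[OF this c]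
    show "(\<phi> m has_real_derivative ?n * cos (?n * x) * cut m pi x + h m x) (at x)"
      unfolding \<phi>_def[abs_def] by (rule DERIV_cong) (simp add: h_def algebra_simps)
  qed
  have sin_le: "\<bar>sin (?n * x)\<bar> \<le> ?n * x" if "x \<ge> 0" for x
    using abs_sin_x_le_abs_x[of "?n * x"] that by simp
  have sin_pi: "\<bar>sin (?n * x)\<bar> = \<bar>sin (?n * (pi - x))\<bar>" for x
    by (simp add: right_diff_distrib sin_diff abs_mult)
  have Mx: "\<bar>sin (?n * x) * (real (Suc m) * flat 2 (A m x))\<bar> \<le> ?n * (flat 1 (A m x) + flat 2 (A m x))" if "x \<ge> 0" for m x
  proof -
    have "\<bar>sin (?n * x) * (real (Suc m) * flat 2 (A m x))\<bar> = \<bar>sin (?n * x)\<bar> * (real (Suc m) * flat 2 (A m x))"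
      using flat_nonneg[of 2] by (simp add: abs_mult)
    also have "\<dots> \<le> ?n * x * (real (Suc m) * flat 2 (A m x))"
      using flat_nonneg[of 2] sin_le[OF that] by (intro mult_right_mono) auto
    also have "\<dots> = ?n * ((A m x + 1) * flat 2 (A m x))" by (simp add: A_def algebra_simps)
    also have "(A m x + 1) * flat 2 (A m x) = flat 1 (A m x) + flat 2 (A m x)"
      using flat_mult[of "A m x" 1] by (simp add: algebra_simps numeral_2_eq_2)
    finally show ?thesis .
  qed
  have h_le: "\<bar>h m x\<bar> \<le> ?n * (flat 1 (A m x) + flat 2 (A m x)) + ?n * (flat 1 (A m (pi - x)) + flat 2 (A m (pi - x)))"
    if "0 \<le> x" "x \<le> pi" for m x
  proof -
    have "\<bar>h m x\<bar> \<le> \<bar>sin (?n * x) * (real (Suc m) * flat 2 (A m x)) * flat 0 (B m x)\<bar>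
        + \<bar>sin (?n * x) * (real (Suc m) * flat 2 (B m x)) * flat 0 (A m x)\<bar>"
      unfolding h_def by (rule order_trans[OF _ abs_triangle_ineq4]) (simp add: algebra_simps)
    also have "\<dots> \<le> \<bar>sin (?n * x) * (real (Suc m) * flat 2 (A m x))\<bar>
        + \<bar>sin (?n * x) * (real (Suc m) * flat 2 (B m x))\<bar>"
      using flat_nonneg[of 0] flat_0_le_1
      by (intro add_mono) (auto simp: abs_mult intro!: mult_left_le)
    also have "\<bar>sin (?n * x) * (real (Suc m) * flat 2 (B m x))\<bar>
        = \<bar>sin (?n * (pi - x)) * (real (Suc m) * flat 2 (A m (pi - x)))\<bar>"
      using sin_pi[of x] by (simp add: abs_mult BA)
    finally show ?thesis using Mx[of x m] Mx[of "pi - x" m] that by linarith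
  qed
  have f2: "flat 1 y \<le> 1" "flat 2 y \<le> 2" for y
    using flat_le[of 1 y] flat_le[of 2 y] by (simp_all add: numeral_2_eq_2)
  have h_bd: "\<bar>h m x\<bar> \<le> 6 * ?n" if "0 \<le> x" "x \<le> pi" for m x
  proof -
    have "?n * (flat 1 y + flat 2 y) \<le> ?n * 3" for y
      using f2[of y] by (intro mult_left_mono) auto
    from this[of "A m x"] this[of "A m (pi - x)"] h_le[OF that, of m] show ?thesis by linarith
  qed
  have h_lim: "(\<lambda>m. h m x) \<longlonglongrightarrow> 0" if "0 < x" "x < pi" for x
  proof (rule tendsto_0_le[where K = 1])
    have *: "(\<lambda>m. flat (Suc k) (A m y)) \<longlonglongrightarrow> 0" if "y > 0" for k y
      unfolding A_def by (rule filterlim_compose[OF flat_Suc_tendsto_0 filterlim_Suc_affine[OF that]])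
    have "(\<lambda>m. ?n * (flat 1 (A m x) + flat 2 (A m x)) + ?n * (flat 1 (A m (pi - x)) + flat 2 (A m (pi - x))))
        \<longlonglongrightarrow> ?n * (0 + 0) + ?n * (0 + 0)"
      using *[of x 0] *[of x 1] *[of "pi - x" 0] *[of "pi - x" 1] that
      by (intro tendsto_intros) (auto simp: numeral_2_eq_2)
    then show "(\<lambda>m. ?n * (flat 1 (A m x) + flat 2 (A m x)) + ?n * (flat 1 (A m (pi - x)) + flat 2 (A m (pi - x))))
        \<longlonglongrightarrow> 0" by simp
    show "\<forall>\<^sub>F m in sequentially. norm (h m x) \<le> norm (?n * (flat 1 (A m x) + flat 2 (A m x))
        + ?n * (flat 1 (A m (pi - x)) + flat 2 (A m (pi - x)))) * 1"
    proof (rule always_eventually, rule allI)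
      fix m
      show "norm (h m x) \<le> norm (?n * (flat 1 (A m x) + flat 2 (A m x))
        + ?n * (flat 1 (A m (pi - x)) + flat 2 (A m (pi - x)))) * 1"
        using h_le[of x m] that by (simp only: real_norm_def mult_1_right) linarith
    qed
  qed
  have conv: "(\<lambda>m. l2n (k m)) \<longlonglongrightarrow> 0"
    if "\<And>m. L2 (k m)" "\<And>x m. 0 < x \<Longrightarrow> x < pi \<Longrightarrow> \<bar>k m x\<bar> \<le> C" "\<And>x. 0 < x \<Longrightarrow> x < pi \<Longrightarrow> (\<lambda>m. k m x) \<longlonglongrightarrow> 0"
    for k C
  proof -
    have "(\<lambda>m. \<integral>x. (k m x)\<^sup>2 \<partial>ivl) \<longlonglongrightarrow> (\<integral>x. 0 \<partial>ivl)"
    proof (rule integral_dominated_convergence[where w = "\<lambda>_. C\<^sup>2"])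
      show "AE x in ivl. (\<lambda>m. (k m x)\<^sup>2) \<longlonglongrightarrow> 0"
        by (rule AE_ivl_I) (use that(3) in \<open>auto intro!: tendsto_eq_intros\<close>)
      show "AE x in ivl. norm ((k m x)\<^sup>2) \<le> C\<^sup>2" for m
      proof (rule AE_ivl_I)
        fix x :: real assume "0 < x" "x < pi"
        from power_mono[OF that(2)[OF this], of m 2] show "norm ((k m x)\<^sup>2) \<le> C\<^sup>2" by simp
      qed
    qed (use that(1) in \<open>auto simp: L2_iff\<close>)
    then show ?thesis by (simp add: l2n_eq)
  qed
  have cb: "\<bar>1 - cut m pi x\<bar> \<le> 1" for m x using cut_bounds[of m pi x] by simp
  have cl: "(\<lambda>m. cut m pi x) \<longlonglongrightarrow> 1" if "0 < x" "x < pi" for x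
    using cut_tendsto[of x pi] that by simp
  have L2s: "L2 (\<lambda>x. sin (?n * x))" "L2 (\<lambda>x. ?n * cos (?n * x))"
    by (intro L2_continuous continuous_intros)+
  have 1: "(\<lambda>m. l2n (\<lambda>x. sin (?n * x) - \<phi> m x)) \<longlonglongrightarrow> 0"
  proof (rule conv[where C = 1])
    show "L2 (\<lambda>x. sin (?n * x) - \<phi> m x)" for m
      by (intro L2_diff L2s test_fun_L2 test)
    have e: "sin (?n * x) - \<phi> m x = sin (?n * x) * (1 - cut m pi x)" for m x
      by (simp add: \<phi>_def algebra_simps)
    show "\<bar>sin (?n * x) - \<phi> m x\<bar> \<le> 1" for m x
      unfolding e abs_mult using cb by (intro mult_le_one) auto
    show "(\<lambda>m. sin (?n * x) - \<phi> m x) \<longlonglongrightarrow> 0" if "0 < x" "x < pi" for x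
      unfolding e using cl[OF that] by (auto intro!: tendsto_eq_intros)
  qed
  have 2: "(\<lambda>m. l2n (\<lambda>x. ?n * cos (?n * x) - deriv (\<phi> m) x)) \<longlonglongrightarrow> 0"
  \<comment> \<open>One \<open>n\<close> comes from the cosine term and \<open>6 * n\<close> from
    \<open>h_bd\<close>, that is \<open>(1 + 2) * n\<close> for each endpoint.\<close>
  proof (rule conv[where C = "7 * ?n"])
    show "L2 (\<lambda>x. ?n * cos (?n * x) - deriv (\<phi> m) x)" for m
      by (intro L2_diff L2s test_fun_L2_deriv test)
    have e: "?n * cos (?n * x) - deriv (\<phi> m) x = ?n * (cos (?n * x) * (1 - cut m pi x)) - h m x" for m x
      by (simp add: d algebra_simps)
    show "\<bar>?n * cos (?n * x) - deriv (\<phi> m) x\<bar> \<le> 7 * ?n" if "0 < x" "x < pi" for m x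
    proof -
      have "\<bar>cos (?n * x) * (1 - cut m pi x)\<bar> \<le> 1"
        unfolding abs_mult using cb by (intro mult_le_one) auto
      then have "?n * \<bar>cos (?n * x) * (1 - cut m pi x)\<bar> \<le> ?n * 1"
        by (intro mult_left_mono) auto
      then have "\<bar>?n * (cos (?n * x) * (1 - cut m pi x))\<bar> \<le> ?n" by (simp add: abs_mult)
      with h_bd[of x m] that show ?thesis unfolding e by linarith
    qed
    show "(\<lambda>m. ?n * cos (?n * x) - deriv (\<phi> m) x) \<longlonglongrightarrow> 0" if "0 < x" "x < pi" for x
      unfolding e using cl[OF that] h_lim[OF that] by (auto intro!: tendsto_eq_intros)
  qed
  fix e :: real assume "e > 0"
  from tendsto_add[OF 1 2] have "(\<lambda>m. l2n (\<lambda>x. sin (?n * x) - \<phi> m x) +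
      l2n (\<lambda>x. ?n * cos (?n * x) - deriv (\<phi> m) x)) \<longlonglongrightarrow> 0" by simp
  from order_tendstoD(2)[OF this \<open>e > 0\<close>]
  obtain m where "l2n (\<lambda>x. sin (?n * x) - \<phi> m x) + l2n (\<lambda>x. ?n * cos (?n * x) - deriv (\<phi> m) x) < e"
    by (auto simp: eventually_sequentially)
  with test show "\<exists>\<phi>. test_fun \<phi> \<and> l2n (\<lambda>x. sin (?n * x) - \<phi> x)
      + l2n (\<lambda>x. ?n * cos (?n * x) - deriv \<phi> x) < e" by blast
qed

section \<open>Measurability of the norm of a memory variable\<close>

text \<open>Polynomials in \<open>cos x\<close> with rational coefficients: a countable family,
  smooth on the whole line, and dense in the continuous functions on \<open>[0,pi]\<close> because
  the cosine maps this interval homeomorphically onto \<open>[-1,1]\<close>.\<close>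

definition cospoly :: "rat list \<Rightarrow> real \<Rightarrow> real" where
  "cospoly q x = (\<Sum>i<length q. of_rat (q ! i) * cos x ^ i)"

definition cospoly' :: "rat list \<Rightarrow> real \<Rightarrow> real" where
  "cospoly' q x = (\<Sum>i<length q. of_rat (q ! i) * (real i * cos x ^ (i - 1) * (- sin x)))"

lemma cospoly_DERIV: "(cospoly q has_real_derivative cospoly' q x) (at x)"
proof -
  have "((\<lambda>x. cos x ^ i) has_real_derivative real i * cos x ^ (i - 1) * (- sin x)) (at x)" for i
    using DERIV_power[OF DERIV_cos, of i x] by (simp add: mult_ac)
  then show ?thesis
    unfolding cospoly_def[abs_def] cospoly'_def by (intro DERIV_sum DERIV_cmult)
qed

lemma continuous_cospoly': "continuous_on UNIV (cospoly' q)"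
  unfolding cospoly'_def[abs_def] by (intro continuous_intros)

lemma L2_cospoly: "L2 (cospoly q)" "L2 (cospoly' q)"
  using L2_DERIV[OF cospoly_DERIV] L2_continuous[OF continuous_cospoly'] by auto

lemma cospoly_dense:
  assumes f: "continuous_on {0..pi} f" and e: "e > 0"
  shows "\<exists>q. \<forall>x\<in>{0..pi}. \<bar>f x - cospoly q x\<bar> < e"
proof -
  have "continuous_on {-1..1} (f \<circ> arccos)"
    by (intro continuous_on_compose continuous_on_arccos' continuous_on_subset[OF f])
      (auto intro: arccos_lbound arccos_ubound)
  then obtain g where g: "real_polynomial_function g" "\<And>y. y \<in> {-1..1} \<Longrightarrow> \<bar>(f \<circ> arccos) y - g y\<bar> < e / 2"
    using Stone_Weierstrass_real_polynomial_function[of "{-1..1::real}" "f \<circ> arccos" "e / 2"] e by auto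
  from g(1) obtain a n where a: "g = (\<lambda>x. \<Sum>i\<le>n. a i * x ^ i)"
    unfolding real_polynomial_function_iff_sum by blast
  \<comment> \<open>Half of \<open>e\<close> is spent on the Weierstrass approximation; the other
    half is shared by the \<open>Suc n\<close> coefficients when they are replaced by
    rationals.\<close>
  define d where "d = e / (2 * real (Suc n))"
  have "d > 0" using e by (simp add: d_def)
  then have "\<exists>r. \<bar>a i - of_rat r\<bar> < d" for i
    using of_rat_dense[of "a i - d" "a i + d"] by (auto simp: abs_less_iff) (smt (verit))
  then obtain r where r: "\<And>i. \<bar>a i - of_rat (r i)\<bar> < d" by metis
  have cp: "cospoly (map r [0..<Suc n]) x = (\<Sum>i\<le>n. of_rat (r i) * cos x ^ i)" for x
    unfolding cospoly_def by (intro sum.cong) (auto simp del: upt_Suc)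
  have "\<bar>f x - cospoly (map r [0..<Suc n]) x\<bar> < e" if x: "x \<in> {0..pi}" for x
  proof -
    have "\<bar>g (cos x) - cospoly (map r [0..<Suc n]) x\<bar> = \<bar>\<Sum>i\<le>n. (a i - of_rat (r i)) * cos x ^ i\<bar>"
      unfolding a cp by (simp add: sum_subtractf algebra_simps)
    also have "\<dots> \<le> (\<Sum>i\<le>n. \<bar>(a i - of_rat (r i)) * cos x ^ i\<bar>)" by (rule sum_abs)
    also have "\<dots> \<le> (\<Sum>i\<le>n. d)"
    proof (rule sum_mono)
      fix i
      have "\<bar>a i - of_rat (r i)\<bar> * \<bar>cos x\<bar> ^ i \<le> \<bar>a i - of_rat (r i)\<bar>"
        by (intro mult_left_le power_le_one) auto
      then show "\<bar>(a i - of_rat (r i)) * cos x ^ i\<bar> \<le> d"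
        using r[of i] by (simp add: abs_mult power_abs)
    qed
    also have "\<dots> = e / 2" by (simp add: d_def field_simps)
    finally have "\<bar>g (cos x) - cospoly (map r [0..<Suc n]) x\<bar> \<le> e / 2" .
    moreover have "\<bar>f x - g (cos x)\<bar> < e / 2"
      using g(2)[of "cos x"] x by (simp add: arccos_cos)
    ultimately show ?thesis by linarith
  qed
  then show ?thesis by blast
qed

lemma integral_const_ivl: "(\<integral>x. k \<partial>ivl) = k * pi" for k :: real
  unfolding integral_ivl[symmetric] set_lebesgue_integral_def by simp

lemma l2n_le_const:
  assumes "L2 f" "\<And>x. 0 < x \<Longrightarrow> x < pi \<Longrightarrow> \<bar>f x\<bar> \<le> e" shows "l2n f \<le> e\<^sup>2 * pi"
proof -
  have "(\<integral>x. (f x)\<^sup>2 \<partial>ivl) \<le> (\<integral>x. e\<^sup>2 \<partial>ivl)"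
  proof (rule integral_mono)
    fix x assume "x \<in> space ivl"
    then show "(f x)\<^sup>2 \<le> e\<^sup>2" using power_mono[OF assms(2)[of x], of 2] by simp
  qed (use assms in \<open>auto simp: L2_iff\<close>)
  then show ?thesis unfolding l2n_eq integral_const_ivl .
qed

lemma cospoly_dense_wd:
  assumes f: "H10 f" and e: "e > 0"
  shows "\<exists>q. l2n (\<lambda>x. wd f x - cospoly q x) < e"
proof -
  obtain \<phi> where \<phi>: "test_fun \<phi>" "l2n (\<lambda>x. wd f x - deriv \<phi> x) < e / 4"
    using H10_approx[OF f, of "e / 4"] e by auto
  define d where "d = sqrt (e / (4 * pi))"
  have d: "d > 0" "d\<^sup>2 * pi = e / 4" using e by (auto simp: d_def field_simps)
  have "continuous_on {0..pi} (deriv \<phi>)"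
    using test_fun_deriv_continuous[OF \<phi>(1)] by (rule continuous_on_subset) auto
  from cospoly_dense[OF this d(1)] obtain q where q: "\<And>x. x \<in> {0..pi} \<Longrightarrow> \<bar>deriv \<phi> x - cospoly q x\<bar> < d"
    by blast
  note L = H1_L2_wd[OF H10_H1[OF f]] test_fun_L2_deriv[OF \<phi>(1)] L2_cospoly(1)[of q]
  have "l2n (\<lambda>x. deriv \<phi> x - cospoly q x) \<le> d\<^sup>2 * pi"
    using q L by (intro l2n_le_const L2_diff) (auto intro: less_imp_le)
  with l2n_diff_triangle[OF L] \<phi> d have "l2n (\<lambda>x. wd f x - cospoly q x) < e" by linarith
  then show ?thesis by blast
qed

text \<open>The supremum is over a countable family, and each member is measurable in \<open>s\<close> when
  applied to \<open>\<eta> s\<close> for a jointly measurable \<open>\<eta>\<close>; this is where measurability of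
  \<open>s \<mapsto> l2n (wd (\<eta> s))\<close> comes from.\<close>

lemma l2n_wd_eq_SUP:
  assumes f: "H10 f"
  shows "ennreal (l2n (wd f)) = (SUP q. ennreal (- 2 * l2ip f (cospoly' q) - l2n (cospoly q)))"
proof -
  note L = H1_L2_wd[OF H10_H1[OF f]]
  \<comment> \<open>Integration by parts turns the first term into twice the product of
    \<open>wd f\<close> and \<open>cospoly q\<close>; completing the square shows that the supremum
    is attained in the limit of approximants of \<open>wd f\<close>. The right-hand side may be
    negative, and \<open>ennreal\<close> then gives 0, which does not exceed the norm.\<close>
  have eq: "- 2 * l2ip f (cospoly' q) - l2n (cospoly q) = l2n (wd f) - l2n (\<lambda>x. wd f x - cospoly q x)" for q
    using l2n_lin[OF L L2_cospoly(1)[of q], of 1 "-1"]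
      H10_by_parts[OF f cospoly_DERIV continuous_cospoly', of q] by simp
  show ?thesis
    unfolding eq
  proof (rule antisym)
    show "(SUP q. ennreal (l2n (wd f) - l2n (\<lambda>x. wd f x - cospoly q x))) \<le> ennreal (l2n (wd f))"
      by (rule SUP_least) (simp add: ennreal_leI l2n_nonneg)
    show "ennreal (l2n (wd f)) \<le> (SUP q. ennreal (l2n (wd f) - l2n (\<lambda>x. wd f x - cospoly q x)))"
    proof (rule ennreal_le_epsilon)
      fix e :: real assume e: "0 < e"
      obtain q where q: "l2n (\<lambda>x. wd f x - cospoly q x) < e" using cospoly_dense_wd[OF f e] by blast
      have "ennreal (l2n (wd f)) \<le> ennreal (max 0 (l2n (wd f) - l2n (\<lambda>x. wd f x - cospoly q x)) + e)"
        using q by (intro ennreal_leI) auto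
      also have "\<dots> = ennreal (l2n (wd f) - l2n (\<lambda>x. wd f x - cospoly q x)) + ennreal e"
        using e by (subst ennreal_plus) (auto simp: ennreal_max_0)
      also have "\<dots> \<le> (SUP q. ennreal (l2n (wd f) - l2n (\<lambda>x. wd f x - cospoly q x))) + ennreal e"
        by (intro add_right_mono SUP_upper) auto
      finally show "ennreal (l2n (wd f)) \<le> (SUP q. ennreal (l2n (wd f) - l2n (\<lambda>x. wd f x - cospoly q x))) + ennreal e" .
    qed
  qed
qed

text \<open>On the null set of \<open>s\<close> where the slice is not in \<open>H10\<close>, its
  \<open>wd\<close> is arbitrary. Measurability of the slice norm can therefore be claimed only for
  the completed measure, for which null modifications are harmless.\<close>

lemma lebesgue_measurable_cong_AE:
  fixes f g :: "real \<Rightarrow> real"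
  assumes f: "f \<in> borel_measurable lborel" and eq: "AE x in lborel. f x = g x"
  shows "g \<in> borel_measurable lebesgue"
proof (rule measurableI)
  fix A :: "real set" assume A: "A \<in> sets borel"
  have f': "f \<in> borel_measurable lebesgue" using f by (rule measurable_completion)
  show "g -` A \<inter> space lebesgue \<in> sets lebesgue"
  proof (rule complete_measure.in_sets_AE[where A = "f -` A \<inter> space lebesgue"])
    show "complete_measure lebesgue" by (rule completion.complete_measure_axioms)
    show "AE x in lebesgue. (x \<in> f -` A \<inter> space lebesgue) = (x \<in> g -` A \<inter> space lebesgue)"
      using AE_completion[OF eq] by eventually_elim auto
    show "f -` A \<inter> space lebesgue \<in> sets lebesgue" using f' A by (rule measurable_sets)
  qed auto
qed simp

section \<open>Joint measurability and measurable slice norms\<close>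

definition halfl :: "real measure" where
  "halfl = restrict_space lebesgue {0<..}"

lemma space_halfl [simp]: "space halfl = {0<..}"
  by (simp add: halfl_def space_restrict_space)

lemma measurable_halfl_iff:
  "f \<in> borel_measurable halfl \<longleftrightarrow> (\<lambda>x. indicator {0<..} x * f x) \<in> borel_measurable lebesgue" for f :: "real \<Rightarrow> real"
  by (simp add: halfl_def borel_measurable_restrict_space_iff)

lemma integrable_halfl_iff:
  "integrable halfl f \<longleftrightarrow> set_integrable lebesgue {0<..} f" for f :: "real \<Rightarrow> real"
  by (simp add: halfl_def set_integrable_def integrable_restrict_space)

lemma integral_halfl: "(LINT x:{0<..}|lebesgue. f x) = (\<integral>x. f x \<partial>halfl)" for f :: "real \<Rightarrow> real"
  by (simp add: halfl_def set_lebesgue_integral_def integral_restrict_space)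

lemma AE_halfl_iff: "(AE x in halfl. P x) \<longleftrightarrow> (AE x in lborel. 0 < x \<longrightarrow> P x)"
  unfolding halfl_def by (subst AE_restrict_space_iff) (auto simp: AE_completion_iff)

definition jointly_measurable :: "(real \<Rightarrow> real \<Rightarrow> real) \<Rightarrow> bool" where
  "jointly_measurable \<eta> \<longleftrightarrow>
    (\<lambda>p. indicator {0<..} (fst p) * indicator {0<..<pi} (snd p) * \<eta> (fst p) (snd p)) \<in> borel_measurable (borel \<Otimes>\<^sub>M borel)"

lemma jointly_measurable_iff: "jointly_measurable \<eta> \<longleftrightarrow>
  set_borel_measurable lborel ({0<..} \<times> {0<..<pi}) (\<lambda>p::real\<times>real. \<eta> (fst p) (snd p))"
  unfolding jointly_measurable_def set_borel_measurable_def borel_prod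
  by (simp add: indicator_times)

lemma jointly_measurable_lin:
  "jointly_measurable \<eta> \<Longrightarrow> jointly_measurable \<zeta> \<Longrightarrow> jointly_measurable (\<lambda>s x. a * \<eta> s x + b * \<zeta> s x)"
  unfolding jointly_measurable_def
  by (drule (1) borel_measurable_add[OF borel_measurable_times[OF borel_measurable_const[of a]]
        borel_measurable_times[OF borel_measurable_const[of b]]])
     (simp add: algebra_simps)

lemma measurable_l2ip:
  assumes \<eta>: "jointly_measurable \<eta>" and h: "h \<in> borel_measurable borel"
  shows "(\<lambda>s. indicator {0<..} s * l2ip (\<eta> s) h) \<in> borel_measurable borel"
proof -
  have "(\<lambda>(s, x). indicator {0<..} s * indicator {0<..<pi} x * \<eta> s x * h x) \<in> borel_measurable (borel \<Otimes>\<^sub>M lborel)"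
  proof -
    have "(\<lambda>p. indicator {0<..} (fst p) * indicator {0<..<pi} (snd p) * \<eta> (fst p) (snd p) * h (snd p))
        \<in> borel_measurable (borel \<Otimes>\<^sub>M borel)"
      using \<eta> unfolding jointly_measurable_def
      by (rule borel_measurable_times) (rule measurable_compose[OF measurable_snd h])
    then show ?thesis by (simp add: case_prod_beta' cong: measurable_cong_sets)
  qed
  from lborel.borel_measurable_lebesgue_integral[OF this]
  have "(\<lambda>s. \<integral>x. indicator {0<..} s * indicator {0<..<pi} x * \<eta> s x * h x \<partial>lborel) \<in> borel_measurable borel"
    by simp
  moreover have "(\<integral>x. indicator {0<..} s * indicator {0<..<pi} x * \<eta> s x * h x \<partial>lborel)
      = indicator {0<..} s * l2ip (\<eta> s) h" for s :: real
  proof -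
    have "(\<integral>x. indicator {0<..} s * indicator {0<..<pi} x * \<eta> s x * h x \<partial>lborel)
       = (\<integral>x. indicator {0<..} s * (indicator {0<..<pi} x *\<^sub>R (\<eta> s x * h x)) \<partial>lborel)"
      by (simp add: mult_ac)
    also have "\<dots> = indicator {0<..} s * l2ip (\<eta> s) h"
      unfolding l2ip_def set_lebesgue_integral_def by (rule integral_mult_right_zero)
    finally show ?thesis .
  qed
  ultimately show ?thesis by simp
qed

lemma measurable_l2n_wd:
  assumes \<eta>: "jointly_measurable \<eta>" and H: "AE s in lborel. 0 < s \<longrightarrow> H10 (\<eta> s)"
  shows "(\<lambda>s. l2n (wd (\<eta> s))) \<in> borel_measurable halfl"
  unfolding measurable_halfl_iff
proof (rule lebesgue_measurable_cong_AE)
  define m where "m q s = indicator {0<..} s * (- 2 * l2ip (\<eta> s) (cospoly' q) - l2n (cospoly q))" for q s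
  have mm: "m q \<in> borel_measurable borel" for q
  proof -
    have "(\<lambda>s. - 2 * (indicator {0<..} s * l2ip (\<eta> s) (cospoly' q)) - indicator {0<..} s * l2n (cospoly q))
        \<in> borel_measurable borel"
      using measurable_l2ip[OF \<eta> borel_measurable_continuous_onI[OF continuous_cospoly'], of q]
      by (intro borel_measurable_diff borel_measurable_times[of "\<lambda>_. - 2"]) auto
    then show ?thesis unfolding m_def[abs_def] by (simp add: algebra_simps)
  qed
  then have "(\<lambda>s. SUP q. ennreal (m q s)) \<in> borel_measurable borel"
    by (intro borel_measurable_SUP) auto
  then show "(\<lambda>s. enn2real (SUP q. ennreal (m q s))) \<in> borel_measurable lborel" by simp
  show "AE s in lborel. enn2real (SUP q. ennreal (m q s)) = indicator {0<..} s * l2n (wd (\<eta> s))"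
    using H
  proof eventually_elim
    case (elim s)
    show ?case
    proof (cases "s > 0")
      case True
      with elim l2n_wd_eq_SUP[of "\<eta> s", symmetric] show ?thesis
        by (simp add: m_def l2n_nonneg)
    qed (simp add: m_def)
  qed
qed

section \<open>Null sets in the plane and uniqueness of integrands\<close>

lemma AE_lborel_pair_swap:
  fixes P :: "real \<Rightarrow> real \<Rightarrow> bool"
  assumes "AE p in lborel \<Otimes>\<^sub>M lborel. P (fst p) (snd p)"
  shows "AE x in lborel. AE s in lborel. P s x"
proof -
  \<comment> \<open>The set where \<open>P\<close> fails may be nonmeasurable, whereas exchanging
    the order of the quantifiers needs measurability; a measurable null superset supplies
    it.\<close>
  obtain N where N: "N \<in> null_sets (lborel \<Otimes>\<^sub>M lborel :: (real \<times> real) measure)"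
    "{p \<in> space (lborel \<Otimes>\<^sub>M lborel). \<not> P (fst p) (snd p)} \<subseteq> N"
    using assms unfolding eventually_ae_filter by auto
  have "AE p in lborel \<Otimes>\<^sub>M lborel. p \<notin> N" using N(1) by (rule AE_not_in)
  then have "AE s in lborel. AE x in lborel. (s, x) \<notin> N" by (rule lborel_pair.AE_pair)
  moreover have "{p \<in> space (lborel \<Otimes>\<^sub>M lborel). (fst p, snd p) \<notin> N} \<in> sets (lborel \<Otimes>\<^sub>M lborel)"
  proof -
    have "space (lborel \<Otimes>\<^sub>M lborel) - N \<in> sets (lborel \<Otimes>\<^sub>M lborel)"
      using null_setsD2[OF N(1)] by (rule sets.compl_sets)
    also have "space (lborel \<Otimes>\<^sub>M lborel) - N = {p \<in> space (lborel \<Otimes>\<^sub>M lborel). (fst p, snd p) \<notin> N}" by auto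
    finally show ?thesis .
  qed
  ultimately have "AE x in lborel. AE s in lborel. (s, x) \<notin> N"
    by (subst lborel_pair.AE_commute[symmetric]) auto
  then show ?thesis
  proof eventually_elim
    case (elim x)
    then show ?case
      by eventually_elim (use N(2) in \<open>auto simp: space_pair_measure subset_iff\<close>)
  qed
qed

lemma continuous_indefinite_integral:
  fixes f :: "real \<Rightarrow> real"
  assumes f: "integrable lborel f"
  shows "continuous_on UNIV (\<lambda>a. \<integral>x. indicator {..a} x * f x \<partial>lborel)"
  unfolding continuous_on_sequentially
proof safe
  fix u :: "nat \<Rightarrow> real" and a assume u: "u \<longlonglongrightarrow> a"
  show "((\<lambda>a. \<integral>x. indicator {..a} x * f x \<partial>lborel) \<circ> u) \<longlonglongrightarrow> (\<integral>x. indicator {..a} x * f x \<partial>lborel)"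
    unfolding o_def
  proof (rule integral_dominated_convergence[where w = "\<lambda>x. \<bar>f x\<bar>"])
    show "AE x in lborel. (\<lambda>n. indicator {..u n} x * f x) \<longlonglongrightarrow> indicator {..a} x * f x"
      using AE_lborel_singleton[of a]
    proof eventually_elim
      case (elim x)
      then consider "x < a" | "x > a" by linarith
      then have "\<forall>\<^sub>F n in sequentially. indicator {..u n} x * f x = indicator {..a} x * f x"
      proof cases
        case 1
        from order_tendstoD(1)[OF u this] show ?thesis by eventually_elim (use 1 in auto)
      next
        case 2
        from order_tendstoD(2)[OF u this] show ?thesis by eventually_elim (use 2 in auto)
      qed
      then show ?case by (rule tendsto_eventually)
    qed
  qed (use f in \<open>auto simp: abs_mult indicator_def\<close>)
qed

text \<open>The indefinite integral is continuous, so its zero set is closed, and a closed set of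
  full measure is everything; this upgrades the hypothesis from almost every to every
  \<open>a\<close>. Beyond \<open>N\<close> the integral is constant.\<close>

lemma AE_zero_of_indefinite:
  fixes f :: "real \<Rightarrow> real"
  assumes f: "integrable lborel f" and z: "\<And>x. x \<ge> N \<Longrightarrow> f x = 0"
    and 0: "AE a in lborel. a < N \<longrightarrow> (\<integral>x. indicator {..a} x * f x \<partial>lborel) = 0"
  shows "AE x in lborel. f x = 0"
proof (rule AE_zero_of_atMost[OF f])
  let ?G = "\<lambda>a. \<integral>x. indicator {..a} x * f x \<partial>lborel"
  have c: "closed {a. ?G a = 0}"
    using continuous_indefinite_integral[OF f] by (intro closed_Collect_eq) auto
  have "a \<in> {a. ?G a = 0} \<union> {N..}" for a
  proof (rule mem_closed_if_AE_lebesgue)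
    show "closed ({a. ?G a = 0} \<union> {N..})" using c by auto
    show "AE a in lebesgue. a \<in> {a. ?G a = 0} \<union> {N..}"
      using AE_completion[OF 0] by eventually_elim auto
  qed
  then have "{..<N} \<subseteq> {a. ?G a = 0}" by fastforce
  then have "closure {..<N} \<subseteq> {a. ?G a = 0}" using c by (rule closure_minimal)
  then have le: "?G a = 0" if "a \<le> N" for a using that by auto
  show "?G a = 0" for a
  proof (cases "a \<le> N")
    case False
    then have "?G a = ?G N"
      using z by (intro Bochner_Integration.integral_cong) (auto simp: indicator_def)
    then show ?thesis using le[of N] by simp
  qed (rule le)
qed

section \<open>The memory space\<close>

locale memory_kernel =
  fixes \<kappa> :: "real \<Rightarrow> real"
  assumes kernel_cont: "continuous_on {0..} \<kappa>"
    and kernel_int: "set_integrable lborel {0..} \<kappa>"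
    and kernel_pos: "\<And>s. s \<ge> 0 \<Longrightarrow> \<kappa> s > 0"
begin

lemma kernel_integrable_lborel: "set_integrable lborel {0<..} \<kappa>"
  by (rule set_integrable_subset[OF kernel_int]) auto

text \<open>A bridge between the two measures of the definitions: \<open>etanorm\<close> integrates
  over the completed measure, \<open>is_mem_int\<close> and \<open>g0\<close> over
  \<open>lborel\<close>.\<close>

lemma integrable_halfl_lborel:
  fixes f :: "real \<Rightarrow> real"
  assumes "set_integrable lborel {0<..} f"
  shows "integrable halfl f" "(\<integral>s. f s \<partial>halfl) = (LINT s:{0<..}|lborel. f s)"
proof -
  have m: "(\<lambda>x. indicator {0<..} x *\<^sub>R f x) \<in> borel_measurable lborel"
    using assms unfolding set_integrable_def by (rule borel_measurable_integrable)
  show "integrable halfl f"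
    unfolding integrable_halfl_iff using assms unfolding set_integrable_def
    by (subst integrable_completion[OF m])
  show "(\<integral>s. f s \<partial>halfl) = (LINT s:{0<..}|lborel. f s)"
    unfolding integral_halfl[symmetric] set_lebesgue_integral_def by (rule integral_completion[OF m])
qed

lemma kernel_integrable: "integrable halfl \<kappa>"
  by (rule integrable_halfl_lborel(1)[OF kernel_integrable_lborel])

lemma kernel_measurable: "\<kappa> \<in> borel_measurable halfl"
  using kernel_integrable by (rule borel_measurable_integrable)

lemma inV_iff: "inV \<kappa> \<eta> \<longleftrightarrow> jointly_measurable \<eta> \<and> (AE s in halfl. H10 (\<eta> s)) \<and>
     integrable halfl (\<lambda>s. \<kappa> s * l2n (wd (\<eta> s)))"
  by (simp add: inV_def jointly_measurable_iff AE_halfl_iff integrable_halfl_iff)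

lemma etanorm_eq: "etanorm \<kappa> \<eta> = (\<integral>s. \<kappa> s * l2n (wd (\<eta> s)) \<partial>halfl)"
  by (simp add: etanorm_def integral_halfl)

text \<open>The pointwise bound by the two given norms yields integrability only together with the
  measurability from \<open>measurable_l2n_wd\<close>.\<close>

lemma inV_lin:
  assumes "inV \<kappa> \<eta>" "inV \<kappa> \<zeta>" shows "inV \<kappa> (\<lambda>s x. a * \<eta> s x + b * \<zeta> s x)"
proof -
  have j: "jointly_measurable (\<lambda>s x. a * \<eta> s x + b * \<zeta> s x)"
    using assms by (intro jointly_measurable_lin) (auto simp: inV_iff)
  have H: "AE s in halfl. H10 (\<eta> s)" "AE s in halfl. H10 (\<zeta> s)"
    using assms by (auto simp: inV_iff)
  have H': "AE s in halfl. H10 (\<lambda>x. a * \<eta> s x + b * \<zeta> s x)"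
    using H by eventually_elim (rule H10_lin)
  have "integrable halfl (\<lambda>s. \<kappa> s * l2n (wd (\<lambda>x. a * \<eta> s x + b * \<zeta> s x)))"
  proof (rule Bochner_Integration.integrable_bound)
    show "integrable halfl (\<lambda>s. 2 * a\<^sup>2 * (\<kappa> s * l2n (wd (\<eta> s))) + 2 * b\<^sup>2 * (\<kappa> s * l2n (wd (\<zeta> s))))"
      using assms by (simp add: inV_iff)
    show "(\<lambda>s. \<kappa> s * l2n (wd (\<lambda>x. a * \<eta> s x + b * \<zeta> s x))) \<in> borel_measurable halfl"
      using j H' kernel_measurable
      by (intro borel_measurable_times measurable_l2n_wd) (auto simp: AE_halfl_iff)
    show "AE s in halfl. norm (\<kappa> s * l2n (wd (\<lambda>x. a * \<eta> s x + b * \<zeta> s x)))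
        \<le> norm (2 * a\<^sup>2 * (\<kappa> s * l2n (wd (\<eta> s))) + 2 * b\<^sup>2 * (\<kappa> s * l2n (wd (\<zeta> s))))"
      using H AE_space
    proof eventually_elim
      case (elim s)
      have k: "\<kappa> s > 0" using elim kernel_pos[of s] by simp
      note h = elim(1)[THEN H10_H1] elim(2)[THEN H10_H1]
      have "l2n (wd (\<lambda>x. a * \<eta> s x + b * \<zeta> s x)) \<le> 2 * a\<^sup>2 * l2n (wd (\<eta> s)) + 2 * b\<^sup>2 * l2n (wd (\<zeta> s))"
        using l2n_wd_lin[OF h] l2n_lin[OF h[THEN H1_L2_wd]] l2n_add_le[OF h[THEN H1_L2_wd]] by simp
      then have "\<kappa> s * l2n (wd (\<lambda>x. a * \<eta> s x + b * \<zeta> s x))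
          \<le> \<kappa> s * (2 * a\<^sup>2 * l2n (wd (\<eta> s)) + 2 * b\<^sup>2 * l2n (wd (\<zeta> s)))"
        using k by (intro mult_left_mono) auto
      then have "\<kappa> s * l2n (wd (\<lambda>x. a * \<eta> s x + b * \<zeta> s x))
          \<le> 2 * a\<^sup>2 * (\<kappa> s * l2n (wd (\<eta> s))) + 2 * b\<^sup>2 * (\<kappa> s * l2n (wd (\<zeta> s)))"
        by (simp add: algebra_simps)
      then show ?case using k by (simp add: l2n_nonneg)
    qed
  qed
  with j H' show ?thesis by (simp add: inV_iff)
qed

text \<open>Defined by polarization: the measurability and integrability that a direct integral of
  slice products would require are inherited from \<open>inV_lin\<close>.\<close>

definition etaip :: "(real \<Rightarrow> real \<Rightarrow> real) \<Rightarrow> (real \<Rightarrow> real \<Rightarrow> real) \<Rightarrow> real" where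
  "etaip \<eta> \<zeta> = (etanorm \<kappa> (\<lambda>s x. 1 * \<eta> s x + 1 * \<zeta> s x) - etanorm \<kappa> (\<lambda>s x. 1 * \<eta> s x + (-1) * \<zeta> s x)) / 4"

lemma etanorm_lin:
  assumes "inV \<kappa> \<eta>" "inV \<kappa> \<zeta>"
  shows "etanorm \<kappa> (\<lambda>s x. a * \<eta> s x + b * \<zeta> s x)
    = a\<^sup>2 * etanorm \<kappa> \<eta> + 2 * a * b * etaip \<eta> \<zeta> + b\<^sup>2 * etanorm \<kappa> \<zeta>"
proof -
  define e z where "e s = \<kappa> s * l2n (wd (\<eta> s))" and "z s = \<kappa> s * l2n (wd (\<zeta> s))" for s
  define l where "l a b s = \<kappa> s * l2n (wd (\<lambda>x. a * \<eta> s x + b * \<zeta> s x))" for a b s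
  have H: "AE s in halfl. H10 (\<eta> s)" "AE s in halfl. H10 (\<zeta> s)"
    and i: "integrable halfl e" "integrable halfl z"
    using assms by (auto simp: inV_iff e_def[abs_def] z_def[abs_def])
  have li: "integrable halfl (l a b)" for a b
    using inV_lin[OF assms, of a b] by (simp add: inV_iff l_def[abs_def])
  have "AE s in halfl. l a b s = a\<^sup>2 * e s + a * b / 2 * (l 1 1 s - l 1 (-1) s) + b\<^sup>2 * z s"
    using H
  proof eventually_elim
    case (elim s)
    show ?case
      unfolding l_def e_def z_def l2n_wd_lin[OF elim(1)[THEN H10_H1] elim(2)[THEN H10_H1]]
      by (simp add: algebra_simps)
  qed
  then have "(\<integral>s. l a b s \<partial>halfl) = (\<integral>s. a\<^sup>2 * e s + a * b / 2 * (l 1 1 s - l 1 (-1) s) + b\<^sup>2 * z s \<partial>halfl)"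
    using i li by (intro integral_cong_AE borel_measurable_integrable Bochner_Integration.integrable_add
        integrable_mult_right Bochner_Integration.integrable_diff)
  also have "\<dots> = a\<^sup>2 * (\<integral>s. e s \<partial>halfl) + a * b / 2 * ((\<integral>s. l 1 1 s \<partial>halfl) - (\<integral>s. l 1 (-1) s \<partial>halfl))
      + b\<^sup>2 * (\<integral>s. z s \<partial>halfl)"
    using i li by simp
  finally show ?thesis
    unfolding etanorm_eq etaip_def l_def e_def z_def by (simp add: algebra_simps diff_divide_distrib)
qed

lemma etanorm_nonneg: "0 \<le> etanorm \<kappa> \<eta>"
  unfolding etanorm_eq using kernel_pos
  by (intro integral_nonneg_AE AE_I2) (auto simp: l2n_nonneg less_imp_le)

text \<open>By the Poincare inequality, and because the kernel is bounded below on \<open>[0,T]\<close>; without it the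
  integral in \<open>is_eta_s\<close> could be the junk value 0 and the derivative would not be unique.\<close>

lemma inV_L2_bound:
  assumes "inV \<kappa> \<zeta>" "T > 0"
  shows "integrable (lborel \<Otimes>\<^sub>M lborel) (\<lambda>(s, x). indicator {0<..T} s * indicator {0<..<pi} x * \<zeta> s x)"
proof -
  let ?f = "\<lambda>s x. indicator {0<..T} s * indicator {0<..<pi} x * \<zeta> s x :: real"
  have m: "case_prod ?f \<in> borel_measurable (borel \<Otimes>\<^sub>M borel)"
  proof -
    have "(\<lambda>p. indicator {..T} (fst p) * (indicator {0<..} (fst p) * indicator {0<..<pi} (snd p) * \<zeta> (fst p) (snd p)))
      \<in> borel_measurable (borel \<Otimes>\<^sub>M borel)"
    proof (rule borel_measurable_times)
      show "(\<lambda>p. indicator {..T} (fst p) :: real) \<in> borel_measurable (borel \<Otimes>\<^sub>M borel)"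
        by (rule measurable_compose[OF measurable_fst]) simp
    qed (use assms(1) in \<open>simp add: inV_iff jointly_measurable_def\<close>)
    also have "(\<lambda>p. indicator {..T} (fst p) * (indicator {0<..} (fst p) * indicator {0<..<pi} (snd p) * \<zeta> (fst p) (snd p)))
      = case_prod ?f" by (auto simp: fun_eq_iff indicator_def)
    finally show ?thesis .
  qed
  then have m': "case_prod ?f \<in> borel_measurable (lborel \<Otimes>\<^sub>M lborel)"
    by (simp cong: measurable_cong_sets)
  obtain k where k: "k > 0" "\<And>s. s \<in> {0..T} \<Longrightarrow> k \<le> \<kappa> s"
  proof -
    have "continuous_on {0..T} \<kappa>" by (rule continuous_on_subset[OF kernel_cont]) auto
    then obtain s0 where "s0 \<in> {0..T}" "\<And>s. s \<in> {0..T} \<Longrightarrow> \<kappa> s0 \<le> \<kappa> s"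
      using continuous_attains_inf[of "{0..T}" \<kappa>] assms(2) by auto
    then show ?thesis using that[of "\<kappa> s0"] kernel_pos[of s0] by auto
  qed
  have H: "AE s in halfl. H10 (\<zeta> s)" and i: "integrable halfl (\<lambda>s. \<kappa> s * l2n (wd (\<zeta> s)))"
    using assms(1) by (auto simp: inV_iff)
  \<comment> \<open>The absolute value of \<open>\<zeta>\<close> is at most its square plus 1. The
    square is controlled by the Poincare constant and \<open>k \<le> \<kappa> s\<close>, and
    \<open>pi\<close> is the integral of 1.\<close>
  let ?B = "\<lambda>s. indicator {0<..} s * (16 * pi\<^sup>2 / k * (\<kappa> s * l2n (wd (\<zeta> s)))) + pi * indicator {0<..T} s"
  have iB: "integrable lebesgue ?B"
  proof (rule Bochner_Integration.integrable_add)
    have "set_integrable lebesgue {0<..} (\<lambda>s. 16 * pi\<^sup>2 / k * (\<kappa> s * l2n (wd (\<zeta> s))))"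
      unfolding integrable_halfl_iff[symmetric] using i by (rule integrable_mult_right)
    then show "integrable lebesgue (\<lambda>s. indicator {0<..} s * (16 * pi\<^sup>2 / k * (\<kappa> s * l2n (wd (\<zeta> s)))))"
      by (simp add: set_integrable_def)
    show "integrable lebesgue (\<lambda>s. pi * indicator {0<..T} s)"
      using assms(2) by (intro integrable_mult_right integrable_real_indicator) auto
  qed
  have slice: "(\<integral>\<^sup>+x. ennreal (norm (?f s x)) \<partial>lborel) \<le> ennreal (?B s)" if "0 < s \<longrightarrow> H10 (\<zeta> s)" for s
  proof (cases "s \<in> {0<..T}")
    case True
    with that have h: "H10 (\<zeta> s)" by simp
    note L = H1_L2[OF H10_H1[OF h]]
    have "(\<integral>\<^sup>+x. ennreal (norm (?f s x)) \<partial>lborel) = (\<integral>\<^sup>+x. ennreal \<bar>\<zeta> s x\<bar> * indicator {0<..<pi} x \<partial>lborel)"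
      using True by (intro nn_integral_cong) (auto simp: indicator_def)
    also have "\<dots> = (\<integral>\<^sup>+x. ennreal \<bar>\<zeta> s x\<bar> \<partial>ivl)"
      unfolding ivl_def by (rule nn_integral_restrict_space[symmetric]) simp
    also have "\<dots> \<le> (\<integral>\<^sup>+x. ennreal ((\<zeta> s x)\<^sup>2 + 1) \<partial>ivl)"
    proof (intro nn_integral_mono ennreal_leI)
      fix x
      have "0 \<le> (\<bar>\<zeta> s x\<bar> - 1)\<^sup>2" by simp
      then have "2 * \<bar>\<zeta> s x\<bar> \<le> (\<zeta> s x)\<^sup>2 + 1" by (simp add: power2_eq_square algebra_simps)
      then show "\<bar>\<zeta> s x\<bar> \<le> (\<zeta> s x)\<^sup>2 + 1" by linarith
    qed
    also have "\<dots> = ennreal (\<integral>x. (\<zeta> s x)\<^sup>2 + 1 \<partial>ivl)"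
      using L by (intro nn_integral_eq_integral) (auto simp: L2_iff)
    also have "(\<integral>x. (\<zeta> s x)\<^sup>2 + 1 \<partial>ivl) = l2n (\<zeta> s) + pi"
    proof -
      have "(\<integral>x. (\<zeta> s x)\<^sup>2 + 1 \<partial>ivl) = (\<integral>x. (\<zeta> s x)\<^sup>2 \<partial>ivl) + (\<integral>x. 1 \<partial>ivl)"
        using L by (intro Bochner_Integration.integral_add) (auto simp: L2_iff)
      then show ?thesis unfolding integral_const_ivl l2n_eq by simp
    qed
    also have "ennreal (l2n (\<zeta> s) + pi) \<le> ennreal (?B s)"
    proof (rule ennreal_leI)
      have "16 * pi\<^sup>2 * l2n (wd (\<zeta> s)) = 16 * pi\<^sup>2 / k * (k * l2n (wd (\<zeta> s)))" using k by simp
      also have "\<dots> \<le> 16 * pi\<^sup>2 / k * (\<kappa> s * l2n (wd (\<zeta> s)))"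
        using k True by (intro mult_left_mono mult_right_mono l2n_nonneg) auto
      finally show "l2n (\<zeta> s) + pi \<le> ?B s" using H10_Poincare[OF h] True by simp
    qed
    finally show ?thesis .
  qed simp
  show ?thesis
    unfolding integrable_iff_bounded
  proof
    have "(\<integral>\<^sup>+p. ennreal (norm (case_prod ?f p)) \<partial>(lborel \<Otimes>\<^sub>M lborel))
        = (\<integral>\<^sup>+s. \<integral>\<^sup>+x. ennreal (norm (?f s x)) \<partial>lborel \<partial>lborel)"
      using m' by (subst lborel.nn_integral_fst[symmetric]) (auto simp: case_prod_beta')
    \<comment> \<open>The bound \<open>?B\<close> is measurable only for the completion, so the
      outer integral is moved there before comparing.\<close>
    also have "\<dots> = (\<integral>\<^sup>+s. \<integral>\<^sup>+x. ennreal (norm (?f s x)) \<partial>lborel \<partial>lebesgue)"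
      by (rule nn_integral_completion[symmetric])
    also have "\<dots> \<le> (\<integral>\<^sup>+s. ennreal (?B s) \<partial>lebesgue)"
    proof (rule nn_integral_mono_AE)
      have "AE s in lebesgue. 0 < s \<longrightarrow> H10 (\<zeta> s)"
        using H unfolding AE_halfl_iff by (rule AE_completion)
      then show "AE s in lebesgue. (\<integral>\<^sup>+x. ennreal (norm (?f s x)) \<partial>lborel) \<le> ennreal (?B s)"
        by eventually_elim (rule slice)
    qed
    also have "\<dots> = ennreal (\<integral>s. ?B s \<partial>lebesgue)"
      using k kernel_pos
      by (intro nn_integral_eq_integral iB AE_I2) (auto simp: indicator_def l2n_nonneg less_imp_le)
    also have "\<dots> < \<infinity>" by simp
    finally show "(\<integral>\<^sup>+p. ennreal (norm (case_prod ?f p)) \<partial>(lborel \<Otimes>\<^sub>M lborel)) < \<infinity>" .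
  qed (rule m')
qed

text \<open>By Fubini almost every slice in \<open>s\<close> is integrable on each
  \<open>(0,N]\<close>, and for almost every \<open>x\<close> the indefinite integrals of both
  candidates agree for almost every \<open>s\<close>; hence the slices agree. Joint measurability
  then permits returning to the order "almost every \<open>s\<close>, almost every
  \<open>x\<close>".\<close>

lemma is_eta_s_unique:
  assumes 1: "is_eta_s \<kappa> \<eta> \<zeta>" and 2: "is_eta_s \<kappa> \<eta> \<zeta>'"
  shows "AE s in halfl. AE x in ivl. \<zeta> s x = \<zeta>' s x"
proof -
  have V: "inV \<kappa> \<zeta>" "inV \<kappa> \<zeta>'" using 1 2 by (auto simp: is_eta_s_def)
  have slices: "AE x in lborel. \<forall>N::nat. integrable lborel (\<lambda>s. indicator {0<..real (Suc N)} s * indicator {0<..<pi} x * z s x)"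
    if "inV \<kappa> z" for z
    unfolding AE_all_countable
    using lborel_pair.AE_integrable_snd[OF inV_L2_bound[OF that]] by auto
  have "AE p in lborel \<Otimes>\<^sub>M lborel. fst p \<in> {0<..} \<and> snd p \<in> {0<..<pi} \<longrightarrow>
      (LINT r:{0..fst p}|lborel. \<zeta> r (snd p)) = (LINT r:{0..fst p}|lborel. \<zeta>' r (snd p))"
    using 1 2 unfolding is_eta_s_def lborel_prod by (auto simp: mem_Times_iff)
  from AE_lborel_pair_swap[OF this]
  have eq: "AE x in lborel. AE s in lborel. s \<in> {0<..} \<and> x \<in> {0<..<pi} \<longrightarrow>
      (LINT r:{0..s}|lborel. \<zeta> r x) = (LINT r:{0..s}|lborel. \<zeta>' r x)" .
  let ?i = "\<lambda>z s x. indicator {0<..} s * indicator {0<..<pi} x * z s x :: real"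
  have ae: "AE x in lborel. AE s in lborel. ?i \<zeta> s x = ?i \<zeta>' s x"
    using eq slices[OF V(1)] slices[OF V(2)]
  proof eventually_elim
    case (elim x)
    show ?case
    proof (cases "x \<in> {0<..<pi}")
      case x: True
      have i: "integrable lborel (\<lambda>s. indicator {0<..real (Suc N)} s * \<zeta> s x)"
        "integrable lborel (\<lambda>s. indicator {0<..real (Suc N)} s * \<zeta>' s x)" for N
        using elim(2)[rule_format, of N] elim(3)[rule_format, of N] x by auto
      have "AE s in lborel. \<forall>N. indicator {0<..<real (Suc N)} s * (\<zeta> s x - \<zeta>' s x) = 0"
        unfolding AE_all_countable
      proof
        fix N
        let ?N = "real (Suc N)"
        show "AE s in lborel. indicator {0<..<?N} s * (\<zeta> s x - \<zeta>' s x) = 0"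
        proof (rule AE_zero_of_indefinite[where N = ?N])
          have "integrable lborel (\<lambda>s. indicator {..<?N} s *\<^sub>R
              (indicator {0<..?N} s * \<zeta> s x - indicator {0<..?N} s * \<zeta>' s x))"
            by (intro integrable_mult_indicator Bochner_Integration.integrable_diff i) simp
          also have "(\<lambda>s. indicator {..<?N} s *\<^sub>R
              (indicator {0<..?N} s * \<zeta> s x - indicator {0<..?N} s * \<zeta>' s x))
              = (\<lambda>s. indicator {0<..<?N} s * (\<zeta> s x - \<zeta>' s x))"
            by (auto simp: fun_eq_iff indicator_def)
          finally show "integrable lborel (\<lambda>s. indicator {0<..<?N} s * (\<zeta> s x - \<zeta>' s x))" .
          show "AE a in lborel. a < ?N \<longrightarrow> (\<integral>s. indicator {..a} s * (indicator {0<..<?N} s * (\<zeta> s x - \<zeta>' s x)) \<partial>lborel) = 0"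
            using elim(1)
          proof eventually_elim
            case (elim a)
            show ?case
            proof (intro impI, cases "a > 0")
              case a: True
              assume aN: "a < ?N"
              have sub: "set_integrable lborel {0<..a} (\<lambda>s. \<zeta> s x)" "set_integrable lborel {0<..a} (\<lambda>s. \<zeta>' s x)"
              proof -
                have "set_integrable lborel {0<..?N} (\<lambda>s. \<zeta> s x)" "set_integrable lborel {0<..?N} (\<lambda>s. \<zeta>' s x)"
                  using i[of N] by (simp_all add: set_integrable_def)
                moreover have "{0<..a} \<subseteq> {0<..?N}" using aN by auto
                ultimately show "set_integrable lborel {0<..a} (\<lambda>s. \<zeta> s x)" "set_integrable lborel {0<..a} (\<lambda>s. \<zeta>' s x)"
                  by (auto intro: set_integrable_subset)
              qed
              have dd: "(LINT r:{0..a}|lborel. z r x) = (LINT r:{0<..a}|lborel. z r x)" for z :: "real \<Rightarrow> real \<Rightarrow> real"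
                by (rule set_integral_discrete_difference[of "{0}"]) auto
              have "(\<integral>s. indicator {..a} s * (indicator {0<..<?N} s * (\<zeta> s x - \<zeta>' s x)) \<partial>lborel)
                  = (LINT s:{0<..a}|lborel. \<zeta> s x - \<zeta>' s x)"
                unfolding set_lebesgue_integral_def using aN
                by (intro Bochner_Integration.integral_cong) (auto simp: indicator_def)
              also have "\<dots> = 0"
                using elim a x sub by (simp add: dd)
              finally show "(\<integral>s. indicator {..a} s * (indicator {0<..<?N} s * (\<zeta> s x - \<zeta>' s x)) \<partial>lborel) = 0" .
            next
              case a: False
              have "(\<integral>s. indicator {..a} s * (indicator {0<..<?N} s * (\<zeta> s x - \<zeta>' s x)) \<partial>lborel) = (\<integral>s. 0 \<partial>(lborel :: real measure))"
                by (rule Bochner_Integration.integral_cong) (use a in \<open>auto simp: indicator_def\<close>)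
              then show "(\<integral>s. indicator {..a} s * (indicator {0<..<?N} s * (\<zeta> s x - \<zeta>' s x)) \<partial>lborel) = 0" by simp
            qed
          qed
        qed auto
      qed
      then show ?thesis
      proof eventually_elim
        case (elim s)
        show ?case
        proof (cases "s > 0")
          case True
          obtain N where "s < real N" using reals_Archimedean2 by blast
          then have "s \<in> {0<..<real (Suc N)}" using True by auto
          then show ?thesis using elim[rule_format, of N] by simp
        qed simp
      qed
    qed simp
  qed
  have meas: "{p \<in> space (lborel \<Otimes>\<^sub>M lborel). ?i \<zeta> (fst p) (snd p) = ?i \<zeta>' (fst p) (snd p)} \<in> sets (lborel \<Otimes>\<^sub>M lborel)"
  proof (rule borel_measurable_eq)
    show "(\<lambda>p. ?i \<zeta> (fst p) (snd p)) \<in> borel_measurable (lborel \<Otimes>\<^sub>M lborel)"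
      "(\<lambda>p. ?i \<zeta>' (fst p) (snd p)) \<in> borel_measurable (lborel \<Otimes>\<^sub>M lborel)"
      using V by (auto simp: inV_iff jointly_measurable_def cong: measurable_cong_sets)
  qed
  have "AE s in lborel. AE x in lborel. ?i \<zeta> s x = ?i \<zeta>' s x"
    using lborel_pair.AE_commute[where P = "\<lambda>s x. ?i \<zeta> s x = ?i \<zeta>' s x", OF meas] ae by (rule iffD2)
  then show ?thesis
    unfolding AE_halfl_iff AE_ivl_iff
  proof eventually_elim
    case (elim s)
    then show ?case
      by (intro impI, elim eventually_mono) (auto simp: indicator_def)
  qed
qed

end

section \<open>The phase space\<close>

lemma st_lin_simps [simp]:
  "su (st_lin a U b W) = (\<lambda>x. a * su U x + b * su W x)"
  "sv (st_lin a U b W) = (\<lambda>x. a * sv U x + b * sv W x)"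
  "sphi (st_lin a U b W) = (\<lambda>x. a * sphi U x + b * sphi W x)"
  "spsi (st_lin a U b W) = (\<lambda>x. a * spsi U x + b * spsi W x)"
  "stheta (st_lin a U b W) = (\<lambda>x. a * stheta U x + b * stheta W x)"
  "seta (st_lin a U b W) = (\<lambda>s x. a * seta U s x + b * seta W s x)"
  by (simp_all add: st_lin_def)

lemma H1star_iff: "H1star f \<longleftrightarrow> H1 f \<and> (\<integral>x. f x \<partial>ivl) = 0"
  by (simp add: H1star_def integral_ivl)

lemma L2star_iff: "L2star f \<longleftrightarrow> L2 f \<and> (\<integral>x. f x \<partial>ivl) = 0"
  by (simp add: L2star_def integral_ivl)

lemma integral_ivl_lin:
  "L2 f \<Longrightarrow> L2 g \<Longrightarrow> (\<integral>x. a * f x + b * g x \<partial>ivl) = a * (\<integral>x. f x \<partial>ivl) + b * (\<integral>x. g x \<partial>ivl)"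
  using L2_integrable[of f] L2_integrable[of g] by simp

lemma H1star_lin: "H1star f \<Longrightarrow> H1star g \<Longrightarrow> H1star (\<lambda>x. a * f x + b * g x)"
  using integral_ivl_lin[of f g a b] by (simp add: H1star_iff H1_lin H1_L2)

lemma L2star_lin: "L2star f \<Longrightarrow> L2star g \<Longrightarrow> L2star (\<lambda>x. a * f x + b * g x)"
  using integral_ivl_lin[of f g a b] by (simp add: L2star_iff L2_lin)

locale porous = memory_kernel \<kappa> for \<kappa> +
  fixes rho J c mu b alpha xi beta :: real
  assumes pos: "rho > 0" "J > 0" "c > 0" "mu > 0" "b > 0" "alpha > 0" "xi > 0"
    and coupling: "mu * xi > b\<^sup>2"
begin

abbreviation N :: "st \<Rightarrow> real" where
  "N \<equiv> Hnorm rho J c mu b alpha xi \<kappa>"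

abbreviation A :: "st \<Rightarrow> st" where
  "A \<equiv> Aop rho J c mu b alpha xi beta \<kappa>"

definition Q :: "st \<Rightarrow> real" where
  "Q U = mu * l2n (wd (su U)) + xi * l2n (sphi U) + 2 * b * l2ip (sphi U) (wd (su U))
    + rho * l2n (sv U) + alpha * l2n (wd (sphi U)) + J * l2n (spsi U)
    + c * l2n (stheta U) + etanorm \<kappa> (seta U)"

definition B :: "st \<Rightarrow> st \<Rightarrow> real" where
  "B U W = mu * l2ip (wd (su U)) (wd (su W)) + xi * l2ip (sphi U) (sphi W)
    + b * (l2ip (sphi U) (wd (su W)) + l2ip (sphi W) (wd (su U)))
    + rho * l2ip (sv U) (sv W) + alpha * l2ip (wd (sphi U)) (wd (sphi W)) + J * l2ip (spsi U) (spsi W)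
    + c * l2ip (stheta U) (stheta W) + etaip (seta U) (seta W)"

lemma N_eq: "N U = sqrt (Q U)"
  by (simp add: Hnorm_def Q_def)

lemma inH_lin: "inH \<kappa> U \<Longrightarrow> inH \<kappa> W \<Longrightarrow> inH \<kappa> (st_lin a U a' W)"
  by (simp add: inH_def H10_lin L2_lin H1star_lin L2star_lin inV_lin)

lemma inH_H1:
  assumes "inH \<kappa> U"
  shows "H1 (su U)" "H1 (sphi U)" "L2 (sv U)" "L2 (spsi U)" "L2 (stheta U)" "inV \<kappa> (seta U)"
  using assms by (auto simp: inH_def H10_H1 H1star_iff L2star_iff)

lemma Q_lin:
  assumes U: "inH \<kappa> U" and W: "inH \<kappa> W"
  shows "Q (st_lin p U q W) = p\<^sup>2 * Q U + 2 * p * q * B U W + q\<^sup>2 * Q W"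
proof -
  note u = inH_H1[OF U] and w = inH_H1[OF W]
  note L = u(1,2)[THEN H1_L2_wd] u(1,2)[THEN H1_L2] w(1,2)[THEN H1_L2_wd] w(1,2)[THEN H1_L2]
  have "l2ip (\<lambda>x. p * sphi U x + q * sphi W x) (wd (\<lambda>x. p * su U x + q * su W x))
      = l2ip (\<lambda>x. p * wd (su U) x + q * wd (su W) x) (\<lambda>x. p * sphi U x + q * sphi W x)"
    unfolding l2ip_commute[of "\<lambda>x. p * sphi U x + q * sphi W x"]
    by (intro l2ip_cong_AE wd_lin H1_L2_wd[OF H1_lin] u w L2_lin L)
  also have "\<dots> = p\<^sup>2 * l2ip (sphi U) (wd (su U)) + p * q * (l2ip (sphi U) (wd (su W)) + l2ip (sphi W) (wd (su U)))
      + q\<^sup>2 * l2ip (sphi W) (wd (su W))"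
    unfolding l2ip_lin[OF L(1) L(5) L2_lin[OF L(4) L(8)]]
    unfolding l2ip_commute[of "wd (su U)"] l2ip_commute[of "wd (su W)"]
    by (simp add: l2ip_lin L power2_eq_square algebra_simps)
  finally show ?thesis
    unfolding Q_def B_def st_lin_simps
    by (simp only: l2n_wd_lin[OF u(1) w(1)] l2n_wd_lin[OF u(2) w(2)] l2n_lin[OF L(4) L(8)]
        l2n_lin[OF u(3) w(3)] l2n_lin[OF u(4) w(4)] l2n_lin[OF u(5) w(5)] etanorm_lin[OF u(6) w(6)])
      (simp add: algebra_simps)
qed

text \<open>Multiplied by \<open>mu\<close>, the block in \<open>u\<close> and \<open>\<phi>\<close>
  is the norm square of \<open>mu u_x + b \<phi>\<close> plus \<open>mu xi - b^2\<close> times that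
  of \<open>\<phi>\<close>. The velocity term is kept because it alone will bound the test states
  from below.\<close>

lemma Q_ge:
  assumes U: "inH \<kappa> U" shows "rho * l2n (sv U) \<le> Q U"
proof -
  note u = inH_H1[OF U]
  have "0 \<le> l2n (\<lambda>x. mu * wd (su U) x + b * sphi U x) + (mu * xi - b\<^sup>2) * l2n (sphi U)"
    using coupling by (intro add_nonneg_nonneg mult_nonneg_nonneg l2n_nonneg) auto
  also have "\<dots> = mu * (mu * l2n (wd (su U)) + xi * l2n (sphi U) + 2 * b * l2ip (sphi U) (wd (su U)))"
    using l2n_lin[OF H1_L2_wd[OF u(1)] H1_L2[OF u(2)]]
    by (simp add: l2ip_commute power2_eq_square algebra_simps)
  finally have "0 \<le> mu * l2n (wd (su U)) + xi * l2n (sphi U) + 2 * b * l2ip (sphi U) (wd (su U))"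
    using pos by (simp add: zero_le_mult_iff)
  moreover have "0 \<le> alpha * l2n (wd (sphi U))" "0 \<le> J * l2n (spsi U)" "0 \<le> c * l2n (stheta U)"
    using pos by (auto simp: l2n_nonneg)
  ultimately show ?thesis
    using etanorm_nonneg[of "seta U"] unfolding Q_def by linarith
qed

lemma Q_nonneg: "inH \<kappa> U \<Longrightarrow> 0 \<le> Q U"
  using Q_ge[of U] pos l2n_nonneg[of "sv U"] by (meson mult_nonneg_nonneg less_imp_le order_trans)

lemma N_nonneg: "inH \<kappa> U \<Longrightarrow> 0 \<le> N U"
  by (simp add: N_eq Q_nonneg)

lemma N_lin:
  assumes U: "inH \<kappa> U" and W: "inH \<kappa> W"
  shows "N (st_lin p U q W) \<le> \<bar>p\<bar> * N U + \<bar>q\<bar> * N W"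
  unfolding N_eq
proof (rule real_le_lsqrt)
  have cs: "(B U W)\<^sup>2 \<le> Q U * Q W"
    by (rule quadratic_form_CS) (use Q_nonneg[OF inH_lin[OF U W]] Q_lin[OF U W] Q_nonneg U W in auto)
  have "\<bar>B U W\<bar> \<le> sqrt (Q U * Q W)"
    using real_sqrt_le_mono[OF cs] by simp
  then have "\<bar>p * q\<bar> * \<bar>B U W\<bar> \<le> \<bar>p * q\<bar> * (sqrt (Q U) * sqrt (Q W))"
    by (intro mult_left_mono) (simp_all add: real_sqrt_mult)
  then have "p * q * B U W \<le> \<bar>p * q\<bar> * (sqrt (Q U) * sqrt (Q W))"
    using abs_ge_self[of "p * q * B U W"] by (simp only: abs_mult)
  then have "p\<^sup>2 * Q U + 2 * p * q * B U W + q\<^sup>2 * Q W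
      \<le> p\<^sup>2 * Q U + 2 * (\<bar>p * q\<bar> * (sqrt (Q U) * sqrt (Q W))) + q\<^sup>2 * Q W" by simp
  also have "\<dots> = (\<bar>p\<bar> * sqrt (Q U) + \<bar>q\<bar> * sqrt (Q W))\<^sup>2"
    using Q_nonneg[OF U] Q_nonneg[OF W]
    by (simp add: power2_sum power_mult_distrib abs_mult algebra_simps)
  finally show "Q (st_lin p U q W) \<le> (\<bar>p\<bar> * sqrt (Q U) + \<bar>q\<bar> * sqrt (Q W))\<^sup>2"
    by (simp add: Q_lin[OF U W])
qed (use Q_nonneg U W in auto)

text \<open>The norm of the zero state involves \<open>wd\<close> of the zero function, a choice;
  the triangle inequality with coefficients 0 avoids evaluating it.\<close>

lemma N_self_diff: "inH \<kappa> X \<Longrightarrow> N (st_lin 1 X (-1) X) = 0"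
proof -
  assume X: "inH \<kappa> X"
  have "N (st_lin 1 X (-1) X) = N (st_lin 0 X 0 X)"
    by (rule arg_cong[where f = N]) (simp add: st_lin_def)
  then have "N (st_lin 1 X (-1) X) \<le> 0" using N_lin[OF X X, of 0 0] by simp
  then show ?thesis using N_nonneg[OF inH_lin[OF X X, of 1 "-1"]] by simp
qed

lemma N_diff_commute: 
  assumes "inH \<kappa> X" "inH \<kappa> Y" shows "N (st_lin 1 X (-1) Y) = N (st_lin 1 Y (-1) X)"
proof -
  have "N (st_lin 1 X (-1) Y) = N (st_lin (-1) (st_lin 1 Y (-1) X) 0 X)" for X Y
    by (rule arg_cong[where f = N]) (simp add: st_lin_def)
  then have "N (st_lin 1 X (-1) Y) \<le> N (st_lin 1 Y (-1) X)" if "inH \<kappa> X" "inH \<kappa> Y" for X Y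
    using N_lin[OF inH_lin[OF that(2,1), of 1 "-1"] that(1), of "-1" 0] by simp
  then show ?thesis using assms by (simp add: antisym)
qed

lemma N_diff_triangle:
  assumes "inH \<kappa> X" "inH \<kappa> Y" "inH \<kappa> Z"
  shows "N (st_lin 1 X (-1) Z) \<le> N (st_lin 1 X (-1) Y) + N (st_lin 1 Y (-1) Z)"
proof -
  have "N (st_lin 1 X (-1) Z) = N (st_lin 1 (st_lin 1 X (-1) Y) 1 (st_lin 1 Y (-1) Z))"
    by (rule arg_cong[where f = N]) (simp add: st_lin_def)
  then show ?thesis
    using N_lin[OF inH_lin[OF assms(1,2), of 1 "-1"] inH_lin[OF assms(2,3), of 1 "-1"], of 1 1] by simp
qed

lemma N_le_diff:
  assumes "inH \<kappa> X" "inH \<kappa> Y" shows "N X \<le> N Y + N (st_lin 1 X (-1) Y)"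
proof -
  have "N X = N (st_lin 1 Y 1 (st_lin 1 X (-1) Y))"
    by (rule arg_cong[where f = N]) (simp add: st_lin_def)
  also have "\<dots> \<le> N Y + N (st_lin 1 X (-1) Y)"
    using N_lin[OF assms(2) inH_lin[OF assms, of 1 "-1"], of 1 1] by simp
  finally show ?thesis .
qed

section \<open>Exponential stability and the resolvent on the imaginary axis\<close>

lemma generated_semigroupD:
  assumes "generated_semigroup rho J c mu b alpha xi beta \<kappa> S"
  shows "\<And>t U. t \<ge> 0 \<Longrightarrow> inH \<kappa> U \<Longrightarrow> inH \<kappa> (S t U)"
    and "\<And>t U W p q. t \<ge> 0 \<Longrightarrow> inH \<kappa> U \<Longrightarrow> inH \<kappa> W \<Longrightarrow>
        N (st_lin 1 (S t (st_lin p U q W)) (-1) (st_lin p (S t U) q (S t W))) = 0"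
    and "\<And>U. inH \<kappa> U \<Longrightarrow> N (st_lin 1 (S 0 U) (-1) U) = 0"
    and "\<And>t s U. t \<ge> 0 \<Longrightarrow> s \<ge> 0 \<Longrightarrow> inH \<kappa> U \<Longrightarrow> N (st_lin 1 (S (t + s) U) (-1) (S t (S s U))) = 0"
    and "\<And>U. DA \<kappa> U \<Longrightarrow> ((\<lambda>h. N (st_lin (1 / h) (st_lin 1 (S h U) (-1) U) 1 (A U))) \<longlongrightarrow> 0) (at_right 0)"
proof -
  note * = assms[unfolded generated_semigroup_def Let_def]
  note ** = *[THEN conjunct2, THEN conjunct2, THEN conjunct2]
  fix t s p q U W
  show "t \<ge> 0 \<Longrightarrow> inH \<kappa> U \<Longrightarrow> inH \<kappa> (S t U)"
    by (rule *[THEN conjunct1, rule_format])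
  show "t \<ge> 0 \<Longrightarrow> inH \<kappa> U \<Longrightarrow> inH \<kappa> W \<Longrightarrow>
      N (st_lin 1 (S t (st_lin p U q W)) (-1) (st_lin p (S t U) q (S t W))) = 0"
    by (rule *[THEN conjunct2, THEN conjunct1, rule_format])
  show "inH \<kappa> U \<Longrightarrow> N (st_lin 1 (S 0 U) (-1) U) = 0"
    by (rule **[THEN conjunct1, rule_format])
  show "t \<ge> 0 \<Longrightarrow> s \<ge> 0 \<Longrightarrow> inH \<kappa> U \<Longrightarrow> N (st_lin 1 (S (t + s) U) (-1) (S t (S s U))) = 0"
    by (rule **[THEN conjunct2, THEN conjunct1, rule_format])
  show "DA \<kappa> U \<Longrightarrow> ((\<lambda>h. N (st_lin (1 / h) (st_lin 1 (S h U) (-1) U) 1 (A U))) \<longlongrightarrow> 0) (at_right 0)"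
    by (rule **[THEN conjunct2, THEN conjunct2, THEN conjunct2, rule_format])
qed

lemma DA_inH: "DA \<kappa> U \<Longrightarrow> inH \<kappa> U"
  by (simp add: DA_def)

text \<open>To first order \<open>S h U\<close> is \<open>U - h A U\<close> and the rotated state is
  \<open>U + h l W\<close>, so they differ by \<open>h (A U + l W)\<close>. The summand 1 absorbs
  the three \<open>o(h)\<close> remainders for small \<open>h\<close>.\<close>

lemma small_step:
  assumes S: "generated_semigroup rho J c mu b alpha xi beta \<kappa> S"
    and U: "DA \<kappa> U" "inH \<kappa> (A U)" and W: "inH \<kappa> W"
  shows "\<forall>\<^sub>F h in at_right 0. N (st_lin 1 (st_lin (cos (l * h)) U (sin (l * h)) W) (-1) (S h U))
      \<le> h * (N (st_lin 1 (A U) l W) + 1)"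
proof -
  note SH = generated_semigroupD(1)[OF S]
  note HU = DA_inH[OF U(1)]
  let ?g = "\<lambda>h. st_lin (1 / h) (st_lin 1 (S h U) (-1) U) 1 (A U)"
  have c1: "((\<lambda>h. (cos (l * h) - 1) / h) \<longlongrightarrow> 0) (at_right 0)"
  proof -
    have "((\<lambda>h. cos (l * h)) has_real_derivative 0) (at 0)" by (auto intro!: derivative_eq_intros)
    then have "((\<lambda>h. (cos (l * h) - 1) / h) \<longlongrightarrow> 0) (at 0)" by (simp add: DERIV_def)
    then show ?thesis by (rule tendsto_within_subset) auto
  qed
  have c2: "((\<lambda>h. (sin (l * h) - l * h) / h) \<longlongrightarrow> 0) (at_right 0)"
  proof -
    have "((\<lambda>h. sin (l * h) - l * h) has_real_derivative 0) (at 0)" by (auto intro!: derivative_eq_intros)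
    then have "((\<lambda>h. (sin (l * h) - l * h) / h) \<longlongrightarrow> 0) (at 0)" by (simp add: DERIV_def)
    then show ?thesis by (rule tendsto_within_subset) auto
  qed
  have "((\<lambda>h. N (?g h) + \<bar>(cos (l * h) - 1) / h\<bar> * N U + \<bar>(sin (l * h) - l * h) / h\<bar> * N W)
      \<longlongrightarrow> 0 + \<bar>0\<bar> * N U + \<bar>0\<bar> * N W) (at_right 0)"
    by (intro tendsto_intros generated_semigroupD(5)[OF S U(1)] c1 c2)
  then have "\<forall>\<^sub>F h in at_right 0. N (?g h) + \<bar>(cos (l * h) - 1) / h\<bar> * N U + \<bar>(sin (l * h) - l * h) / h\<bar> * N W < 1"
    by (rule order_tendstoD) simp
  moreover have "\<forall>\<^sub>F h in at_right 0. (h::real) > 0" by (simp add: eventually_at_right_less)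
  ultimately show ?thesis
  proof eventually_elim
    case (elim h)
    let ?r = "st_lin (cos (l * h) - 1) U (sin (l * h) - l * h) W"
    have P: "inH \<kappa> (?g h)" "inH \<kappa> (st_lin 1 (A U) l W)" "inH \<kappa> ?r"
      using SH[of h U] elim HU W U(2) by (auto intro!: inH_lin)
    have "N (st_lin 1 (st_lin (cos (l * h)) U (sin (l * h)) W) (-1) (S h U))
        = N (st_lin (- h) (?g h) 1 (st_lin h (st_lin 1 (A U) l W) 1 ?r))"
      by (rule arg_cong[where f = N]) (use elim in \<open>simp add: st_lin_def fun_eq_iff field_simps\<close>)
    also have "\<dots> \<le> h * N (?g h) + N (st_lin h (st_lin 1 (A U) l W) 1 ?r)"
      using N_lin[OF P(1) inH_lin[OF P(2,3), of h 1], of "- h" 1] elim by simp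
    also have "N (st_lin h (st_lin 1 (A U) l W) 1 ?r) \<le> h * N (st_lin 1 (A U) l W) + N ?r"
      using N_lin[OF P(2,3), of h 1] elim by simp
    also have "N ?r \<le> \<bar>cos (l * h) - 1\<bar> * N U + \<bar>sin (l * h) - l * h\<bar> * N W"
      by (rule N_lin[OF HU W])
    also have "\<dots> = h * (\<bar>(cos (l * h) - 1) / h\<bar> * N U + \<bar>(sin (l * h) - l * h) / h\<bar> * N W)"
    proof -
      have "h * \<bar>y / h\<bar> = \<bar>y\<bar>" for y using elim(2) by (simp add: abs_divide)
      then show ?thesis by (simp only: distrib_left mult.assoc[symmetric])
    qed
    finally have "N (st_lin 1 (st_lin (cos (l * h)) U (sin (l * h)) W) (-1) (S h U)) \<le>
        h * (N (?g h) + \<bar>(cos (l * h) - 1) / h\<bar> * N U + \<bar>(sin (l * h) - l * h) / h\<bar> * N W)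
        + h * N (st_lin 1 (A U) l W)" by (simp only: distrib_left add_ac)
    also have "\<dots> \<le> h * 1 + h * N (st_lin 1 (A U) l W)"
      using elim by (intro add_right_mono mult_left_mono) (auto intro: less_imp_le)
    finally show ?case by (simp only: distrib_left add.commute)
  qed
qed

text \<open>The curve \<open>t \<mapsto> cos (l t + p) U - sin (l t + p) W\<close> is the real part of \<open>exp (i (l t + p)) (U + i W)\<close> and
  solves the evolution equation up to a right-hand side made of the two residuals. Instead of the
  Duhamel integral, the telescoping sum of \<open>S ((m - k) h) (v k)\<close> over \<open>k\<close> is used.\<close>

lemma rotation_close_to_semigroup:
  assumes S: "generated_semigroup rho J c mu b alpha xi beta \<kappa> S"
    and C: "C > 0" "\<omega> > 0"
    and bound: "\<And>U t. inH \<kappa> U \<Longrightarrow> t \<ge> 0 \<Longrightarrow> N (S t U) \<le> C * exp (- \<omega> * t) * N U"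
    and U: "DA \<kappa> U" "inH \<kappa> (A U)" and W: "DA \<kappa> W" "inH \<kappa> (A W)" and T: "T > 0"
  shows "N (st_lin (cos p) U (- sin p) W) \<le> C * exp (- \<omega> * T) * (N U + N W)
    + T * C * (N (st_lin 1 (A U) (- l) W) + N (st_lin 1 (A W) l U) + 2)"
proof -
  note SH = generated_semigroupD(1)[OF S]
  note HU = DA_inH[OF U(1)] and HW = DA_inH[OF W(1)]
  define M where "M = N (st_lin 1 (A U) (- l) W) + N (st_lin 1 (A W) l U) + 2"
  have M: "M \<ge> 0"
    unfolding M_def using N_nonneg inH_lin HU HW U W by (intro add_nonneg_nonneg) auto
  define V where "V t = st_lin (cos t) U (- sin t) W" for t
  have VH: "inH \<kappa> (V t)" for t unfolding V_def by (intro inH_lin HU HW)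
  \<comment> \<open>The threshold for \<open>h\<close> does not depend on the phase
    \<open>t\<close>: by linearity only the increments of \<open>U\<close> and \<open>W\<close>
    matter, with coefficients bounded by 1. One step length thus serves the whole curve.\<close>
  have "\<forall>\<^sub>F h in at_right 0. \<forall>t. N (st_lin 1 (V (t + l * h)) (-1) (S h (V t))) \<le> h * M"
    using small_step[OF S U HW, of "- l"] small_step[OF S W HU, of l]
      eventually_at_right_less[of 0]
  proof eventually_elim
    case (elim h)
    show ?case
    proof
      fix t
      define X where "X = st_lin 1 (st_lin (cos (l * h)) U (- sin (l * h)) W) (-1) (S h U)"
      define Y where "Y = st_lin 1 (st_lin (cos (l * h)) W (sin (l * h)) U) (-1) (S h W)"
      define Z where "Z = st_lin (cos t) (S h U) (- sin t) (S h W)"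
      have P: "inH \<kappa> X" "inH \<kappa> Y" "inH \<kappa> (S h (V t))" "inH \<kappa> Z"
        unfolding X_def Y_def Z_def using SH elim(3) HU HW VH by (auto intro!: inH_lin)
      have "N (st_lin 1 (V (t + l * h)) (-1) Z) = N (st_lin (cos t) X (- sin t) Y)"
        by (rule arg_cong[where f = N])
          (simp add: X_def Y_def Z_def V_def st_lin_def fun_eq_iff cos_add sin_add algebra_simps)
      also have "\<dots> \<le> \<bar>cos t\<bar> * N X + \<bar>- sin t\<bar> * N Y" by (rule N_lin[OF P(1,2)])
      also have "\<dots> \<le> 1 * N X + 1 * N Y"
        using N_nonneg[OF P(1)] N_nonneg[OF P(2)] by (intro add_mono mult_right_mono) auto
      also have "\<dots> \<le> h * (N (st_lin 1 (A U) (- l) W) + 1) + h * (N (st_lin 1 (A W) l U) + 1)"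
        unfolding mult_1_left
        by (intro add_mono) (use elim(1,2) in \<open>simp_all only: X_def Y_def mult_minus_left cos_minus sin_minus\<close>)
      also have "\<dots> = h * M" unfolding M_def distrib_left by simp
      finally have "N (st_lin 1 (V (t + l * h)) (-1) Z) \<le> h * M" .
      moreover have "N (st_lin 1 (S h (V t)) (-1) Z) = 0"
        unfolding Z_def V_def by (rule generated_semigroupD(2)[OF S _ HU HW]) (use elim(3) in simp)
      ultimately show "N (st_lin 1 (V (t + l * h)) (-1) (S h (V t))) \<le> h * M"
        using N_diff_triangle[OF VH P(4,3), of "t + l * h"] N_diff_commute[OF P(3,4)] by linarith
    qed
  qed
  then obtain d where d: "d > 0" "\<And>h t. 0 < h \<Longrightarrow> h < d \<Longrightarrow> N (st_lin 1 (V (t + l * h)) (-1) (S h (V t))) \<le> h * M"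
    by (auto simp: eventually_at_right_field)
  obtain m :: nat where m: "T / d < real m" using reals_Archimedean2 by blast
  have m0: "m > 0" using m T d(1) by (cases m) (auto simp: divide_less_0_iff)
  define h where "h = T / real m"
  have h: "0 < h" "h < d" "real m * h = T"
    using m m0 T d(1) by (auto simp: h_def field_simps)
  \<comment> \<open>Initial phase chosen such that the curve reaches phase \<open>p\<close> at time
    \<open>T\<close>.\<close>
  define p0 where "p0 = p - l * T"
  define v where "v k = V (p0 + l * (real k * h))" for k :: nat
  have vH: "inH \<kappa> (v k)" for k unfolding v_def by (rule VH)
  have step: "N (st_lin 1 (v (Suc k)) (-1) (S h (v k))) \<le> h * M" for k
    using d(2)[OF h(1,2), of "p0 + l * (real k * h)"] by (simp add: v_def algebra_simps)
  \<comment> \<open>Each step error of size \<open>h M\<close> is transported to time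
    \<open>T\<close> by \<open>S r\<close>, at the cost of a factor \<open>C\<close>;
    \<open>m\<close> steps with \<open>m h = T\<close> sum up to \<open>T C M\<close>.\<close>
  have tele: "N (st_lin 1 (S (real (m - k) * h) (v k)) (-1) (S T (v 0))) \<le> real k * (C * (h * M))" if "k \<le> m" for k
    using that
  proof (induction k)
    case 0
    then show ?case using N_self_diff[OF SH[OF _ vH[of 0]], of T] T h(3) by simp
  next
    case (Suc k)
    define r where "r = real (m - Suc k) * h"
    have r: "r \<ge> 0" "real (m - k) * h = r + h"
    proof -
      have "real (m - k) = real (m - Suc k) + 1" using Suc.prems by simp
      then show "real (m - k) * h = r + h" by (simp only: r_def distrib_right mult_1_left)
    qed (use h(1) in \<open>simp add: r_def\<close>)
    have Sh: "inH \<kappa> (S h (v k))" using SH h(1) vH by auto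
    let ?X = "S r (v (Suc k))" and ?Y = "S r (S h (v k))" and ?Z = "S (r + h) (v k)"
    let ?D = "st_lin 1 (v (Suc k)) (-1) (S h (v k))"
    have P: "inH \<kappa> ?X" "inH \<kappa> ?Y" "inH \<kappa> ?Z" "inH \<kappa> (S T (v 0))" "inH \<kappa> ?D" "inH \<kappa> (S r ?D)"
      using SH r(1) h(1) vH Sh T inH_lin by auto
    \<comment> \<open>Linearity and the semigroup law hold only up to states of norm 0, hence the
      detours through \<open>S r ?D\<close> and \<open>?Z\<close> in place of equations.\<close>
    have "N (st_lin 1 ?X (-1) ?Y) \<le> N (S r ?D) + N (st_lin 1 (st_lin 1 ?X (-1) ?Y) (-1) (S r ?D))"
      by (rule N_le_diff[OF inH_lin[OF P(1,2)] P(6)])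
    also have "N (st_lin 1 (st_lin 1 ?X (-1) ?Y) (-1) (S r ?D)) = 0"
      unfolding N_diff_commute[OF inH_lin[OF P(1,2)] P(6)]
      by (rule generated_semigroupD(2)[OF S r(1) vH Sh])
    also have "N (S r ?D) \<le> C * exp (- \<omega> * r) * N ?D" by (rule bound[OF P(5) r(1)])
    also have "\<dots> \<le> C * 1 * (h * M)"
      using C r(1) step[of k] N_nonneg[OF P(5)] by (intro mult_mono) auto
    finally have 1: "N (st_lin 1 ?X (-1) ?Y) \<le> C * (h * M)" by simp
    have 2: "N (st_lin 1 ?Y (-1) ?Z) = 0"
      unfolding N_diff_commute[OF P(2,3)]
      by (rule generated_semigroupD(4)[OF S r(1) _ vH]) (use h in simp)
    have 3: "N (st_lin 1 ?Z (-1) (S T (v 0))) \<le> real k * (C * (h * M))"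
      unfolding r(2)[symmetric] by (rule Suc.IH) (use Suc.prems in simp)
    have "N (st_lin 1 ?X (-1) (S T (v 0))) \<le> C * (h * M) + real k * (C * (h * M))"
      using N_diff_triangle[OF P(1,2,4)] N_diff_triangle[OF P(2,3,4)] 1 2 3 by linarith
    then show ?case unfolding r_def of_nat_Suc distrib_right mult_1_left .
  qed
  have P: "inH \<kappa> (S 0 (v m))" "inH \<kappa> (S T (v 0))" using SH vH T by auto
  have "N (v m) \<le> N (S T (v 0)) + N (st_lin 1 (v m) (-1) (S T (v 0)))"
    by (rule N_le_diff[OF vH P(2)])
  also have "N (st_lin 1 (v m) (-1) (S T (v 0))) \<le> N (st_lin 1 (v m) (-1) (S 0 (v m))) + N (st_lin 1 (S 0 (v m)) (-1) (S T (v 0)))"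
    by (rule N_diff_triangle[OF vH P])
  also have "N (st_lin 1 (v m) (-1) (S 0 (v m))) = 0"
    unfolding N_diff_commute[OF vH P(1)] by (rule generated_semigroupD(3)[OF S vH])
  also have "N (st_lin 1 (S 0 (v m)) (-1) (S T (v 0))) \<le> T * C * M"
    using tele[of m] h(3) by (simp add: algebra_simps)
  also have "N (S T (v 0)) \<le> C * exp (- \<omega> * T) * N (v 0)"
    using bound[OF vH] T by simp
  also have "N (v 0) \<le> N U + N W"
  proof -
    have "N (v 0) \<le> \<bar>cos p0\<bar> * N U + \<bar>- sin p0\<bar> * N W"
      unfolding v_def V_def using N_lin[OF HU HW, of "cos p0" "- sin p0"] by simp
    also have "\<dots> \<le> 1 * N U + 1 * N W"
      using N_nonneg[OF HU] N_nonneg[OF HW] by (intro add_mono mult_right_mono) auto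
    finally show ?thesis by simp
  qed
  also have "v m = st_lin (cos p) U (- sin p) W"
    by (simp add: v_def V_def h(3) p0_def)
  finally show ?thesis using C by (simp add: M_def mult_left_mono)
qed

text \<open>Fix \<open>T\<close> with \<open>C * exp (- \<omega> * T) \<le> 1 / 4\<close>. The
  phases 0 and \<open>- pi / 2\<close> recover \<open>U\<close> and \<open>W\<close>; adding both
  estimates leaves half of \<open>N U + N W\<close> on the right, which is absorbed.
  \<open>K = 4 T C\<close> depends on neither the states nor \<open>l\<close>.\<close>

lemma exponential_stability_imp_resolvent_bound:
  assumes S: "generated_semigroup rho J c mu b alpha xi beta \<kappa> S"
    and C: "C > 0" "\<omega> > 0"
    and bound: "\<And>U t. inH \<kappa> U \<Longrightarrow> t \<ge> 0 \<Longrightarrow> N (S t U) \<le> C * exp (- \<omega> * t) * N U"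
  obtains K where "K > 0" "\<And>U W l. DA \<kappa> U \<Longrightarrow> inH \<kappa> (A U) \<Longrightarrow> DA \<kappa> W \<Longrightarrow> inH \<kappa> (A W) \<Longrightarrow>
      N U + N W \<le> K * (N (st_lin 1 (A U) (- l) W) + N (st_lin 1 (A W) l U) + 2)"
proof -
  define T where "T = max 1 (ln (4 * C) / \<omega>)"
  have T: "T > 0" by (simp add: T_def)
  have "ln (4 * C) / \<omega> \<le> T" by (simp add: T_def)
  then have "ln (4 * C) \<le> \<omega> * T" using C by (simp add: pos_divide_le_eq mult.commute)
  then have "4 * C \<le> exp (\<omega> * T)" using C by (metis exp_le_cancel_iff exp_ln mult_pos_pos zero_less_numeral)
  then have T4: "C * exp (- \<omega> * T) \<le> 1 / 4"
    by (simp add: exp_minus field_simps)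
  show ?thesis
  proof (rule that[of "4 * T * C"])
    show "4 * T * C > 0" using T C by simp
    fix U W l assume U: "DA \<kappa> U" "inH \<kappa> (A U)" and W: "DA \<kappa> W" "inH \<kappa> (A W)"
    define M where "M = N (st_lin 1 (A U) (- l) W) + N (st_lin 1 (A W) l U) + 2"
    note HU = DA_inH[OF U(1)] and HW = DA_inH[OF W(1)]
    have *: "N (st_lin (cos p) U (- sin p) W) \<le> 1 / 4 * (N U + N W) + T * C * M" for p
    proof -
      have "C * exp (- \<omega> * T) * (N U + N W) \<le> 1 / 4 * (N U + N W)"
        using T4 N_nonneg[OF HU] N_nonneg[OF HW] by (intro mult_right_mono) auto
      then show ?thesis
        using rotation_close_to_semigroup[OF S C bound U W T, of p l] unfolding M_def by linarith
    qed
    have "st_lin (cos 0) U (- sin 0) W = U" "st_lin (cos (- (pi / 2))) U (- sin (- (pi / 2))) W = W"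
      by (simp_all add: st_lin_def)
    with *[of 0] *[of "- (pi / 2)"]
    have "N U \<le> 1 / 4 * (N U + N W) + T * C * M" "N W \<le> 1 / 4 * (N U + N W) + T * C * M"
      by (simp_all only:)
    moreover have "x + y \<le> 4 * z" if "x \<le> 1 / 4 * (x + y) + z" "y \<le> 1 / 4 * (x + y) + z" for x y z :: real
      using that by (simp add: field_simps)
    ultimately have "N U + N W \<le> 4 * (T * C * M)" by blast
    then show "N U + N W \<le> 4 * T * C * (N (st_lin 1 (A U) (- l) W) + N (st_lin 1 (A W) l U) + 2)"
      unfolding M_def by (simp only: mult.assoc)
  qed
qed

end

section \<open>Fourier modes\<close>

lemma is_wd_sin: "is_wd (\<lambda>x. k * sin (real n * x)) (\<lambda>x. (k * real n) * cos (real n * x))"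
  by (intro is_wd_C1) (auto intro!: derivative_eq_intros continuous_intros)

lemma is_wd_cos: "is_wd (\<lambda>x. k * cos (real n * x)) (\<lambda>x. (- (k * real n)) * sin (real n * x))"
  by (intro is_wd_C1) (auto intro!: derivative_eq_intros continuous_intros)

lemma L2_sin: "L2 (\<lambda>x. k * sin (real n * x))" and L2_cos: "L2 (\<lambda>x. k * cos (real n * x))"
  by (intro L2_continuous continuous_intros)+

lemma H10_cmult_sin: "H10 (\<lambda>x. k * sin (real n * x))"
  using H10_lin[OF H10_sin H10_sin, of k n 0 n] by simp

lemma H1_cmult_cos: "H1 (\<lambda>x. k * cos (real n * x))"
  unfolding H1_def using is_wd_cos L2_cos by blast

text \<open>Integration by parts shows that both norms are equal, and their sum is the integral of
  1.\<close>

lemma sin_cos_ivl: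
  assumes n: "n > 0"
  shows l2n_sin: "l2n (\<lambda>x. sin (real n * x)) = pi / 2"
    and l2n_cos: "l2n (\<lambda>x. cos (real n * x)) = pi / 2"
    and integral_cos: "(\<integral>x. cos (real n * x) \<partial>ivl) = 0"
proof -
  have L: "L2 (\<lambda>x. sin (real n * x))" "L2 (\<lambda>x. cos (real n * x))"
    using L2_sin[of 1] L2_cos[of 1] by auto
  have "l2ip (\<lambda>x. sin (real n * x)) (\<lambda>x. - real n * sin (real n * x))
      = - l2ip (\<lambda>x. real n * cos (real n * x)) (\<lambda>x. cos (real n * x))"
    by (rule l2ip_by_parts) (auto intro!: derivative_eq_intros continuous_intros)
  moreover have "l2ip (\<lambda>x. sin (real n * x)) (\<lambda>x. - real n * sin (real n * x)) = - real n * l2n (\<lambda>x. sin (real n * x))"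
    unfolding l2ip_eq l2n_eq power2_eq_square
    by (subst integral_mult_right_zero[symmetric]) (simp add: mult_ac)
  moreover have "l2ip (\<lambda>x. real n * cos (real n * x)) (\<lambda>x. cos (real n * x)) = real n * l2n (\<lambda>x. cos (real n * x))"
    unfolding l2ip_eq l2n_eq power2_eq_square
    by (subst integral_mult_right_zero[symmetric]) (simp add: mult_ac)
  ultimately have eq: "l2n (\<lambda>x. sin (real n * x)) = l2n (\<lambda>x. cos (real n * x))" using n by simp
  have "l2n (\<lambda>x. sin (real n * x)) + l2n (\<lambda>x. cos (real n * x))
      = (\<integral>x. (sin (real n * x))\<^sup>2 + (cos (real n * x))\<^sup>2 \<partial>ivl)"
    unfolding l2n_eq using L by (intro Bochner_Integration.integral_add[symmetric]) (auto simp: L2_iff)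
  also have "\<dots> = (\<integral>x. 1 \<partial>ivl)" by (simp only: sin_cos_squared_add)
  also have "\<dots> = pi" unfolding integral_const_ivl by simp
  finally show "l2n (\<lambda>x. sin (real n * x)) = pi / 2" "l2n (\<lambda>x. cos (real n * x)) = pi / 2"
    using eq by auto
  have "l2ip (\<lambda>x. sin (real n * x)) (\<lambda>x. 0) = - l2ip (\<lambda>x. real n * cos (real n * x)) (\<lambda>x. 1)"
    by (rule l2ip_by_parts) (auto intro!: derivative_eq_intros continuous_intros)
  then show "(\<integral>x. cos (real n * x) \<partial>ivl) = 0" using n by (simp add: l2ip_eq)
qed

lemma l2n_wd_sin: "n > 0 \<Longrightarrow> l2n (wd (\<lambda>x. k * sin (real n * x))) = (k * real n)\<^sup>2 * (pi / 2)"
  using l2n_cong_AE[OF is_wd_L2[OF is_wd_wd[OF is_wd_sin]] L2_cos wd_AE[OF is_wd_sin], of k n]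
  by (simp add: l2n_cmult l2n_cos)

lemma l2n_wd_zero:
  assumes "L2 f" "AE x in ivl. f x = 0" shows "l2n (wd f) = 0"
proof -
  have "is_wd (\<lambda>x. 0) (\<lambda>x. 0)" using is_wd_sin[of 0 0] by simp
  then have "is_wd f (\<lambda>x. 0)"
    by (rule is_wd_cong_AE) (use assms L2_const in auto)
  then have "l2n (wd f) = l2n (\<lambda>x. 0)"
    using L2_const by (intro l2n_cong_AE is_wd_L2[OF is_wd_wd] wd_AE)
  then show ?thesis by (simp add: l2n_eq)
qed

lemma l2ip_sin_deriv2:
  assumes w: "test_fun w"
  shows "l2ip (\<lambda>x. k * sin (real n * x)) ((deriv ^^ 2) w) = - ((real n)\<^sup>2 * k) * l2ip (\<lambda>x. sin (real n * x)) w"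
proof -
  have "l2ip (\<lambda>x. k * sin (real n * x)) (deriv (deriv w)) = - l2ip (\<lambda>x. k * real n * cos (real n * x)) (deriv w)"
    using test_fun_boundary[OF test_fun_deriv[OF w]]
    by (intro l2ip_by_parts test_fun_DERIV test_fun_deriv_continuous test_fun_deriv w)
      (auto intro!: derivative_eq_intros continuous_intros)
  also have "l2ip (\<lambda>x. k * real n * cos (real n * x)) (deriv w) = - l2ip (\<lambda>x. - (k * (real n)\<^sup>2) * sin (real n * x)) w"
    using test_fun_boundary[OF w]
    by (intro l2ip_by_parts test_fun_DERIV test_fun_deriv_continuous w)
      (auto intro!: derivative_eq_intros continuous_intros simp: power2_eq_square)
  also have "l2ip (\<lambda>x. - (k * (real n)\<^sup>2) * sin (real n * x)) w = - ((real n)\<^sup>2 * k) * l2ip (\<lambda>x. sin (real n * x)) w"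
    unfolding l2ip_eq by (subst integral_mult_right_zero[symmetric]) (simp add: mult_ac)
  finally show ?thesis by (simp add: numeral_2_eq_2)
qed

text \<open>The boundary conditions select sines for \<open>u\<close>, \<open>v\<close>,
  \<open>\<theta>\<close>, \<open>\<eta>\<close> and cosines for \<open>\<phi>\<close>,
  \<open>\<psi>\<close>. The operator preserves this pattern for each \<open>n\<close>, so on modes
  it reduces to coefficients and the profile \<open>e\<close>.\<close>

definition mode :: "nat \<Rightarrow> real \<Rightarrow> real \<Rightarrow> real \<Rightarrow> real \<Rightarrow> real \<Rightarrow> (real \<Rightarrow> real) \<Rightarrow> st" where
  "mode n a v f p t e =
     \<lparr>su = (\<lambda>x. a * sin (real n * x)), sv = (\<lambda>x. v * sin (real n * x)),
      sphi = (\<lambda>x. f * cos (real n * x)), spsi = (\<lambda>x. p * cos (real n * x)),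
      stheta = (\<lambda>x. t * sin (real n * x)), seta = (\<lambda>s x. e s * sin (real n * x))\<rparr>"

lemma mode_simps [simp]:
  "su (mode n a v f p t e) = (\<lambda>x. a * sin (real n * x))"
  "sv (mode n a v f p t e) = (\<lambda>x. v * sin (real n * x))"
  "sphi (mode n a v f p t e) = (\<lambda>x. f * cos (real n * x))"
  "spsi (mode n a v f p t e) = (\<lambda>x. p * cos (real n * x))"
  "stheta (mode n a v f p t e) = (\<lambda>x. t * sin (real n * x))"
  "seta (mode n a v f p t e) = (\<lambda>s x. e s * sin (real n * x))"
  by (simp_all add: mode_def)

lemma st_lin_mode:
  "st_lin k (mode n a v f p t e) k' (mode n a' v' f' p' t' e')
   = mode n (k * a + k' * a') (k * v + k' * v') (k * f + k' * f') (k * p + k' * p') (k * t + k' * t')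
      (\<lambda>s. k * e s + k' * e' s)"
  by (simp add: st_lin_def mode_def algebra_simps)

context memory_kernel begin

lemma inV_sin:
  assumes n: "n > 0" and e: "e \<in> borel_measurable borel" "\<And>s. s > 0 \<Longrightarrow> \<bar>e s\<bar> \<le> E"
  shows "inV \<kappa> (\<lambda>s x. e s * sin (real n * x))"
    and "etanorm \<kappa> (\<lambda>s x. e s * sin (real n * x)) = (real n)\<^sup>2 * (pi / 2) * (\<integral>s. \<kappa> s * (e s)\<^sup>2 \<partial>halfl)"
    and "integrable halfl (\<lambda>s. \<kappa> s * e s)" "integrable halfl (\<lambda>s. \<kappa> s * (e s)\<^sup>2)"
proof -
  have m: "e \<in> borel_measurable halfl"
    unfolding halfl_def using e(1) by (intro measurable_restrict_space1 measurable_completion) simp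
  show "integrable halfl (\<lambda>s. \<kappa> s * e s)"
  proof (rule Bochner_Integration.integrable_bound)
    show "integrable halfl (\<lambda>s. E * \<kappa> s)" using kernel_integrable by simp
    show "AE s in halfl. norm (\<kappa> s * e s) \<le> norm (E * \<kappa> s)"
    proof (rule AE_I2)
      fix s assume "s \<in> space halfl"
      then have "s > 0" by simp
      then show "norm (\<kappa> s * e s) \<le> norm (E * \<kappa> s)"
        using e(2)[of s] kernel_pos[of s] by (simp add: abs_mult mult.commute mult_left_mono)
    qed
  qed (use m kernel_measurable in simp)
  show i: "integrable halfl (\<lambda>s. \<kappa> s * (e s)\<^sup>2)"
  proof (rule Bochner_Integration.integrable_bound)
    show "integrable halfl (\<lambda>s. E\<^sup>2 * \<kappa> s)" using kernel_integrable by simp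
    show "AE s in halfl. norm (\<kappa> s * (e s)\<^sup>2) \<le> norm (E\<^sup>2 * \<kappa> s)"
    proof (rule AE_I2)
      fix s assume "s \<in> space halfl"
      then have "s > 0" by simp
      then show "norm (\<kappa> s * (e s)\<^sup>2) \<le> norm (E\<^sup>2 * \<kappa> s)"
        using power_mono[OF e(2)[of s], of 2] kernel_pos[of s] by (simp add: abs_mult mult.commute mult_left_mono)
    qed
  qed (use m kernel_measurable in simp)
  have eq: "\<kappa> s * l2n (wd (\<lambda>x. e s * sin (real n * x))) = (real n)\<^sup>2 * (pi / 2) * (\<kappa> s * (e s)\<^sup>2)" for s
    by (simp add: l2n_wd_sin[OF n] power_mult_distrib)
  have "(\<lambda>p. indicator {0<..} (fst p) * indicator {0<..<pi} (snd p) * (e (fst p) * sin (real n * snd p)))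
      \<in> borel_measurable (borel \<Otimes>\<^sub>M borel)"
    by (intro borel_measurable_times measurable_compose[OF measurable_fst e(1)]
        measurable_compose[OF measurable_fst, of "indicator {0<..}"]
        measurable_compose[OF measurable_snd, of "indicator {0<..<pi}"]
        measurable_compose[OF measurable_snd, of "\<lambda>x. sin (real n * x)"]) auto
  then have "jointly_measurable (\<lambda>s x. e s * sin (real n * x))"
    by (simp add: jointly_measurable_def)
  then show "inV \<kappa> (\<lambda>s x. e s * sin (real n * x))"
    unfolding inV_iff eq using i H10_cmult_sin by (auto intro!: AE_I2)
  show "etanorm \<kappa> (\<lambda>s x. e s * sin (real n * x)) = (real n)\<^sup>2 * (pi / 2) * (\<integral>s. \<kappa> s * (e s)\<^sup>2 \<partial>halfl)"
    unfolding etanorm_eq eq by (rule integral_mult_right_zero)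
qed

lemma inH_mode:
  assumes n: "n > 0" and e: "e \<in> borel_measurable borel" "\<And>s. s > 0 \<Longrightarrow> \<bar>e s\<bar> \<le> E"
  shows "inH \<kappa> (mode n a v f p t e)"
  using inV_sin(1)[OF assms] H10_cmult_sin H1_cmult_cos L2_sin L2_cos integral_cos[OF n]
  by (simp add: inH_def H1star_iff L2star_iff)

end

section \<open>The operator on Fourier modes\<close>

context porous begin

lemma Q_mode:
  assumes n: "n > 0" and e: "e \<in> borel_measurable borel" "\<And>s. s > 0 \<Longrightarrow> \<bar>e s\<bar> \<le> E"
  shows "Q (mode n 0 v 0 p t e) = (pi / 2) * (rho * v\<^sup>2 + J * p\<^sup>2 + c * t\<^sup>2
    + (real n)\<^sup>2 * (\<integral>s. \<kappa> s * (e s)\<^sup>2 \<partial>halfl))"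
proof -
  have z: "l2n (wd (\<lambda>x. 0)) = 0" "l2n (\<lambda>x. 0) = 0" "l2ip (\<lambda>x. 0) g = 0" for g
    using l2n_wd_zero[OF L2_const[of 0]] by (auto simp: l2n_eq l2ip_eq)
  have "Q (mode n 0 v 0 p t e) = rho * (v\<^sup>2 * (pi / 2)) + J * (p\<^sup>2 * (pi / 2)) + c * (t\<^sup>2 * (pi / 2))
      + etanorm \<kappa> (\<lambda>s x. e s * sin (real n * x))"
    unfolding Q_def mode_simps mult_zero_left z l2n_cmult l2n_sin[OF n] l2n_cos[OF n] by simp
  then show ?thesis
    using inV_sin(2)[OF n e] by (simp only: distrib_left mult_ac)
qed

text \<open>The value of the operator is assembled from chosen objects and matches a mode only
  almost everywhere. Since \<open>ivl\<close> is not complete, such equality does not transfer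
  measurability; the \<open>L2\<close> and \<open>inV\<close> conditions on \<open>X\<close> are
  therefore supplied separately.\<close>

lemma inH_cong_AE:
  assumes Y: "inH \<kappa> Y" and u: "su X = su Y" "sphi X = sphi Y"
    and L: "L2 (sv X)" "L2 (spsi X)" "L2 (stheta X)" and V: "inV \<kappa> (seta X)"
    and ae: "AE x in ivl. sv X x = sv Y x" "AE x in ivl. spsi X x = spsi Y x"
      "AE x in ivl. stheta X x = stheta Y x" "AE s in halfl. AE x in ivl. seta X s x = seta Y s x"
  shows "inH \<kappa> X \<and> N (st_lin 1 X (-1) Y) = 0"
proof
  note y = inH_H1[OF Y]
  have "(\<integral>x. spsi X x \<partial>ivl) = (\<integral>x. spsi Y x \<partial>ivl)"
    using L(2) y(4) ae(2) by (intro integral_cong_AE L2_measurable)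
  then show "inH \<kappa> X"
    using Y u L V by (simp add: inH_def L2star_iff)
  have z: "l2n (wd (\<lambda>x. 0)) = 0" "l2n (\<lambda>x. 0) = 0" "l2ip (\<lambda>x. 0) g = 0" for g
    using l2n_wd_zero[OF L2_const[of 0]] by (auto simp: l2n_eq l2ip_eq)
  have d: "l2n (\<lambda>x. f x - g x) = 0" if "L2 f" "L2 g" "AE x in ivl. f x = g x" for f g
    using that L2_diff[OF that(1,2)] by (simp add: l2n_zero_iff)
  have "AE s in halfl. \<kappa> s * l2n (wd (\<lambda>x. seta X s x - seta Y s x)) = 0"
    using ae(4) V[unfolded inV_iff, THEN conjunct2, THEN conjunct1]
      y(6)[unfolded inV_iff, THEN conjunct2, THEN conjunct1]
  proof eventually_elim
    case (elim s)
    then have "l2n (wd (\<lambda>x. seta X s x - seta Y s x)) = 0"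
      by (intro l2n_wd_zero L2_diff H1_L2 H10_H1) auto
    then show ?case by simp
  qed
  then have "etanorm \<kappa> (\<lambda>s x. seta X s x - seta Y s x) = 0"
    unfolding etanorm_eq by (rule integral_eq_zero_AE)
  then have "Q (st_lin 1 X (-1) Y) = 0"
    unfolding Q_def st_lin_simps u using d L ae y by (simp add: z)
  then show "N (st_lin 1 X (-1) Y) = 0" by (simp add: N_eq)
qed

text \<open>The Fourier symbol of the operator. The hypothesis \<open>int\<close> encodes both that
  \<open>e'\<close> is the derivative of \<open>e\<close> and that \<open>\<eta>\<close> vanishes at
  \<open>s = 0\<close>. The result is a difference of norm 0, which is all that the choices in
  \<open>Aop\<close> permit.\<close>

lemma A_mode:
  fixes a v f p t :: real
  assumes n: "n > 0"
    and e: "e \<in> borel_measurable borel" "\<And>s. s > 0 \<Longrightarrow> \<bar>e s\<bar> \<le> E"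
    and e': "e' \<in> borel_measurable borel" "\<And>s. s > 0 \<Longrightarrow> \<bar>e' s\<bar> \<le> E'"
    and int: "\<And>s. s > 0 \<Longrightarrow> (LINT r:{0..s}|lborel. e' r) = e s"
  defines "U \<equiv> mode n a v f p t e"
  shows "DA \<kappa> U" "inH \<kappa> (A U)"
    and "N (st_lin 1 (A U) (-1) (mode n (- v) (mu / rho * (real n)\<^sup>2 * a + b / rho * real n * f) (- p)
        (alpha / J * (real n)\<^sup>2 * f + xi / J * f + b / J * real n * a + beta / J * real n * t)
        (- (beta / c) * real n * p + (real n)\<^sup>2 / c * (LINT s:{0<..}|lborel. \<kappa> s * e s))
        (\<lambda>s. - t + e' s))) = 0"
proof -
  let ?s = "\<lambda>x. sin (real n * x)" and ?c = "\<lambda>x. cos (real n * x)"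
  define I where "I = (LINT s:{0<..}|lborel. \<kappa> s * e s)"
  define z where "z s x = e' s * ?s x" for s x
  define h where "h x = (- ((real n)\<^sup>2 * I)) * ?s x" for x
  have zV: "inV \<kappa> z" unfolding z_def using inV_sin(1)[OF n e'] .
  have eta: "is_eta_s \<kappa> (seta U) z"
    unfolding is_eta_s_def U_def mode_simps
  proof (intro conjI zV AE_I2 impI)
    fix q :: "real \<times> real" assume q: "q \<in> {0<..} \<times> {0<..<pi}"
    then have "fst q > 0" by auto
    then show "e (fst q) * ?s (snd q) = (LINT r:{0..fst q}|lborel. z r (snd q))"
      unfolding z_def by (simp add: int)
  qed
  have mem: "is_mem_int \<kappa> (seta U) h"
    unfolding is_mem_int_def U_def mode_simps
  proof (intro conjI allI impI)
    show "L2 h" unfolding h_def by (rule L2_sin)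
    fix w assume w: "test_fun w"
    have "(LINT x:{0<..<pi}|lborel. e s * ?s x * (deriv ^^ 2) w x) = e s * (- (real n)\<^sup>2 * l2ip ?s w)" for s
      using l2ip_sin_deriv2[OF w, of "e s" n] by (simp add: l2ip_def mult_ac)
    then have "(LINT s:{0<..}|lborel. \<kappa> s * (LINT x:{0<..<pi}|lborel. e s * ?s x * (deriv ^^ 2) w x))
        = (LINT s:{0<..}|lborel. (\<kappa> s * e s) * (- (real n)\<^sup>2 * l2ip ?s w))"
      by (simp only: mult.assoc)
    also have "\<dots> = I * (- (real n)\<^sup>2 * l2ip ?s w)" unfolding I_def by (rule set_integral_mult_left)
    also have "\<dots> = l2ip h w"
      unfolding h_def l2ip_eq mult.assoc integral_mult_right_zero by simp
    finally show "(LINT s:{0<..}|lborel. \<kappa> s * (LINT x:{0<..<pi}|lborel. e s * ?s x * (deriv ^^ 2) w x)) = l2ip h w" .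
  qed
  have inU: "inH \<kappa> U" unfolding U_def by (rule inH_mode[OF n e])
  have wu: "is_wd (su U) (\<lambda>x. (a * real n) * ?c x)" unfolding U_def mode_simps by (rule is_wd_sin)
  have wf: "is_wd (sphi U) (\<lambda>x. (- (f * real n)) * ?s x)" unfolding U_def mode_simps by (rule is_wd_cos)
  have Lwu: "L2 (wd (su U))" and Lwf: "L2 (wd (sphi U))"
    using is_wd_L2[OF is_wd_wd] wu wf by blast+
  \<comment> \<open>First derivatives are known only almost everywhere, so second derivatives are
    computed on the explicit function and transferred by \<open>is_wd_cong_AE\<close>.\<close>
  have aeu: "AE x in ivl. (a * real n) * ?c x = wd (su U) x"
    using wd_AE[OF wu] by eventually_elim simp
  have aef: "AE x in ivl. (- (f * real n)) * ?s x = wd (sphi U) x"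
    using wd_AE[OF wf] by eventually_elim simp
  have wwu: "is_wd (wd (su U)) (\<lambda>x. (- (a * real n * real n)) * ?s x)"
    by (rule is_wd_cong_AE[OF is_wd_cos L2_cos Lwu aeu])
  have wwf: "is_wd (wd (sphi U)) (\<lambda>x. (- (f * real n) * real n) * ?c x)"
    by (rule is_wd_cong_AE[OF is_wd_sin L2_sin Lwf aef])
  have wt: "is_wd (stheta U) (\<lambda>x. (t * real n) * ?c x)" unfolding U_def mode_simps by (rule is_wd_sin)
  have wp: "is_wd (spsi U) (\<lambda>x. (- (p * real n)) * ?s x)" unfolding U_def mode_simps by (rule is_wd_cos)
  have L: "L2 (wd (wd (su U)))" "L2 (wd (wd (sphi U)))" "L2 (wd (stheta U))" "L2 (wd (spsi U))"
    using is_wd_L2[OF is_wd_wd[OF wwu]] is_wd_L2[OF is_wd_wd[OF wwf]]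
      is_wd_L2[OF is_wd_wd[OF wt]] is_wd_L2[OF is_wd_wd[OF wp]] by auto
  show DAU: "DA \<kappa> U"
    unfolding DA_def
  proof (intro conjI inU)
    show "H2 (su U)" unfolding H2_def H1_def
      using Lwu wu wwu L2_sin by (auto simp: U_def)
    show "H2 (sphi U)" unfolding H2_def H1_def
      using Lwf wf wwf L2_cos by (auto simp: U_def)
    show "H10 (wd (sphi U))" by (rule H10_cong_AE[OF H10_cmult_sin Lwf aef])
    show "H10 (sv U)" "H10 (stheta U)" unfolding U_def mode_simps by (rule H10_cmult_sin)+
    show "H1star (spsi U)"
      unfolding U_def mode_simps H1star_iff using H1_cmult_cos integral_cos[OF n] by simp
  qed (use eta mem in blast)+
  define \<zeta> where "\<zeta> = (SOME \<zeta>. is_eta_s \<kappa> (seta U) \<zeta>)"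
  define h' where "h' = (SOME h. is_mem_int \<kappa> (seta U) h)"
  have \<zeta>: "is_eta_s \<kappa> (seta U) \<zeta>" unfolding \<zeta>_def using eta by (rule someI[of "is_eta_s \<kappa> (seta U)"])
  have h': "is_mem_int \<kappa> (seta U) h'" unfolding h'_def using mem by (rule someI[of "is_mem_int \<kappa> (seta U)"])
  have Lh: "L2 h'" "L2 h" using h' mem by (auto simp: is_mem_int_def)
  have aeh: "AE x in ivl. h' x = h x"
    using h' mem Lh by (intro AE_eq_of_test_fun) (auto simp: is_mem_int_def)
  have ae\<zeta>: "AE s in halfl. AE x in ivl. \<zeta> s x = z s x" by (rule is_eta_s_unique[OF \<zeta> eta])
  define X where "X = A U"
  have X: "su X = (\<lambda>x. - sv U x)"
      "sv X = (\<lambda>x. - (mu / rho) * wd (wd (su U)) x - (b / rho) * wd (sphi U) x)"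
      "sphi X = (\<lambda>x. - spsi U x)"
      "spsi X = (\<lambda>x. - (alpha / J) * wd (wd (sphi U)) x + (xi / J) * sphi U x
                 + (b / J) * wd (su U) x + (beta / J) * wd (stheta U) x)"
      "stheta X = (\<lambda>x. (beta / c) * wd (spsi U) x - (1 / c) * h' x)"
      "seta X = (\<lambda>s x. - stheta U x + \<zeta> s x)"
    unfolding X_def Aop_def Let_def \<zeta>_def h'_def by simp_all
  define Y where "Y = mode n (- v) (mu / rho * (real n)\<^sup>2 * a + b / rho * real n * f) (- p)
        (alpha / J * (real n)\<^sup>2 * f + xi / J * f + b / J * real n * a + beta / J * real n * t)
        (- (beta / c) * real n * p + (real n)\<^sup>2 / c * I) (\<lambda>s. - t + e' s)"
  have Y: "inH \<kappa> Y"
    unfolding Y_def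
  proof (rule inH_mode[OF n])
    show "(\<lambda>s. - t + e' s) \<in> borel_measurable borel" using e'(1) by simp
    show "\<bar>- t + e' s\<bar> \<le> \<bar>t\<bar> + E'" if "s > 0" for s using e'(2)[OF that] by linarith
  qed
  have Lphi: "L2 (sphi U)" unfolding U_def mode_simps by (rule L2_cos)
  have "inH \<kappa> X \<and> N (st_lin 1 X (-1) Y) = 0"
  proof (rule inH_cong_AE[OF Y])
    show "su X = su Y" "sphi X = sphi Y" unfolding X Y_def U_def mode_simps by auto
    show "L2 (sv X)"
      unfolding X using L2_lin[OF L(1) Lwf, of "- (mu / rho)" "- (b / rho)"] by simp
    show "L2 (spsi X)"
    proof -
      have "L2 (\<lambda>x. 1 * (- (alpha / J) * wd (wd (sphi U)) x + (xi / J) * sphi U x)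
          + 1 * ((b / J) * wd (su U) x + (beta / J) * wd (stheta U) x))"
        by (intro L2_lin L Lwu Lphi)
      then show ?thesis unfolding X by (simp add: add.assoc)
    qed
    show "L2 (stheta X)"
      unfolding X using L2_lin[OF L(4) Lh(1), of "beta / c" "- (1 / c)"] by simp
    have "inV \<kappa> (\<lambda>s x. (- 1) * (t * ?s x) + 1 * \<zeta> s x)"
    proof (rule inV_lin)
      show "inV \<kappa> (\<lambda>s x. t * ?s x)" by (rule inV_sin(1)[OF n, of "\<lambda>_. t" "\<bar>t\<bar>"]) auto
      show "inV \<kappa> \<zeta>" using \<zeta> by (simp add: is_eta_s_def)
    qed
    then show "inV \<kappa> (seta X)" unfolding X U_def mode_simps by simp
    show "AE x in ivl. sv X x = sv Y x"
      using wd_AE[OF wwu] aef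
    proof eventually_elim
      case (elim x)
      show ?case unfolding X Y_def mode_simps elim(1) elim(2)[symmetric]
        by (simp add: power2_eq_square algebra_simps)
    qed
    show "AE x in ivl. spsi X x = spsi Y x"
      using wd_AE[OF wwf] aeu wd_AE[OF wt]
    proof eventually_elim
      case (elim x)
      show ?case unfolding X Y_def mode_simps elim(1) elim(2)[symmetric] elim(3)
        by (simp add: U_def power2_eq_square algebra_simps)
    qed
    show "AE x in ivl. stheta X x = stheta Y x"
      using wd_AE[OF wp] aeh
    proof eventually_elim
      case (elim x)
      show ?case unfolding X Y_def mode_simps elim h_def
        by (simp add: power2_eq_square algebra_simps)
    qed
    show "AE s in halfl. AE x in ivl. seta X s x = seta Y s x"
      using ae\<zeta>
    proof eventually_elim
      case (elim s)
      then show ?case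
        by eventually_elim (simp add: X Y_def U_def z_def algebra_simps)
    qed
  qed
  then show "inH \<kappa> (A U)"
    "N (st_lin 1 (A U) (-1) (mode n (- v) (mu / rho * (real n)\<^sup>2 * a + b / rho * real n * f) (- p)
        (alpha / J * (real n)\<^sup>2 * f + xi / J * f + b / J * real n * a + beta / J * real n * t)
        (- (beta / c) * real n * p + (real n)\<^sup>2 / c * (LINT s:{0<..}|lborel. \<kappa> s * e s))
        (\<lambda>s. - t + e' s))) = 0"
    unfolding X_def Y_def I_def by auto
qed

end

section \<open>Lack of exponential stability\<close>

context memory_kernel begin

text \<open>Dominated convergence with the kernel as dominating function. For the real profile this
  takes the role of the Riemann-Lebesgue lemma for \<open>exp (- i l s)\<close>.\<close>

lemma kernel_exp_tendsto_0:
  assumes a: "filterlim a at_top sequentially" and a0: "\<And>n. 0 \<le> a n"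
  shows "(\<lambda>n. \<integral>s. \<kappa> s * exp (- a n * s) \<partial>halfl) \<longlonglongrightarrow> 0"
proof -
  have exp_measurable: "(\<lambda>s. exp (- k * s)) \<in> borel_measurable halfl" for k :: real
    unfolding halfl_def by (intro measurable_restrict_space1 measurable_completion) simp
  have "(\<lambda>n. \<integral>s. \<kappa> s * exp (- a n * s) \<partial>halfl) \<longlonglongrightarrow> (\<integral>s. 0 \<partial>halfl)"
  proof (rule integral_dominated_convergence[where w = \<kappa>])
    show "AE s in halfl. (\<lambda>n. \<kappa> s * exp (- a n * s)) \<longlonglongrightarrow> 0"
    proof (rule AE_I2)
      fix s assume "s \<in> space halfl"
      then have s: "s > 0" by simp
      have "filterlim (\<lambda>n. s * a n) at_top sequentially"
        using s a by (intro filterlim_tendsto_pos_mult_at_top[OF tendsto_const])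
      then have "filterlim (\<lambda>n. - (s * a n)) at_bot sequentially"
        by (simp add: filterlim_uminus_at_top)
      then have "(\<lambda>n. exp (- (s * a n))) \<longlonglongrightarrow> 0"
        by (rule filterlim_compose[OF exp_at_bot])
      then show "(\<lambda>n. \<kappa> s * exp (- a n * s)) \<longlonglongrightarrow> 0"
        by (intro tendsto_mult_right_zero) (simp add: mult.commute)
    qed
    show "AE s in halfl. norm (\<kappa> s * exp (- a n * s)) \<le> \<kappa> s" for n
    proof (rule AE_I2)
      fix s assume "s \<in> space halfl"
      then have "s > 0" by simp
      then show "norm (\<kappa> s * exp (- a n * s)) \<le> \<kappa> s"
        using kernel_pos[of s] a0[of n] by (simp add: abs_mult mult_left_le)
    qed
  qed (use kernel_integrable kernel_measurable exp_measurable in auto)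
  then show ?thesis by simp
qed

lemma g0_eq: "g0 \<kappa> = (\<integral>s. \<kappa> s \<partial>halfl)"
proof -
  have "g0 \<kappa> = (LINT s:{0<..}|lborel. \<kappa> s)"
    unfolding g0_def by (rule set_integral_discrete_difference[of "{0}"]) auto
  then show ?thesis using integrable_halfl_lborel(2)[OF kernel_integrable_lborel] by simp
qed

end

context porous begin

lemma N_replace:
  assumes "inH \<kappa> X" "inH \<kappa> Y" "inH \<kappa> Z" "N (st_lin 1 X (-1) Y) = 0"
  shows "N (st_lin 1 X k Z) \<le> N (st_lin 1 Y k Z)"
proof -
  have "N (st_lin 1 X k Z) = N (st_lin 1 (st_lin 1 X (-1) Y) 1 (st_lin 1 Y k Z))"
    by (rule arg_cong[where f = N]) (simp add: st_lin_def)
  also have "\<dots> \<le> N (st_lin 1 Y k Z)"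
    using N_lin[OF inH_lin[OF assms(1,2), of 1 "-1"] inH_lin[OF assms(2,3), of 1 k], of 1 1] assms(4) by simp
  finally show ?thesis .
qed

text \<open>The pair is the real and imaginary part of the complex state with amplitudes
  \<open>u = 1\<close>, \<open>v = i l\<close>, \<open>\<phi> / n\<close>, \<open>\<psi> = i l \<phi> / n\<close>, \<open>\<theta>\<close> and \<open>\<eta> = - i (\<theta> / l) (1 - r)\<close>, where \<open>l\<close> is the frequency
  of the undamped wave equation for \<open>u\<close>. The first two equations make the terms of order \<open>n\<close> in the
  residuals cancel. Solving the equation of \<open>\<eta>\<close> exactly would need \<open>r s = exp (- i l s)\<close>; the real choice
  \<open>r s = exp (- sqrt l * s)\<close> leaves a residual that still tends to 0.\<close>

lemma mode_estimate:
  fixes \<phi> \<theta> :: real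
  assumes 1: "(alpha - J * mu / rho) * \<phi> + beta * \<theta> = - b"
    and 2: "gamma_g rho c mu \<kappa> * \<theta> = beta * mu * \<phi>"
    and n: "n > 0" and l_def: "l = real n * sqrt (mu / rho)"
  obtains U W where "DA \<kappa> U" "inH \<kappa> (A U)" "DA \<kappa> W" "inH \<kappa> (A W)"
    "N U \<ge> 0" "N W \<ge> sqrt (mu * pi / 2) * real n"
    "N (st_lin 1 (A U) (- l) W) \<le> real n * sqrt ((pi / 2) * (rho * (b * \<phi> / rho)\<^sup>2 / (real n)\<^sup>2
      + J * (xi * \<phi> / J)\<^sup>2 / (real n)^4 + \<theta>\<^sup>2 * (\<integral>s. \<kappa> s * exp (- (2 * sqrt l) * s) \<partial>halfl)))"
    "N (st_lin 1 (A W) l U) \<le> real n * sqrt ((pi / 2) * (\<theta>\<^sup>2 / (c * (mu / rho)) * (\<integral>s. \<kappa> s * exp (- sqrt l * s) \<partial>halfl)\<^sup>2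
      + \<theta>\<^sup>2 / l * (\<integral>s. \<kappa> s * exp (- (2 * sqrt l) * s) \<partial>halfl)))"
proof -
  let ?n = "real n"
  \<comment> \<open>\<open>R\<close> must tend to infinity for the kernel integrals \<open>G\<close>
    and \<open>G2\<close> to vanish, yet slower than \<open>l\<close>, since \<open>e'\<close> has
    size \<open>R / l\<close>; with the square root, \<open>(R / l)^2 = 1 / l\<close>.\<close>
  define R where "R = sqrt l"
  define G where "G = (\<integral>s. \<kappa> s * exp (- R * s) \<partial>halfl)"
  define G2 where "G2 = (\<integral>s. \<kappa> s * exp (- (2 * R) * s) \<partial>halfl)"
  have l: "l > 0" using n pos by (simp add: l_def)
  have R: "R > 0" "R * R = l" using l by (auto simp: R_def)
  have l2: "l * l = ?n\<^sup>2 * (mu / rho)"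
  proof -
    have "l * l = l\<^sup>2" by (simp add: power2_eq_square)
    also have "\<dots> = ?n\<^sup>2 * (sqrt (mu / rho))\<^sup>2" unfolding l_def by (rule power_mult_distrib)
    also have "(sqrt (mu / rho))\<^sup>2 = mu / rho" using pos by (intro real_sqrt_pow2) simp
    finally show ?thesis .
  qed
  define r where "r s = exp (- R * s)" for s
  define e where "e s = - (\<theta> / l) * (1 - r s)" for s
  define e' where "e' s = - (\<theta> / l) * (R * r s)" for s
  have r01: "0 < r s" "r s \<le> 1" if "s > 0" for s using that R(1) by (auto simp: r_def)
  have rm: "r \<in> borel_measurable borel" unfolding r_def[abs_def] by simp
  have em: "e \<in> borel_measurable borel" "e' \<in> borel_measurable borel"
    unfolding e_def[abs_def] e'_def[abs_def] using rm by auto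
  have eb: "\<bar>e s\<bar> \<le> \<bar>\<theta> / l\<bar>" "\<bar>e' s\<bar> \<le> \<bar>\<theta> / l\<bar> * R" "\<bar>- \<theta> * r s\<bar> \<le> \<bar>\<theta>\<bar>" if "s > 0" for s
    using r01[OF that] R(1)
    by (auto simp: e_def e'_def abs_mult intro!: mult_left_le mult_left_mono divide_right_mono)
  have int: "(LINT x:{0..s}|lborel. e' x) = e s" if "s > 0" for s
  proof -
    have "(\<integral>x. e' x * indicator {0..s} x \<partial>lborel) = e s - e 0"
      unfolding e_def e'_def r_def using that l
      by (intro integral_FTC_Icc_real) (auto intro!: derivative_eq_intros continuous_intros)
    then show ?thesis by (simp add: set_lebesgue_integral_def e_def r_def mult.commute)
  qed
  \<comment> \<open>The part with \<open>g0 \<kappa>\<close> has leading order and will enter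
    \<open>gamma_g\<close>; the part with \<open>G\<close> goes into the residual.\<close>
  have lb: "(LINT s:{0<..}|lborel. \<kappa> s * e s) = - (\<theta> / l) * (g0 \<kappa> - G)"
  proof -
    have "set_integrable lborel {0<..} (\<lambda>s. \<kappa> s * e s)"
    proof (rule set_integrable_bound[where f = "\<lambda>s. \<bar>\<theta> / l\<bar> * \<kappa> s"])
      show "set_integrable lborel {0<..} (\<lambda>s. \<bar>\<theta> / l\<bar> * \<kappa> s)"
        using kernel_integrable_lborel by (rule set_integrable_mult_right)
      have "(\<lambda>s. (indicator {0<..} s *\<^sub>R \<kappa> s) * e s) \<in> borel_measurable lborel"
        using borel_measurable_integrable[OF kernel_integrable_lborel[unfolded set_integrable_def]]
        by (rule borel_measurable_times) (use em(1) in simp)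
      then show "set_borel_measurable lborel {0<..} (\<lambda>s. \<kappa> s * e s)"
        by (simp add: set_borel_measurable_def mult.assoc)
      show "AE s in lborel. s \<in> {0<..} \<longrightarrow> norm (\<kappa> s * e s) \<le> norm (\<bar>\<theta> / l\<bar> * \<kappa> s)"
      proof (intro AE_I2 impI)
        fix s :: real assume "s \<in> {0<..}"
        then show "norm (\<kappa> s * e s) \<le> norm (\<bar>\<theta> / l\<bar> * \<kappa> s)"
          using mult_left_mono[OF eb(1)[of s], of "\<kappa> s"] kernel_pos[of s]
          by (simp add: abs_mult mult.commute)
      qed
    qed
    from integrable_halfl_lborel(2)[OF this]
    have "(LINT s:{0<..}|lborel. \<kappa> s * e s) = (\<integral>s. \<kappa> s * e s \<partial>halfl)" by simp
    also have "\<dots> = (\<integral>s. - (\<theta> / l) * (\<kappa> s - \<kappa> s * r s) \<partial>halfl)"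
      by (rule Bochner_Integration.integral_cong) (auto simp: e_def algebra_simps)
    also have "\<dots> = - (\<theta> / l) * (\<integral>s. \<kappa> s - \<kappa> s * r s \<partial>halfl)" by (rule integral_mult_right_zero)
    also have "(\<integral>s. \<kappa> s - \<kappa> s * r s \<partial>halfl) = g0 \<kappa> - G"
      unfolding g0_eq G_def r_def[symmetric]
      by (rule Bochner_Integration.integral_diff[OF kernel_integrable inV_sin(3)[OF n rm, of 1]])
        (use r01 in \<open>simp add: less_imp_le\<close>)
    finally show ?thesis .
  qed
  define U where "U = mode n 1 0 (\<phi> / ?n) 0 \<theta> (\<lambda>_. 0)"
  define W where "W = mode n 0 l 0 (l * \<phi> / ?n) 0 e"
  note AU = A_mode[OF n, of "\<lambda>_. 0" 0 "\<lambda>_. 0" 0 1 0 "\<phi> / ?n" 0 \<theta>, simplified, folded U_def]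
  note AW = A_mode[OF n em(1) eb(1) em(2) eb(2) int, of 0 l 0 "l * \<phi> / ?n" 0, folded W_def]
  \<comment> \<open>\<open>F1\<close> and \<open>F2\<close> are what survives in the real and
    imaginary part: the lower-order terms with \<open>b\<close> and \<open>xi\<close>, and the
    errors of the memory profile.\<close>
  define F1 where "F1 = mode n 0 (b * \<phi> / rho) 0 (xi * \<phi> / (J * ?n)) 0 (\<lambda>s. - \<theta> * r s)"
  define F2 where "F2 = mode n 0 0 0 0 (?n\<^sup>2 * \<theta> * G / (c * l)) e'"
  have HU: "inH \<kappa> U" and HW: "inH \<kappa> W" using AU(1) AW(1) by (auto simp: DA_inH)
  have F1: "N (st_lin 1 (A U) (- l) W) \<le> N F1"
  proof -
    define E where "E = mode n 0 (mu / rho * ?n\<^sup>2 + b / rho * ?n * (\<phi> / ?n)) 0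
      (alpha / J * ?n\<^sup>2 * (\<phi> / ?n) + xi / J * (\<phi> / ?n) + b / J * ?n + beta / J * ?n * \<theta>) 0 (\<lambda>_. - \<theta>)"
    have "inH \<kappa> E" unfolding E_def by (rule inH_mode[OF n, of _ "\<bar>\<theta>\<bar>"]) auto
    moreover have "N (st_lin 1 (A U) (-1) E) = 0" using AU(3) n unfolding E_def by simp
    ultimately have "N (st_lin 1 (A U) (- l) W) \<le> N (st_lin 1 E (- l) W)"
      using AU(2) HW by (intro N_replace)
    also have "st_lin 1 E (- l) W = F1"
    proof -
      have "1 * (mu / rho * ?n\<^sup>2 + b / rho * ?n * (\<phi> / ?n)) + - l * l = b * \<phi> / rho"
        using n l2 by simp
      moreover have "1 * (alpha / J * ?n\<^sup>2 * (\<phi> / ?n) + xi / J * (\<phi> / ?n) + b / J * ?n + beta / J * ?n * \<theta>)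
          + - l * (l * \<phi> / ?n) = xi * \<phi> / (J * ?n)"
      proof -
        have "l * (l * \<phi> / ?n) = ?n * (mu / rho) * \<phi>"
          using n l2 by (simp add: mult.assoc[symmetric] power2_eq_square)
        \<comment> \<open>All terms of order \<open>n\<close> in the equation of
          \<open>\<phi>\<close>; the bracket vanishes by the first scalar equation.\<close>
        moreover have "alpha / J * ?n\<^sup>2 * (\<phi> / ?n) + b / J * ?n + beta / J * ?n * \<theta> - ?n * (mu / rho) * \<phi>
            = ?n / J * ((alpha - J * mu / rho) * \<phi> + beta * \<theta> + b)"
          using n pos by (simp add: field_simps power2_eq_square)
        ultimately show ?thesis using 1 n by simp
      qed
      moreover have "1 * - \<theta> + - l * e s = - \<theta> * r s" for s
        using l by (simp add: e_def algebra_simps)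
      ultimately show ?thesis
        unfolding E_def W_def F1_def st_lin_mode by (simp only: mult_zero_right mult_zero_left add_0_right add_0_left mult_1)
    qed
    finally show ?thesis .
  qed
  have F2: "N (st_lin 1 (A W) l U) \<le> N F2"
  proof -
    define E where "E = mode n (- l) 0 (- (l * \<phi> / ?n)) 0
      (- (beta / c) * ?n * (l * \<phi> / ?n) + ?n\<^sup>2 / c * (- (\<theta> / l) * (g0 \<kappa> - G))) e'"
    have "inH \<kappa> E" unfolding E_def by (rule inH_mode[OF n em(2) eb(2)])
    moreover have "N (st_lin 1 (A W) (-1) E) = 0" using AW(3) unfolding E_def lb by simp
    ultimately have "N (st_lin 1 (A W) l U) \<le> N (st_lin 1 E l U)"
      using AW(2) HU by (intro N_replace)
    also have "st_lin 1 E l U = F2"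
    proof -
      have "1 * (- (beta / c) * ?n * (l * \<phi> / ?n) + ?n\<^sup>2 / c * (- (\<theta> / l) * (g0 \<kappa> - G))) + l * \<theta>
          = ?n\<^sup>2 * \<theta> * G / (c * l)"
      proof -
        \<comment> \<open>Multiplying by \<open>l\<close> brings in \<open>l * l\<close>, which is
          rational in the data. The second scalar equation then produces the term with
          \<open>g0 \<kappa>\<close> that cancels the leading part of the memory integral.\<close>
        have "l * (- (beta / c) * l * \<phi> + l * \<theta>) = ?n\<^sup>2 * (\<theta> * g0 \<kappa>) / c"
        proof -
          have "l * (- (beta / c) * l * \<phi> + l * \<theta>) = (l * l) * (\<theta> - beta / c * \<phi>)" by (simp add: algebra_simps)
          also have "\<dots> = ?n\<^sup>2 / (rho * c) * (c * mu * \<theta> - beta * mu * \<phi>)"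
            unfolding l2 using pos by (simp add: field_simps)
          also have "c * mu * \<theta> - beta * mu * \<phi> = rho * (\<theta> * g0 \<kappa>)"
            using 2 by (simp add: gamma_g_def algebra_simps)
          finally show ?thesis using pos by simp
        qed
        moreover have "x = y / (c * l)" if "l * x = y / c" for x y
          using that l pos by (simp add: field_simps)
        ultimately have *: "- (beta / c) * l * \<phi> + l * \<theta> = ?n\<^sup>2 * (\<theta> * g0 \<kappa>) / (c * l)"
          by blast
        have "1 * (- (beta / c) * ?n * (l * \<phi> / ?n) + ?n\<^sup>2 / c * (- (\<theta> / l) * (g0 \<kappa> - G))) + l * \<theta>
            = (- (beta / c) * l * \<phi> + l * \<theta>) + ?n\<^sup>2 / c * (- (\<theta> / l) * (g0 \<kappa> - G))" using n by simp
        also have "\<dots> = ?n\<^sup>2 * \<theta> * G / (c * l)"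
          unfolding * using l pos by (simp add: field_simps)
        finally show ?thesis .
      qed
      moreover have "1 * - (l * \<phi> / ?n) + l * (\<phi> / ?n) = 0" "1 * - l + l * 1 = 0" by simp_all
      ultimately show ?thesis
        unfolding E_def U_def F2_def st_lin_mode by (simp only: mult_zero_right mult_zero_left add_0_right add_0_left mult_1)
    qed
    finally show ?thesis .
  qed
  have Q1: "Q F1 = ?n\<^sup>2 * ((pi / 2) * (rho * (b * \<phi> / rho)\<^sup>2 / ?n\<^sup>2 + J * (xi * \<phi> / J)\<^sup>2 / ?n^4 + \<theta>\<^sup>2 * G2))"
  proof -
    have "(\<integral>s. \<kappa> s * (- \<theta> * r s)\<^sup>2 \<partial>halfl) = (\<integral>s. \<theta>\<^sup>2 * (\<kappa> s * exp (- (2 * R) * s)) \<partial>halfl)"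
      by (rule Bochner_Integration.integral_cong)
        (auto simp: r_def power_mult_distrib power2_eq_square exp_add[symmetric])
    also have "\<dots> = \<theta>\<^sup>2 * G2" unfolding G2_def by (rule integral_mult_right_zero)
    finally have i: "(\<integral>s. \<kappa> s * (- \<theta> * r s)\<^sup>2 \<partial>halfl) = \<theta>\<^sup>2 * G2" .
    have "Q F1 = (pi / 2) * (rho * (b * \<phi> / rho)\<^sup>2 + J * (xi * \<phi> / (J * ?n))\<^sup>2 + c * 0\<^sup>2 + ?n\<^sup>2 * (\<theta>\<^sup>2 * G2))"
      unfolding F1_def i[symmetric] by (rule Q_mode[OF n _ eb(3)]) (use rm in auto)
    also have "\<dots> = ?n\<^sup>2 * ((pi / 2) * (rho * (b * \<phi> / rho)\<^sup>2 / ?n\<^sup>2 + J * (xi * \<phi> / J)\<^sup>2 / ?n^4 + \<theta>\<^sup>2 * G2))"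
    proof -
      have "J * (xi * \<phi> / (J * ?n))\<^sup>2 = ?n\<^sup>2 * (J * (xi * \<phi> / J)\<^sup>2 / ?n^4)"
        using n by (simp add: power_divide power_mult_distrib power4_eq_xxxx power2_eq_square mult_ac)
      moreover have "rho * (b * \<phi> / rho)\<^sup>2 = ?n\<^sup>2 * (rho * (b * \<phi> / rho)\<^sup>2 / ?n\<^sup>2)"
        using n by simp
      ultimately show ?thesis using n by (simp add: algebra_simps)
    qed
    finally show ?thesis .
  qed
  have Q2: "Q F2 = ?n\<^sup>2 * ((pi / 2) * (\<theta>\<^sup>2 / (c * (mu / rho)) * G\<^sup>2 + \<theta>\<^sup>2 / l * G2))"
  proof -
    have "(\<integral>s. \<kappa> s * (e' s)\<^sup>2 \<partial>halfl) = (\<integral>s. \<theta>\<^sup>2 / l * (\<kappa> s * exp (- (2 * R) * s)) \<partial>halfl)"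
    proof (rule Bochner_Integration.integral_cong)
      fix s
      have "(e' s)\<^sup>2 = \<theta>\<^sup>2 * (R * R) / (l * l) * (r s * r s)"
        by (simp add: e'_def power2_eq_square)
      also have "\<dots> = \<theta>\<^sup>2 / l * exp (- (2 * R) * s)"
        unfolding R(2) r_def using l by (simp add: exp_add[symmetric])
      finally show "\<kappa> s * (e' s)\<^sup>2 = \<theta>\<^sup>2 / l * (\<kappa> s * exp (- (2 * R) * s))" by simp
    qed simp
    also have "\<dots> = \<theta>\<^sup>2 / l * G2" unfolding G2_def by (rule integral_mult_right_zero)
    finally have i: "(\<integral>s. \<kappa> s * (e' s)\<^sup>2 \<partial>halfl) = \<theta>\<^sup>2 / l * G2" .
    have "Q F2 = (pi / 2) * (rho * 0\<^sup>2 + J * 0\<^sup>2 + c * (?n\<^sup>2 * \<theta> * G / (c * l))\<^sup>2 + ?n\<^sup>2 * (\<theta>\<^sup>2 / l * G2))"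
      unfolding F2_def i[symmetric] by (rule Q_mode[OF n em(2) eb(2)])
    moreover have "c * (?n\<^sup>2 * \<theta> * G / (c * l))\<^sup>2 = ?n\<^sup>2 * (\<theta>\<^sup>2 / (c * (mu / rho)) * G\<^sup>2)"
    proof -
      have "c * (?n\<^sup>2 * \<theta> * G / (c * l))\<^sup>2 = ?n\<^sup>2 * (?n\<^sup>2 * \<theta>\<^sup>2 * G\<^sup>2) / (c * (l * l))"
        using pos by (simp add: power2_eq_square mult_ac)
      also have "\<dots> = ?n\<^sup>2 * (\<theta>\<^sup>2 / (c * (mu / rho)) * G\<^sup>2)"
        unfolding l2 using n pos by simp
      finally show ?thesis .
    qed
    ultimately show ?thesis by (simp add: algebra_simps)
  qed
  have sq: "sqrt (?n\<^sup>2 * y) = ?n * sqrt y" for y by (simp add: real_sqrt_mult)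
  show ?thesis
  proof (rule that[of U W])
    show "DA \<kappa> U" "inH \<kappa> (A U)" "DA \<kappa> W" "inH \<kappa> (A W)" using AU(1,2) AW(1,2) by auto
    show "N U \<ge> 0" by (rule N_nonneg[OF HU])
    \<comment> \<open>The velocity amplitude \<open>l\<close> alone gives growth of order
      \<open>n\<close>.\<close>
    have "rho * l2n (sv W) = ?n\<^sup>2 * (mu * pi / 2)"
      using pos l2 by (simp add: W_def l2n_cmult l2n_sin[OF n] power2_eq_square)
    then have "sqrt (?n\<^sup>2 * (mu * pi / 2)) \<le> N W"
      unfolding N_eq using Q_ge[OF HW] by simp
    then show "N W \<ge> sqrt (mu * pi / 2) * ?n" unfolding sq by (simp add: mult.commute)
    show "N (st_lin 1 (A U) (- l) W) \<le> ?n * sqrt ((pi / 2) * (rho * (b * \<phi> / rho)\<^sup>2 / ?n\<^sup>2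
      + J * (xi * \<phi> / J)\<^sup>2 / ?n^4 + \<theta>\<^sup>2 * (\<integral>s. \<kappa> s * exp (- (2 * sqrt l) * s) \<partial>halfl)))"
      using F1 unfolding N_eq Q1 sq G2_def R_def .
    show "N (st_lin 1 (A W) l U) \<le> ?n * sqrt ((pi / 2) * (\<theta>\<^sup>2 / (c * (mu / rho)) * (\<integral>s. \<kappa> s * exp (- sqrt l * s) \<partial>halfl)\<^sup>2
      + \<theta>\<^sup>2 / l * (\<integral>s. \<kappa> s * exp (- (2 * sqrt l) * s) \<partial>halfl)))"
      using F2 unfolding N_eq Q2 sq G_def G2_def R_def .
  qed
qed

text \<open>After division by \<open>n\<close> the resolvent bound reads: a positive constant is at
  most \<open>K\<close> times a null sequence, with \<open>K\<close> independent of
  \<open>n\<close>.\<close>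

lemma not_exponentially_stable:
  fixes \<phi> \<theta> :: real
  assumes S: "generated_semigroup rho J c mu b alpha xi beta \<kappa> S"
    and 1: "(alpha - J * mu / rho) * \<phi> + beta * \<theta> = - b"
    and 2: "gamma_g rho c mu \<kappa> * \<theta> = beta * mu * \<phi>"
    and C: "C > 0" "\<omega> > 0"
    and bound: "\<And>U t. inH \<kappa> U \<Longrightarrow> t \<ge> 0 \<Longrightarrow> N (S t U) \<le> C * exp (- \<omega> * t) * N U"
  shows False
proof -
  obtain K where K: "K > 0" "\<And>U W l. DA \<kappa> U \<Longrightarrow> inH \<kappa> (A U) \<Longrightarrow> DA \<kappa> W \<Longrightarrow> inH \<kappa> (A W) \<Longrightarrow>
      N U + N W \<le> K * (N (st_lin 1 (A U) (- l) W) + N (st_lin 1 (A W) l U) + 2)"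
    using exponential_stability_imp_resolvent_bound[OF S C bound] by blast
  define q where "q = sqrt (mu / rho)"
  have q: "q > 0" using pos by (simp add: q_def)
  define G where "G n = (\<integral>s. \<kappa> s * exp (- sqrt (real n * q) * s) \<partial>halfl)" for n
  define G2 where "G2 n = (\<integral>s. \<kappa> s * exp (- (2 * sqrt (real n * q)) * s) \<partial>halfl)" for n
  have lim: "filterlim (\<lambda>n. real n * q) at_top sequentially"
    using filterlim_tendsto_pos_mult_at_top[OF tendsto_const q filterlim_real_sequentially]
    by (simp add: mult.commute)
  have slim: "filterlim (\<lambda>n. sqrt (real n * q)) at_top sequentially"
    by (rule filterlim_compose[OF sqrt_at_top lim])
  have G: "G \<longlonglongrightarrow> 0"
    unfolding G_def[abs_def] by (rule kernel_exp_tendsto_0[OF slim]) (use q in simp)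
  have G2: "G2 \<longlonglongrightarrow> 0"
    unfolding G2_def[abs_def]
  proof (rule kernel_exp_tendsto_0)
    show "filterlim (\<lambda>n. 2 * sqrt (real n * q)) at_top sequentially"
      by (rule filterlim_tendsto_pos_mult_at_top[OF tendsto_const _ slim]) simp
  qed (use q in simp)
  have inv: "(\<lambda>n. inverse (real n)) \<longlonglongrightarrow> 0"
    by (rule lim_inverse_n)
  have invq: "(\<lambda>n. inverse (real n * q)) \<longlonglongrightarrow> 0"
    by (rule tendsto_inverse_0_at_top[OF lim])
  define P1 where "P1 n = sqrt ((pi / 2) * (rho * (b * \<phi> / rho)\<^sup>2 / (real n)\<^sup>2
      + J * (xi * \<phi> / J)\<^sup>2 / (real n)^4 + \<theta>\<^sup>2 * G2 n))" for n
  define P2 where "P2 n = sqrt ((pi / 2) * (\<theta>\<^sup>2 / (c * (mu / rho)) * (G n)\<^sup>2 + \<theta>\<^sup>2 / (real n * q) * G2 n))" for n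
  have P1: "P1 \<longlonglongrightarrow> 0"
  proof -
    have "(\<lambda>n. sqrt ((pi / 2) * (rho * (b * \<phi> / rho)\<^sup>2 * (inverse (real n))\<^sup>2
      + J * (xi * \<phi> / J)\<^sup>2 * (inverse (real n))^4 + \<theta>\<^sup>2 * G2 n)))
      \<longlonglongrightarrow> sqrt ((pi / 2) * (rho * (b * \<phi> / rho)\<^sup>2 * 0\<^sup>2 + J * (xi * \<phi> / J)\<^sup>2 * 0^4 + \<theta>\<^sup>2 * 0))"
      by (intro tendsto_intros inv G2)
    moreover have "P1 = (\<lambda>n. sqrt ((pi / 2) * (rho * (b * \<phi> / rho)\<^sup>2 * (inverse (real n))\<^sup>2
      + J * (xi * \<phi> / J)\<^sup>2 * (inverse (real n))^4 + \<theta>\<^sup>2 * G2 n)))"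
      unfolding P1_def[abs_def] by (simp only: divide_inverse power_inverse)
    ultimately show ?thesis by simp
  qed
  have P2: "P2 \<longlonglongrightarrow> 0"
  proof -
    have "(\<lambda>n. sqrt ((pi / 2) * (\<theta>\<^sup>2 / (c * (mu / rho)) * (G n)\<^sup>2 + \<theta>\<^sup>2 * inverse (real n * q) * G2 n)))
      \<longlonglongrightarrow> sqrt ((pi / 2) * (\<theta>\<^sup>2 / (c * (mu / rho)) * 0\<^sup>2 + \<theta>\<^sup>2 * 0 * 0))"
      by (intro tendsto_intros invq G G2)
    moreover have "P2 = (\<lambda>n. sqrt ((pi / 2) * (\<theta>\<^sup>2 / (c * (mu / rho)) * (G n)\<^sup>2
        + \<theta>\<^sup>2 * inverse (real n * q) * G2 n)))"
      unfolding P2_def[abs_def] by (simp only: divide_inverse)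
    ultimately show ?thesis by simp
  qed
  have le: "sqrt (mu * pi / 2) \<le> K * (P1 n + P2 n + 2 * inverse (real n))" if n: "n > 0" for n
  proof -
    let ?n = "real n"
    obtain U W where UW: "DA \<kappa> U" "inH \<kappa> (A U)" "DA \<kappa> W" "inH \<kappa> (A W)"
      "N U \<ge> 0" "N W \<ge> sqrt (mu * pi / 2) * ?n"
      "N (st_lin 1 (A U) (- (?n * q)) W) \<le> ?n * P1 n"
      "N (st_lin 1 (A W) (?n * q) U) \<le> ?n * P2 n"
      by (rule mode_estimate[OF 1 2 n refl])
        (rule that; simp only: P1_def P2_def G_def G2_def q_def)
    have "sqrt (mu * pi / 2) * ?n \<le> N U + N W" using UW by linarith
    also have "\<dots> \<le> K * (N (st_lin 1 (A U) (- (?n * q)) W) + N (st_lin 1 (A W) (?n * q) U) + 2)"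
      by (rule K(2)[OF UW(1-4)])
    also have "\<dots> \<le> K * (?n * P1 n + ?n * P2 n + 2)"
      using K(1) UW by (intro mult_left_mono add_mono) auto
    also have "\<dots> = K * (P1 n + P2 n + 2 * inverse ?n) * ?n"
      using n by (simp add: field_simps)
    finally show ?thesis using n by simp
  qed
  have "sqrt (mu * pi / 2) \<le> K * (0 + 0 + 2 * 0)"
  proof (rule LIMSEQ_le_const)
    show "(\<lambda>n. K * (P1 n + P2 n + 2 * inverse (real n))) \<longlonglongrightarrow> K * (0 + 0 + 2 * 0)"
      by (intro tendsto_intros P1 P2 inv)
    show "\<exists>N. \<forall>n\<ge>N. sqrt (mu * pi / 2) \<le> K * (P1 n + P2 n + 2 * inverse (real n))"
      using le by (intro exI[of _ 1]) auto
  qed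
  moreover have "sqrt (mu * pi / 2) > 0" using pos by simp
  ultimately show False by simp
qed

end

theorem theorem4:
  fixes rho J c mu b alpha xi beta delta :: real
    and \<kappa> :: "real \<Rightarrow> real"
    and S :: "real \<Rightarrow> st \<Rightarrow> st"
  assumes pos: "rho > 0" "J > 0" "c > 0" "mu > 0" "b > 0" "alpha > 0" "xi > 0"
    and coupling: "mu * xi > b\<^sup>2"
    and beta: "beta \<noteq> 0"
    and h1: "continuous_on {0..} \<kappa>" "set_integrable lborel {0..} \<kappa>"
    and h2: "\<forall>s\<ge>0. \<kappa> s > 0" "\<forall>s>0. \<kappa> differentiable (at s) \<and> deriv \<kappa> s \<le> 0"
    and h4: "delta > 0" "\<forall>s>0. deriv \<kappa> s \<le> - delta * \<kappa> s"
    and cond: "gamma_g rho c mu \<kappa> = 0 \<or>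
               (gamma_g rho c mu \<kappa> \<noteq> 0 \<and> chi_g rho J c mu alpha beta \<kappa> \<noteq> 0)"
    and S: "generated_semigroup rho J c mu b alpha xi beta \<kappa> S"
  shows "\<not> (\<exists>C \<omega>. C > 0 \<and> \<omega> > 0 \<and>
            (\<forall>U t. inH \<kappa> U \<longrightarrow> t \<ge> 0 \<longrightarrow>
               Hnorm rho J c mu b alpha xi \<kappa> (S t U) \<le> C * exp (- \<omega> * t) * Hnorm rho J c mu b alpha xi \<kappa> U))"
proof -
  interpret porous \<kappa> rho J c mu b alpha xi beta
    by unfold_locales (use pos coupling h1 h2(1) in auto)
  let ?g = "gamma_g rho c mu \<kappa>"
  obtain \<phi> \<theta> where *: "(alpha - J * mu / rho) * \<phi> + beta * \<theta> = - b" "?g * \<theta> = beta * mu * \<phi>"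
  proof (cases "?g = 0")
    case True
    \<comment> \<open>With \<open>gamma_g = 0\<close> the second equation forces
      \<open>\<phi> = 0\<close>, and \<open>\<theta>\<close> alone balances \<open>b\<close>, which
      requires \<open>beta\<close> to be nonzero.\<close>
    then show ?thesis using that[of 0 "- b / beta"] beta by simp
  next
    case False
    \<comment> \<open>The coefficient of \<open>\<phi>\<close> after eliminating
      \<open>\<theta>\<close> by the second equation; \<open>chi_g\<close> is \<open>D\<close> up to
      the positive factor \<open>alpha mu / rho\<close>.\<close>
    define D where "D = alpha - J * mu / rho + beta\<^sup>2 * mu / ?g"
    have "D = alpha * mu / rho * chi_g rho J c mu alpha beta \<kappa>"
      unfolding D_def chi_g_def using pos False by (simp add: field_simps)
    then have D: "D \<noteq> 0" using cond False pos by simp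
    show ?thesis
    proof (rule that[of "- b / D" "beta * mu * (- b / D) / ?g"])
      have "(alpha - J * mu / rho) * y + beta * (beta * mu * y / ?g) = D * y" for y
        unfolding D_def by (simp add: power2_eq_square algebra_simps)
      from this[of "- b / D"] show "(alpha - J * mu / rho) * (- b / D) + beta * (beta * mu * (- b / D) / ?g) = - b"
        using D by simp
    qed (use False in simp)
  qed
  show ?thesis
    using not_exponentially_stable[OF S *] by blast
qed

end
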